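(* Let $(H,\alpha_H)$ be a Hom-Hopf algebra with bijective antipode $S$. Then $H$ is a right $H^{op}\otimes H$-comodule via $$\rho(h)=\alpha_H^{-1}(h_{12})\otimes S^{-1}\alpha_H^{-2}(h_{11})\otimes\alpha_H^{-1}(h_2),\qquad h\in H .$$ Define a left $H^{op}\otimes H$-action on $H$ by $(h\otimes g)\cdot l=(g\,\alpha_H^{-1}(l))\,\alpha_H(h)$. Then $(H^{op}\otimes H,H,H)$ is a Doi-Hopf datum. Moreover, there is an isomorphism of categories $${}_H\mathcal{M}(H^{op}\otimes H)^H\simeq{}_H\mathcal{YD}^H .$$
   Context: Work over a field $k$, $\otimes=\otimes_k$. All structure maps $\alpha$ below are assumed bijective. Hom-algebra $(A,\alpha_A)$: a linear multiplication, a unit $1_A$ and a linear $\alpha_A:A\to A$ with $\alpha_A(ab)=\alpha_A(a)\alpha_A(b)$, $\alpha_A(1_A)=1_A$, $1_Aa=\alpha_A(a)=a1_A$, $\alpha_A(a)(bc)=(ab)\alpha_A(c)$. Hom-coalgebra $(C,\alpha_C)$: linear $\Delta:C\to C\otimes C$, $\Delta(c)=c_1\otimes c_2$, $\varepsilon:C\to k$ and $\alpha_C$ with $\varepsilon\circ\alpha_C=\varepsilon$, $(\alpha_C\otimes\alpha_C)\Delta=\Delta\alpha_C$, $(\varepsilon\otimes id)\Delta=\alpha_C=(id\otimes\varepsilon)\Delta$, $(\Delta\otimes\alpha_C)\Delta=(\alpha_C\otimes\Delta)\Delta$. Hom-bialgebra: a Hom-algebra and Hom-coalgebra with the same $\alpha$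 such that $\Delta,\varepsilon$ are Hom-algebra morphisms. Hom-Hopf algebra: a Hom-bialgebra with a linear $S$, $S\alpha=\alpha S$, $S(h_1)h_2=h_1S(h_2)=\varepsilon(h)1$. Here $h_{11}\otimes h_{12}\otimes h_2=(\Delta\otimes id)\Delta(h)$ and $h_1\otimes h_{21}\otimes h_{22}=(id\otimes\Delta)\Delta(h)$. $H^{op}$ is $H$ with opposite multiplication and the same $\alpha_H,\Delta,\varepsilon$; $H^{op}\otimes H$ has the componentwise structure. Left $A$-module $(M,\alpha_M)$: linear $A\otimes M\to M$ with $1_A\cdot m=\alpha_M(m)$, $\alpha_M(a\cdot m)=\alpha_A(a)\cdot\alpha_M(m)$, $\alpha_A(a)\cdot(b\cdot m)=(ab)\cdot\alpha_M(m)$. Right $C$-comodule $(M,\alpha_M)$: linear $\rho:M\to M\otimes C$, $\rho(m)=m_{(0)}\otimes m_{(1)}$, with $(id\otimes\varepsilon)\rho=\alpha_M$, $(\alpha_M\otimes\alpha_C)\rho=\rho\alpha_M$, $(\rho\otimes\alpha_C)\rho=(\alpha_M\otimes\Delta)\rho$. (Co)module maps are (co)linear and commute with the $\alpha$'s. A (Hom-type) Doi-Hopf datum $(K,A,C)$ consists of a Hom-Hopf algebra $(K,\alpha_K)$, a right $K$-comodule algebra $(A,\alpha_A)$ (a Hom-algebra and right $K$-comodule, $\rho(a)=a_{(0)}\otimes a_{(1)}$, with $\rho(ab)=\rho(a)\rho(b)$, $\rho(1_A)=1_A\otimes1_K$) and a left $K$-module coalgebra $(C,\alpha_C)$ (a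 Hom-coalgebra and left $K$-module with $\Delta_C(h\cdot c)=h_1\cdot c_1\otimes h_2\cdot c_2$, $\varepsilon_C(h\cdot c)=\varepsilon_K(h)\varepsilon_C(c)$). A Doi-Hopf module over $(K,A,C)$ is $(M,\alpha_M)$ that is a left $A$-module and a right $C$-comodule with $\rho(a\cdot m)=a_{(0)}\cdot m_{(0)}\otimes a_{(1)}\cdot m_{(1)}$. ${}_A\mathcal{M}(K)^C$ is the category of these, with $A$-linear $C$-colinear maps. In the claim, $K=H^{op}\otimes H$, and both $A$ and $C$ are $H$ (as Hom-algebra, resp. Hom-coalgebra). ${}_H\mathcal{YD}^H$ is the category of left-right Yetter-Drinfeld modules: $(M,\alpha_M)$ that are left $H$-modules and right $H$-comodules such that for all $h\in H$, $m\in M$, $$\rho(h\cdot m)=\alpha_H^{-1}(h_{21})\cdot m_{(0)}\otimes[\alpha_H^{-2}(h_{22})\alpha_H^{-1}(m_{(1)})]S^{-1}(h_1),$$ with $H$-linear $H$-colinear maps. *)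

theory Defs
  imports "HOL-Algebra.Module" "HOL-Algebra.AbelCoset" "HOL-Library.FuncSet"
begin

section \<open>Tensor products of vector spaces\<close>

text \<open>
  A vector space over a field \<open>k\<close> is a record \<open>V\<close> with \<^term>\<open>module k V\<close>.
  The tensor product \<open>V \<otimes> W\<close> is the free vector space on \<open>carrier V \<times> carrier W\<close> modulo the
  subspace spanned by the bilinearity relations; its elements are cosets of finitely supported
  functions. The fields \<open>mult\<close> and \<open>one\<close>, which module records inherit from ring records, are
  left unspecified where only the vector space matters.
\<close>

type_synonym ('k, 'v, 'w) tensor = "('v \<times> 'w \<Rightarrow> 'k) set"

definition linear_map ::
  "('k, 'r) ring_scheme \<Rightarrow> ('k, 'v, 'x) module_scheme \<Rightarrow> ('k, 'w, 'y) module_scheme \<Rightarrow> ('v \<Rightarrow> 'w) \<Rightarrow> bool"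
  where "linear_map k V W f \<longleftrightarrow>
    f \<in> carrier V \<rightarrow> carrier W \<and>
    (\<forall>x\<in>carrier V. \<forall>y\<in>carrier V. f (x \<oplus>\<^bsub>V\<^esub> y) = f x \<oplus>\<^bsub>W\<^esub> f y) \<and>
    (\<forall>c\<in>carrier k. \<forall>x\<in>carrier V. f (c \<odot>\<^bsub>V\<^esub> x) = c \<odot>\<^bsub>W\<^esub> f x)"

definition bilinear_map ::
  "('k, 'r) ring_scheme \<Rightarrow> ('k, 'v, 'x) module_scheme \<Rightarrow> ('k, 'w, 'y) module_scheme \<Rightarrow>
    ('k, 'u, 'z) module_scheme \<Rightarrow> ('v \<Rightarrow> 'w \<Rightarrow> 'u) \<Rightarrow> bool"
  where "bilinear_map k V W U f \<longleftrightarrow>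
    (\<forall>v\<in>carrier V. linear_map k W U (f v)) \<and>
    (\<forall>w\<in>carrier W. linear_map k V U (\<lambda>v. f v w))"

definition free_space ::
  "('k, 'r) ring_scheme \<Rightarrow> ('k, 'v, 'x) module_scheme \<Rightarrow> ('k, 'w, 'y) module_scheme \<Rightarrow>
    ('k, 'v \<times> 'w \<Rightarrow> 'k) module"
  where "free_space k V W =
    \<lparr>carrier = {f. finite {p. f p \<noteq> \<zero>\<^bsub>k\<^esub>} \<and> {p. f p \<noteq> \<zero>\<^bsub>k\<^esub>} \<subseteq> carrier V \<times> carrier W \<and>
        range f \<subseteq> carrier k},
     mult = undefined, one = undefined,
     zero = (\<lambda>p. \<zero>\<^bsub>k\<^esub>),
     add = (\<lambda>f g p. f p \<oplus>\<^bsub>k\<^esub> g p),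
     smult = (\<lambda>c f p. c \<otimes>\<^bsub>k\<^esub> f p)\<rparr>"

definition basis_vec :: "('k, 'r) ring_scheme \<Rightarrow> 'v \<Rightarrow> 'w \<Rightarrow> 'v \<times> 'w \<Rightarrow> 'k"
  where "basis_vec k v w = (\<lambda>p. if p = (v, w) then \<one>\<^bsub>k\<^esub> else \<zero>\<^bsub>k\<^esub>)"

definition bilinearity_relations ::
  "('k, 'r) ring_scheme \<Rightarrow> ('k, 'v, 'x) module_scheme \<Rightarrow> ('k, 'w, 'y) module_scheme \<Rightarrow> ('v \<times> 'w \<Rightarrow> 'k) set"
  where "bilinearity_relations k V W = (let F = free_space k V W; e = basis_vec k in
    {e (v \<oplus>\<^bsub>V\<^esub> v') w \<ominus>\<^bsub>F\<^esub> (e v w \<oplus>\<^bsub>F\<^esub> e v' w) | v v' w.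
        v \<in> carrier V \<and> v' \<in> carrier V \<and> w \<in> carrier W} \<union>
    {e v (w \<oplus>\<^bsub>W\<^esub> w') \<ominus>\<^bsub>F\<^esub> (e v w \<oplus>\<^bsub>F\<^esub> e v w') | v w w'.
        v \<in> carrier V \<and> w \<in> carrier W \<and> w' \<in> carrier W} \<union>
    {e (c \<odot>\<^bsub>V\<^esub> v) w \<ominus>\<^bsub>F\<^esub> c \<odot>\<^bsub>F\<^esub> e v w | c v w.
        c \<in> carrier k \<and> v \<in> carrier V \<and> w \<in> carrier W} \<union>
    {e v (c \<odot>\<^bsub>W\<^esub> w) \<ominus>\<^bsub>F\<^esub> c \<odot>\<^bsub>F\<^esub> e v w | c v w.
        c \<in> carrier k \<and> v \<in> carrier V \<and> w \<in> carrier W})"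

definition tensor_null ::
  "('k, 'r) ring_scheme \<Rightarrow> ('k, 'v, 'x) module_scheme \<Rightarrow> ('k, 'w, 'y) module_scheme \<Rightarrow> ('v \<times> 'w \<Rightarrow> 'k) set"
  where "tensor_null k V W =
    \<Inter>{N. submodule N k (free_space k V W) \<and> bilinearity_relations k V W \<subseteq> N}"

definition tensor_space ::
  "('k, 'r) ring_scheme \<Rightarrow> ('k, 'v, 'x) module_scheme \<Rightarrow> ('k, 'w, 'y) module_scheme \<Rightarrow>
    ('k, ('k, 'v, 'w) tensor) module"
  where "tensor_space k V W = (let F = free_space k V W; N = tensor_null k V W in
    \<lparr>carrier = a_rcosets\<^bsub>F\<^esub> N,
     mult = undefined, one = undefined,
     zero = N,
     add = (\<lambda>s t. s <+>\<^bsub>F\<^esub> t),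
     smult = (\<lambda>c t. \<Union>r\<in>t. N +>\<^bsub>F\<^esub> (c \<odot>\<^bsub>F\<^esub> r))\<rparr>)"

text \<open>The pure tensor \<open>v \<otimes> w\<close>.\<close>

definition tpure ::
  "('k, 'r) ring_scheme \<Rightarrow> ('k, 'v, 'x) module_scheme \<Rightarrow> ('k, 'w, 'y) module_scheme \<Rightarrow>
    'v \<Rightarrow> 'w \<Rightarrow> ('k, 'v, 'w) tensor"
  where "tpure k V W v w = tensor_null k V W +>\<^bsub>free_space k V W\<^esub> basis_vec k v w"

text \<open>
  The linear map \<open>V \<otimes> W \<rightarrow> U\<close> induced by a bilinear map \<open>f\<close>, evaluated at \<open>t\<close>: if
  \<open>t = \<Sum>\<^sub>i c\<^sub>i v\<^sub>i \<otimes> w\<^sub>i\<close>, the value is \<open>\<Sum>\<^sub>i c\<^sub>i f(v\<^sub>i, w\<^sub>i)\<close>. For bilinear \<open>f\<close> the choice of the representative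
  of the coset \<open>t\<close> is immaterial. This is how Sweedler notation is rendered: an expression in
  \<open>h\<^sub>1\<close> and \<open>h\<^sub>2\<close> is \<open>tlift k U (\<lambda>h\<^sub>1 h\<^sub>2. \<dots>) (\<Delta> h)\<close>.
\<close>

definition tlift ::
  "('k, 'r) ring_scheme \<Rightarrow> ('k, 'u, 'z) module_scheme \<Rightarrow> ('v \<Rightarrow> 'w \<Rightarrow> 'u) \<Rightarrow> ('k, 'v, 'w) tensor \<Rightarrow> 'u"
  where "tlift k U f t = (let r = (SOME r. r \<in> t) in
    (\<Oplus>\<^bsub>U\<^esub>p\<in>{p. r p \<noteq> \<zero>\<^bsub>k\<^esub>}. r p \<odot>\<^bsub>U\<^esub> f (fst p) (snd p)))"

text \<open>The map \<open>f \<otimes> g\<close> with values in \<open>V \<otimes> W\<close>.\<close>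

definition tmap ::
  "('k, 'r) ring_scheme \<Rightarrow> ('k, 'v, 'x) module_scheme \<Rightarrow> ('k, 'w, 'y) module_scheme \<Rightarrow>
    ('a \<Rightarrow> 'v) \<Rightarrow> ('b \<Rightarrow> 'w) \<Rightarrow> ('k, 'a, 'b) tensor \<Rightarrow> ('k, 'v, 'w) tensor"
  where "tmap k V W f g = tlift k (tensor_space k V W) (\<lambda>a b. tpure k V W (f a) (g b))"

text \<open>The associativity isomorphism \<open>(U \<otimes> V) \<otimes> W \<rightarrow> U \<otimes> (V \<otimes> W)\<close>.\<close>

definition tassoc ::
  "('k, 'r) ring_scheme \<Rightarrow> ('k, 'u, 'x) module_scheme \<Rightarrow> ('k, 'v, 'y) module_scheme \<Rightarrow>
    ('k, 'w, 'z) module_scheme \<Rightarrow>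
    ('k, ('k, 'u, 'v) tensor, 'w) tensor \<Rightarrow> ('k, 'u, ('k, 'v, 'w) tensor) tensor"
  where "tassoc k U V W = (let VW = tensor_space k V W; T = tensor_space k U VW in
    tlift k T (\<lambda>s w. tlift k T (\<lambda>u v. tpure k U VW u (tpure k V W v w)) s))"


section \<open>Hom-structures\<close>

text \<open>
  \<open>twist\<close> is the structure map \<open>\<alpha>\<close>. A Hom-algebra uses the record fields \<open>mult\<close> and \<open>one\<close> for its
  (in general neither associative nor strictly unital) multiplication and its unit.
\<close>

record ('k, 'v) hom_space = "('k, 'v) module" +
  twist :: "'v \<Rightarrow> 'v"

record ('k, 'v) hom_coalg = "('k, 'v) hom_space" +
  comult :: "'v \<Rightarrow> ('k, 'v, 'v) tensor"
  counit :: "'v \<Rightarrow> 'k"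

record ('k, 'v) hom_hopf = "('k, 'v) hom_coalg" +
  antipode :: "'v \<Rightarrow> 'v"

definition twist_inv :: "('k, 'v, 'x) hom_space_scheme \<Rightarrow> 'v \<Rightarrow> 'v"
  where "twist_inv V = inv_into (carrier V) (twist V)"

definition antipode_inv :: "('k, 'v, 'x) hom_hopf_scheme \<Rightarrow> 'v \<Rightarrow> 'v"
  where "antipode_inv H = inv_into (carrier H) (antipode H)"

definition ground_space :: "('k, 'r) ring_scheme \<Rightarrow> ('k, 'k) hom_space"
  where "ground_space k =
    \<lparr>carrier = carrier k, mult = mult k, one = \<one>\<^bsub>k\<^esub>, zero = \<zero>\<^bsub>k\<^esub>, add = add k,
     smult = mult k, twist = (\<lambda>x. x)\<rparr>"

text \<open>Componentwise Hom-algebra structure on \<open>A \<otimes> B\<close>.\<close>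

definition tensor_alg ::
  "('k, 'r) ring_scheme \<Rightarrow> ('k, 'a, 'x) hom_space_scheme \<Rightarrow> ('k, 'b, 'y) hom_space_scheme \<Rightarrow>
    ('k, ('k, 'a, 'b) tensor) hom_space"
  where "tensor_alg k A B = (let T = tensor_space k A B in
    \<lparr>carrier = carrier T,
     mult = (\<lambda>s t. tlift k T (\<lambda>a b. tlift k T (\<lambda>a' b'.
        tpure k A B (a \<otimes>\<^bsub>A\<^esub> a') (b \<otimes>\<^bsub>B\<^esub> b')) t) s),
     one = tpure k A B \<one>\<^bsub>A\<^esub> \<one>\<^bsub>B\<^esub>,
     zero = \<zero>\<^bsub>T\<^esub>, add = add T, smult = smult T,
     twist = tmap k A B (twist A) (twist B)\<rparr>)"

text \<open>Componentwise structure on \<open>A \<otimes> B\<close>, with \<open>\<Delta>(a \<otimes> b) = (a\<^sub>1 \<otimes> b\<^sub>1) \<otimes> (a\<^sub>2 \<otimes> b\<^sub>2)\<close>.\<close>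

definition tensor_hopf ::
  "('k, 'r) ring_scheme \<Rightarrow> ('k, 'a, 'x) hom_hopf_scheme \<Rightarrow> ('k, 'b, 'y) hom_hopf_scheme \<Rightarrow>
    ('k, ('k, 'a, 'b) tensor) hom_hopf"
  where "tensor_hopf k A B =
    (let T = tensor_alg k A B; TT = tensor_space k T T in
    \<lparr>carrier = carrier T, mult = mult T, one = \<one>\<^bsub>T\<^esub>, zero = \<zero>\<^bsub>T\<^esub>, add = add T,
     smult = smult T, twist = twist T,
     comult = tlift k TT (\<lambda>a b.
        tlift k TT (\<lambda>a1 a2.
          tlift k TT (\<lambda>b1 b2. tpure k T T (tpure k A B a1 b1) (tpure k A B a2 b2))
            (comult B b))
          (comult A a)),
     counit = tlift k (ground_space k) (\<lambda>a b. counit A a \<otimes>\<^bsub>k\<^esub> counit B b),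
     antipode = tmap k A B (antipode A) (antipode B)\<rparr>)"

text \<open>The antipode of \<open>H\<^sup>o\<^sup>p\<close> is the inverse of the antipode of \<open>H\<close>.\<close>

definition op_hopf :: "('k, 'a, 'x) hom_hopf_scheme \<Rightarrow> ('k, 'a, 'x) hom_hopf_scheme"
  where "op_hopf H = H\<lparr>mult := (\<lambda>x y. y \<otimes>\<^bsub>H\<^esub> x), antipode := antipode_inv H\<rparr>"

locale hom_vector_space = k?: field k + V?: module k V for k (structure) and V (structure) +
  assumes twist_linear: "linear_map k V V (twist V)"
    and twist_bij: "bij_betw (twist V) (carrier V) (carrier V)"

locale hom_algebra = hom_vector_space k A for k (structure) and A (structure) +
  assumes mult_bilinear: "bilinear_map k A A A (mult A)"
    and one_closed: "\<one>\<^bsub>A\<^esub> \<in> carrier A"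
    and twist_mult: "\<lbrakk>a \<in> carrier A; b \<in> carrier A\<rbrakk> \<Longrightarrow>
      twist A (a \<otimes>\<^bsub>A\<^esub> b) = twist A a \<otimes>\<^bsub>A\<^esub> twist A b"
    and twist_one: "twist A \<one>\<^bsub>A\<^esub> = \<one>\<^bsub>A\<^esub>"
    and one_mult: "a \<in> carrier A \<Longrightarrow> \<one>\<^bsub>A\<^esub> \<otimes>\<^bsub>A\<^esub> a = twist A a"
    and mult_one: "a \<in> carrier A \<Longrightarrow> a \<otimes>\<^bsub>A\<^esub> \<one>\<^bsub>A\<^esub> = twist A a"
    and hom_assoc: "\<lbrakk>a \<in> carrier A; b \<in> carrier A; c \<in> carrier A\<rbrakk> \<Longrightarrow>
      twist A a \<otimes>\<^bsub>A\<^esub> (b \<otimes>\<^bsub>A\<^esub> c) = (a \<otimes>\<^bsub>A\<^esub> b) \<otimes>\<^bsub>A\<^esub> twist A c"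

definition hom_algebra_morphism ::
  "('k, 'r) ring_scheme \<Rightarrow> ('k, 'a, 'x) hom_space_scheme \<Rightarrow> ('k, 'b, 'y) hom_space_scheme \<Rightarrow>
    ('a \<Rightarrow> 'b) \<Rightarrow> bool"
  where "hom_algebra_morphism k A B f \<longleftrightarrow>
    linear_map k A B f \<and>
    (\<forall>x\<in>carrier A. \<forall>y\<in>carrier A. f (x \<otimes>\<^bsub>A\<^esub> y) = f x \<otimes>\<^bsub>B\<^esub> f y) \<and>
    f \<one>\<^bsub>A\<^esub> = \<one>\<^bsub>B\<^esub> \<and>
    (\<forall>x\<in>carrier A. f (twist A x) = twist B (f x))"

locale hom_coalgebra = hom_vector_space k C for k (structure) and C (structure) +
  assumes comult_linear: "linear_map k C (tensor_space k C C) (comult C)"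
    and counit_linear: "linear_map k C (ground_space k) (counit C)"
    and counit_twist: "c \<in> carrier C \<Longrightarrow> counit C (twist C c) = counit C c"
    and comult_twist: "c \<in> carrier C \<Longrightarrow>
      tmap k C C (twist C) (twist C) (comult C c) = comult C (twist C c)"
    and counit_left: "c \<in> carrier C \<Longrightarrow>
      tlift k C (\<lambda>c1 c2. counit C c1 \<odot>\<^bsub>C\<^esub> c2) (comult C c) = twist C c"
    and counit_right: "c \<in> carrier C \<Longrightarrow>
      tlift k C (\<lambda>c1 c2. counit C c2 \<odot>\<^bsub>C\<^esub> c1) (comult C c) = twist C c"
    and hom_coassoc: "c \<in> carrier C \<Longrightarrow>
      tassoc k C C C (tmap k (tensor_space k C C) C (comult C) (twist C) (comult C c)) =
      tmap k C (tensor_space k C C) (twist C) (comult C) (comult C c)"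

locale hom_bialgebra = hom_algebra k H + hom_coalgebra k H for k (structure) and H (structure) +
  assumes comult_morphism: "hom_algebra_morphism k H (tensor_alg k H H) (comult H)"
    and counit_morphism: "hom_algebra_morphism k H (ground_space k) (counit H)"

locale hom_hopf_algebra = hom_bialgebra k H for k (structure) and H (structure) +
  assumes antipode_linear: "linear_map k H H (antipode H)"
    and antipode_twist: "h \<in> carrier H \<Longrightarrow> antipode H (twist H h) = twist H (antipode H h)"
    and antipode_left: "h \<in> carrier H \<Longrightarrow>
      tlift k H (\<lambda>h1 h2. antipode H h1 \<otimes>\<^bsub>H\<^esub> h2) (comult H h) = counit H h \<odot>\<^bsub>H\<^esub> \<one>\<^bsub>H\<^esub>"
    and antipode_right: "h \<in> carrier H \<Longrightarrow>
      tlift k H (\<lambda>h1 h2. h1 \<otimes>\<^bsub>H\<^esub> antipode H h2) (comult H h) = counit H h \<odot>\<^bsub>H\<^esub> \<one>\<^bsub>H\<^esub>"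

locale hom_module = A?: hom_algebra k A + M?: hom_vector_space k M
  for k (structure) and A (structure) and M (structure) and action +
  assumes action_bilinear: "bilinear_map k A M M action"
    and action_one: "m \<in> carrier M \<Longrightarrow> action \<one>\<^bsub>A\<^esub> m = twist M m"
    and action_twist: "\<lbrakk>a \<in> carrier A; m \<in> carrier M\<rbrakk> \<Longrightarrow>
      twist M (action a m) = action (twist A a) (twist M m)"
    and action_mult: "\<lbrakk>a \<in> carrier A; b \<in> carrier A; m \<in> carrier M\<rbrakk> \<Longrightarrow>
      action (twist A a) (action b m) = action (a \<otimes>\<^bsub>A\<^esub> b) (twist M m)"

locale hom_comodule = C?: hom_coalgebra k C + M?: hom_vector_space k M
  for k (structure) and C (structure) and M (structure) and coaction +
  assumes coaction_linear: "linear_map k M (tensor_space k M C) coaction"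
    and coaction_counit: "m \<in> carrier M \<Longrightarrow>
      tlift k M (\<lambda>m0 m1. counit C m1 \<odot>\<^bsub>M\<^esub> m0) (coaction m) = twist M m"
    and coaction_twist: "m \<in> carrier M \<Longrightarrow>
      tmap k M C (twist M) (twist C) (coaction m) = coaction (twist M m)"
    and coaction_coassoc: "m \<in> carrier M \<Longrightarrow>
      tassoc k M C C (tmap k (tensor_space k M C) C coaction (twist C) (coaction m)) =
      tmap k M (tensor_space k C C) (twist M) (comult C) (coaction m)"


section \<open>Doi-Hopf data and Doi-Hopf modules\<close>

locale hom_comodule_algebra =
  hom_hopf_algebra k K + hom_algebra k A + hom_comodule k K A coaction
  for k (structure) and K (structure) and A (structure) and coaction +
  assumes coaction_mult: "\<lbrakk>a \<in> carrier A; b \<in> carrier A\<rbrakk> \<Longrightarrow>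
      coaction (a \<otimes>\<^bsub>A\<^esub> b) = coaction a \<otimes>\<^bsub>tensor_alg k A K\<^esub> coaction b"
    and coaction_one: "coaction \<one>\<^bsub>A\<^esub> = tpure k A K \<one>\<^bsub>A\<^esub> \<one>\<^bsub>K\<^esub>"

locale hom_module_coalgebra =
  hom_hopf_algebra k K + hom_coalgebra k C + hom_module k K C action
  for k (structure) and K (structure) and C (structure) and action +
  assumes action_comult: "\<lbrakk>h \<in> carrier K; c \<in> carrier C\<rbrakk> \<Longrightarrow>
      comult C (action h c) =
      tlift k (tensor_space k C C) (\<lambda>h1 h2.
        tlift k (tensor_space k C C) (\<lambda>c1 c2. tpure k C C (action h1 c1) (action h2 c2))
          (comult C c))
        (comult K h)"
    and action_counit: "\<lbrakk>h \<in> carrier K; c \<in> carrier C\<rbrakk> \<Longrightarrow>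
      counit C (action h c) = counit K h \<otimes>\<^bsub>k\<^esub> counit C c"

locale doi_hopf_datum =
  hom_comodule_algebra k K A coaction + hom_module_coalgebra k K C action
  for k (structure) and K (structure) and A (structure) and coaction
    and C (structure) and action

text \<open>A vector space with structure map, action of \<open>A\<close> (on \<open>'a\<close>) and coaction of \<open>C\<close> (on \<open>'c\<close>).\<close>

record ('k, 'a, 'c, 'm) act_coact_space = "('k, 'm) hom_space" +
  act :: "'a \<Rightarrow> 'm \<Rightarrow> 'm"
  coact :: "'m \<Rightarrow> ('k, 'm, 'c) tensor"

definition doi_hopf_module ::
  "('k, 'r) ring_scheme \<Rightarrow> ('k, 'a, 'x) hom_space_scheme \<Rightarrow> ('a \<Rightarrow> ('k, 'a, 'h) tensor) \<Rightarrow>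
    ('k, 'c, 'y) hom_coalg_scheme \<Rightarrow> ('h \<Rightarrow> 'c \<Rightarrow> 'c) \<Rightarrow> ('k, 'a, 'c, 'm) act_coact_space \<Rightarrow> bool"
  where "doi_hopf_module k A coaction C action M \<longleftrightarrow>
    hom_module k A M (act M) \<and>
    hom_comodule k C M (coact M) \<and>
    (\<forall>a\<in>carrier A. \<forall>m\<in>carrier M.
      coact M (act M a m) =
      tlift k (tensor_space k M C) (\<lambda>a0 a1.
        tlift k (tensor_space k M C) (\<lambda>m0 m1. tpure k M C (act M a0 m0) (action a1 m1))
          (coact M m))
        (coaction a))"

definition yetter_drinfeld_module ::
  "('k, 'r) ring_scheme \<Rightarrow> ('k, 'h, 'x) hom_hopf_scheme \<Rightarrow> ('k, 'h, 'h, 'm) act_coact_space \<Rightarrow> bool"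
  where "yetter_drinfeld_module k H M \<longleftrightarrow>
    hom_module k H M (act M) \<and>
    hom_comodule k H M (coact M) \<and>
    (\<forall>h\<in>carrier H. \<forall>m\<in>carrier M.
      coact M (act M h m) =
      tlift k (tensor_space k M H) (\<lambda>h1 h2.
        tlift k (tensor_space k M H) (\<lambda>h21 h22.
          tlift k (tensor_space k M H) (\<lambda>m0 m1.
            tpure k M H
              (act M (twist_inv H h21) m0)
              ((twist_inv H (twist_inv H h22) \<otimes>\<^bsub>H\<^esub> twist_inv H m1) \<otimes>\<^bsub>H\<^esub> antipode_inv H h1))
            (coact M m))
          (comult H h2))
        (comult H h))"


section \<open>Categories\<close>

text \<open>Arrows are indexed by their domain and codomain; hom-sets need not be disjoint.\<close>

record ('o, 'f) category =
  Obj :: "'o set"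
  Arr :: "'o \<Rightarrow> 'o \<Rightarrow> 'f set"
  Idt :: "'o \<Rightarrow> 'f"
  Cmp :: "'o \<Rightarrow> 'o \<Rightarrow> 'o \<Rightarrow> 'f \<Rightarrow> 'f \<Rightarrow> 'f"  \<comment> \<open>\<open>Cmp C X Y Z g f\<close> is \<open>g \<circ> f\<close> for \<open>f : X \<rightarrow> Y\<close> and \<open>g : Y \<rightarrow> Z\<close>\<close>

locale is_category =
  fixes C :: "('o, 'f) category"
  assumes Idt_closed: "X \<in> Obj C \<Longrightarrow> Idt C X \<in> Arr C X X"
    and Cmp_closed: "\<lbrakk>X \<in> Obj C; Y \<in> Obj C; Z \<in> Obj C; f \<in> Arr C X Y; g \<in> Arr C Y Z\<rbrakk> \<Longrightarrow>
      Cmp C X Y Z g f \<in> Arr C X Z"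
    and Cmp_Idt: "\<lbrakk>X \<in> Obj C; Y \<in> Obj C; f \<in> Arr C X Y\<rbrakk> \<Longrightarrow> Cmp C X X Y f (Idt C X) = f"
    and Idt_Cmp: "\<lbrakk>X \<in> Obj C; Y \<in> Obj C; f \<in> Arr C X Y\<rbrakk> \<Longrightarrow> Cmp C X Y Y (Idt C Y) f = f"
    and Cmp_assoc: "\<lbrakk>W \<in> Obj C; X \<in> Obj C; Y \<in> Obj C; Z \<in> Obj C;
      f \<in> Arr C W X; g \<in> Arr C X Y; h \<in> Arr C Y Z\<rbrakk> \<Longrightarrow>
      Cmp C W X Z (Cmp C X Y Z h g) f = Cmp C W Y Z h (Cmp C W X Y g f)"

locale is_functor = C: is_category C + D: is_category D
  for C :: "('o, 'f) category" and D :: "('p, 'g) category" +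
  fixes Fo :: "'o \<Rightarrow> 'p" and Fa :: "'o \<Rightarrow> 'o \<Rightarrow> 'f \<Rightarrow> 'g"
  assumes Fo_closed: "X \<in> Obj C \<Longrightarrow> Fo X \<in> Obj D"
    and Fa_closed: "\<lbrakk>X \<in> Obj C; Y \<in> Obj C; f \<in> Arr C X Y\<rbrakk> \<Longrightarrow> Fa X Y f \<in> Arr D (Fo X) (Fo Y)"
    and Fa_Idt: "X \<in> Obj C \<Longrightarrow> Fa X X (Idt C X) = Idt D (Fo X)"
    and Fa_Cmp: "\<lbrakk>X \<in> Obj C; Y \<in> Obj C; Z \<in> Obj C; f \<in> Arr C X Y; g \<in> Arr C Y Z\<rbrakk> \<Longrightarrow>
      Fa X Z (Cmp C X Y Z g f) = Cmp D (Fo X) (Fo Y) (Fo Z) (Fa Y Z g) (Fa X Y f)"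

definition isomorphic_categories :: "('o, 'f) category \<Rightarrow> ('p, 'g) category \<Rightarrow> bool"
  where "isomorphic_categories C D \<longleftrightarrow>
    (\<exists>Fo Fa Go Ga. is_functor C D Fo Fa \<and> is_functor D C Go Ga \<and>
      (\<forall>X\<in>Obj C. Go (Fo X) = X) \<and>
      (\<forall>X\<in>Obj C. \<forall>Y\<in>Obj C. \<forall>f\<in>Arr C X Y. Ga (Fo X) (Fo Y) (Fa X Y f) = f) \<and>
      (\<forall>X\<in>Obj D. Fo (Go X) = X) \<and>
      (\<forall>X\<in>Obj D. \<forall>Y\<in>Obj D. \<forall>f\<in>Arr D X Y. Fa (Go X) (Go Y) (Ga X Y f) = f))"

text \<open>
  Operations are total functions, so their values off the carriers are normalised to
  \<^const>\<open>undefined\<close>, as are the unused ring fields. This makes equality of records coincide with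
  equality of objects. Arrows are likewise extensional functions.
\<close>

definition canonical ::
  "('k, 'r) ring_scheme \<Rightarrow> ('k, 'a, 'x) hom_space_scheme \<Rightarrow> ('k, 'a, 'c, 'm) act_coact_space \<Rightarrow> bool"
  where "canonical k A M \<longleftrightarrow>
    mult M = undefined \<and> one M = undefined \<and>
    (\<lambda>(x, y). x \<oplus>\<^bsub>M\<^esub> y) \<in> extensional (carrier M \<times> carrier M) \<and>
    (\<lambda>(c, x). c \<odot>\<^bsub>M\<^esub> x) \<in> extensional (carrier k \<times> carrier M) \<and>
    twist M \<in> extensional (carrier M) \<and>
    (\<lambda>(a, x). act M a x) \<in> extensional (carrier A \<times> carrier M) \<and>
    coact M \<in> extensional (carrier M)"

definition linear_colinear_maps ::
  "('k, 'r) ring_scheme \<Rightarrow> ('k, 'a, 'x) hom_space_scheme \<Rightarrow> ('k, 'c, 'y) hom_coalg_scheme \<Rightarrow>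
    ('k, 'a, 'c, 'm) act_coact_space \<Rightarrow> ('k, 'a, 'c, 'm) act_coact_space \<Rightarrow> ('m \<Rightarrow> 'm) set"
  where "linear_colinear_maps k A C M N =
    {f \<in> extensional (carrier M).
      linear_map k M N f \<and>
      (\<forall>m\<in>carrier M. f (twist M m) = twist N (f m)) \<and>
      (\<forall>a\<in>carrier A. \<forall>m\<in>carrier M. f (act M a m) = act N a (f m)) \<and>
      (\<forall>m\<in>carrier M. tmap k N C f (\<lambda>c. c) (coact M m) = coact N (f m))}"

definition act_coact_category ::
  "('k, 'r) ring_scheme \<Rightarrow> ('k, 'a, 'x) hom_space_scheme \<Rightarrow> ('k, 'c, 'y) hom_coalg_scheme \<Rightarrow>
    (('k, 'a, 'c, 'm) act_coact_space \<Rightarrow> bool) \<Rightarrow>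
    (('k, 'a, 'c, 'm) act_coact_space, 'm \<Rightarrow> 'm) category"
  where "act_coact_category k A C P =
    \<lparr>Obj = {M. canonical k A M \<and> P M},
     Arr = linear_colinear_maps k A C,
     Idt = (\<lambda>M. \<lambda>m\<in>carrier M. m),
     Cmp = (\<lambda>L M N g f. compose (carrier L) g f)\<rparr>"

text \<open>
  \<open>\<^sub>A\<M>(K)\<^sup>C\<close> and \<open>\<^sub>H\<Y>\<D>\<^sup>H\<close>, with underlying sets drawn from the type \<open>'m\<close>. The Hopf algebra
  \<open>K\<close> enters the former only through its coaction on \<open>A\<close> and its action on \<open>C\<close>.
\<close>

definition doi_hopf_category ::
  "('k, 'r) ring_scheme \<Rightarrow> ('k, 'a, 'x) hom_space_scheme \<Rightarrow> ('a \<Rightarrow> ('k, 'a, 'h) tensor) \<Rightarrow>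
    ('k, 'c, 'y) hom_coalg_scheme \<Rightarrow> ('h \<Rightarrow> 'c \<Rightarrow> 'c) \<Rightarrow>
    (('k, 'a, 'c, 'm) act_coact_space, 'm \<Rightarrow> 'm) category"
  where "doi_hopf_category k A coaction C action =
    act_coact_category k A C (doi_hopf_module k A coaction C action)"

definition yetter_drinfeld_category ::
  "('k, 'r) ring_scheme \<Rightarrow> ('k, 'h, 'x) hom_hopf_scheme \<Rightarrow>
    (('k, 'h, 'h, 'm) act_coact_space, 'm \<Rightarrow> 'm) category"
  where "yetter_drinfeld_category k H = act_coact_category k H H (yetter_drinfeld_module k H)"


section \<open>The coaction and action of \<open>H\<^sup>o\<^sup>p \<otimes> H\<close> on \<open>H\<close>\<close>

definition op_tensor_hopf ::
  "('k, 'r) ring_scheme \<Rightarrow> ('k, 'h, 'x) hom_hopf_scheme \<Rightarrow> ('k, ('k, 'h, 'h) tensor) hom_hopf"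
  where "op_tensor_hopf k H = tensor_hopf k (op_hopf H) H"

definition yd_coaction ::
  "('k, 'r) ring_scheme \<Rightarrow> ('k, 'h, 'x) hom_hopf_scheme \<Rightarrow> 'h \<Rightarrow> ('k, 'h, ('k, 'h, 'h) tensor) tensor"
  where "yd_coaction k H h =
    (let K = op_tensor_hopf k H; T = tensor_space k H K in
      tlift k T (\<lambda>h1 h2.
        tlift k T (\<lambda>h11 h12.
          tpure k H K (twist_inv H h12)
            (tpure k (op_hopf H) H
              (antipode_inv H (twist_inv H (twist_inv H h11)))
              (twist_inv H h2)))
          (comult H h1))
        (comult H h))"

definition yd_action ::
  "('k, 'r) ring_scheme \<Rightarrow> ('k, 'h, 'x) hom_hopf_scheme \<Rightarrow> ('k, 'h, 'h) tensor \<Rightarrow> 'h \<Rightarrow> 'h"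
  where "yd_action k H t l =
    tlift k H (\<lambda>h g. (g \<otimes>\<^bsub>H\<^esub> twist_inv H l) \<otimes>\<^bsub>H\<^esub> twist H h) t"

end

theory Submission
  imports Defs
begin

text \<open>
  Since \<open>\<alpha>\<close> is bijective, \<open>a b\<close> can be replaced by \<open>\<alpha>\<^sup>-\<^sup>1(a b)\<close> and \<open>\<Delta>\<close> by
  \<open>\<Delta>' = \<Delta> \<circ> \<alpha>\<^sup>-\<^sup>1\<close>. The result is an ordinary Hopf algebra on which \<open>\<alpha>\<close> acts as an automorphism.
  In particular \<open>\<Delta>'\<close> is strictly coassociative, so the factors of an iterated coproduct can be numbered
  from left to right without recording brackets. In this numbering, with the products still taken in \<open>H\<close>,
  the coaction and the action of \<open>K = H\<^sup>o\<^sup>p \<otimes> H\<close> read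

    \<open>\<rho>(h) = \<alpha>(h\<^sub>2) \<otimes> (S\<^sup>-\<^sup>1(h\<^sub>1) \<otimes> h\<^sub>3)\<close>,   \<open>(h \<otimes> g) \<cdot> l = (g \<alpha>\<^sup>-\<^sup>1(l)) \<alpha>(h)\<close>.

  Substituting them in \<open>h\<^sub>(\<^sub>0\<^sub>) \<cdot> m\<^sub>(\<^sub>0\<^sub>) \<otimes> h\<^sub>(\<^sub>1\<^sub>) \<cdot> m\<^sub>(\<^sub>1\<^sub>)\<close>
  gives \<open>\<alpha>(h\<^sub>2) \<cdot> m\<^sub>(\<^sub>0\<^sub>) \<otimes> (h\<^sub>3 \<alpha>\<^sup>-\<^sup>1(m\<^sub>(\<^sub>1\<^sub>))) \<alpha>(S\<^sup>-\<^sup>1(h\<^sub>1))\<close>, and the right-hand side of the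
  Yetter-Drinfeld condition is the same expression with the other bracketing of \<open>h\<^sub>1, h\<^sub>2, h\<^sub>3\<close>
  (\<open>doi_hopf_compatibility_eq\<close>). So the two categories have the same objects and the same arrows, and the
  isomorphism is the identity; what remains for it is that they are categories at all
  (\<open>is_category_act_coact\<close>).

  That \<open>(K, H, H)\<close> is a Doi-Hopf datum comes down to the following. The opposite of \<open>H\<close> is a Hom-Hopf
  algebra with antipode \<open>S\<^sup>-\<^sup>1\<close>, and a tensor product of Hom-Hopf algebras is one
  (\<open>hom_hopf_algebra_tensor_hopf\<close>). The coaction is coassociative because \<open>S\<^sup>-\<^sup>1\<close> reverses coproducts:
  both sides of the axiom run over the same five-fold coproduct (\<open>hom_comodule_yd\<close>). It is multiplicative
  because \<open>S\<^sup>-\<^sup>1\<close> reverses products and so does \<open>H\<^sup>o\<^sup>p\<close> (\<open>hom_comodule_algebra_yd\<close>). The action is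
  a two-sided multiplication, hence compatible with \<open>\<Delta>\<close> because \<open>\<Delta>\<close> is multiplicative
  (\<open>hom_module_coalgebra_yd\<close>). That \<open>S\<close> reverses products and coproducts follows from the uniqueness of
  convolution inverses (\<open>convolution_inverse_unique\<close>), applied to maps \<open>H \<otimes> H \<rightarrow> H\<close> and
  \<open>H \<rightarrow> H \<otimes> H\<close>.

  Sweedler notation is rendered by \<open>tsum\<close>: an iterated coproduct becomes a nest of such sums, and a
  calculation consists of exchanging independent sums (\<open>tsum_swap\<close>), pulling linear maps through a sum
  (\<open>linear_map_tsum\<close>), regrouping by coassociativity (\<open>tsum_coassoc\<close>, \<open>sw_coassoc\<close>), and cancelling by
  the counit and the antipode. The multilinearity hypotheses of these steps are
  left to the simplifier: there is one rule, with a name beginning with \<open>lin\<close>, for every way of building a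
  linear map from others, and a nested expression is linear in a variable that occurs once in it by
  following its syntax. An identity between linear maps on a tensor product is
  checked on pure tensors (\<open>tensor_linear_ext\<close>).
\<close>

section \<open>Linear maps\<close>

lemma linear_mapI:
  assumes "\<And>x. x \<in> carrier V \<Longrightarrow> f x \<in> carrier W"
    and "\<And>x y. \<lbrakk>x \<in> carrier V; y \<in> carrier V\<rbrakk> \<Longrightarrow> f (x \<oplus>\<^bsub>V\<^esub> y) = f x \<oplus>\<^bsub>W\<^esub> f y"
    and "\<And>c x. \<lbrakk>c \<in> carrier k; x \<in> carrier V\<rbrakk> \<Longrightarrow> f (c \<odot>\<^bsub>V\<^esub> x) = c \<odot>\<^bsub>W\<^esub> f x"
  shows "linear_map k V W f"
  using assms unfolding linear_map_def by blast

lemma linear_mapD: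
  assumes "linear_map k V W f"
  shows linear_map_closed: "x \<in> carrier V \<Longrightarrow> f x \<in> carrier W"
    and linear_map_add: "\<lbrakk>x \<in> carrier V; y \<in> carrier V\<rbrakk> \<Longrightarrow> f (x \<oplus>\<^bsub>V\<^esub> y) = f x \<oplus>\<^bsub>W\<^esub> f y"
    and linear_map_smult: "\<lbrakk>c \<in> carrier k; x \<in> carrier V\<rbrakk> \<Longrightarrow> f (c \<odot>\<^bsub>V\<^esub> x) = c \<odot>\<^bsub>W\<^esub> f x"
  using assms unfolding linear_map_def by blast+

lemma bilinear_mapI:
  assumes "\<And>v. v \<in> carrier V \<Longrightarrow> linear_map k W U (\<lambda>w. f v w)"
    and "\<And>w. w \<in> carrier W \<Longrightarrow> linear_map k V U (\<lambda>v. f v w)"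
  shows "bilinear_map k V W U f"
  using assms unfolding bilinear_map_def by blast

lemma bilinear_mapD:
  assumes "bilinear_map k V W U f"
  shows bilinear_map_closed: "\<lbrakk>v \<in> carrier V; w \<in> carrier W\<rbrakk> \<Longrightarrow> f v w \<in> carrier U"
    and bilinear_map_right: "v \<in> carrier V \<Longrightarrow> linear_map k W U (f v)"
    and bilinear_map_left: "w \<in> carrier W \<Longrightarrow> linear_map k V U (\<lambda>v. f v w)"
  using assms linear_map_closed unfolding bilinear_map_def by (blast intro: linear_map_closed)+

lemma linear_map_id: "linear_map k V V (\<lambda>x. x)"
  by (rule linear_mapI) auto

lemma linear_map_comp:
  assumes "linear_map k V W f" "linear_map k U V g"
  shows "linear_map k U W (\<lambda>x. f (g x))"
  by (rule linear_mapI) (use assms in \<open>auto simp: linear_mapD[OF assms(1)] linear_mapD[OF assms(2)]\<close>)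

lemma bilinear_map_comp:
  assumes F: "bilinear_map k V W U F" and f: "linear_map k X V f" and g: "linear_map k Y W g"
  shows "bilinear_map k X Y U (\<lambda>x y. F (f x) (g y))"
proof (rule bilinear_mapI)
  show "linear_map k Y U (\<lambda>y. F (f x) (g y))" if "x \<in> carrier X" for x
    by (rule linear_map_comp[OF bilinear_map_right[OF F linear_map_closed[OF f that]] g])
  show "linear_map k X U (\<lambda>x. F (f x) (g y))" if "y \<in> carrier Y" for y
    by (rule linear_map_comp[OF bilinear_map_left[OF F linear_map_closed[OF g that]] f])
qed

lemma linear_map_cong:
  assumes "linear_map k V W f" "module k V" "\<And>x. x \<in> carrier V \<Longrightarrow> f x = g x"
  shows "linear_map k V W g"
proof -
  interpret module k V by fact
  show ?thesis
    by (rule linear_mapI) (use assms linear_mapD[OF assms(1)] in \<open>auto simp flip: assms(3)\<close>)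
qed

lemma linear_map_zero:
  assumes "linear_map k V W f" "module k V" "module k W"
  shows "f \<zero>\<^bsub>V\<^esub> = \<zero>\<^bsub>W\<^esub>"
proof -
  interpret V: module k V by fact
  interpret W: module k W by fact
  have "f \<zero>\<^bsub>V\<^esub> = f (\<zero>\<^bsub>k\<^esub> \<odot>\<^bsub>V\<^esub> \<zero>\<^bsub>V\<^esub>)" by simp
  also have "\<dots> = \<zero>\<^bsub>k\<^esub> \<odot>\<^bsub>W\<^esub> f \<zero>\<^bsub>V\<^esub>"
    using linear_map_smult[OF assms(1)] by blast
  also have "\<dots> = \<zero>\<^bsub>W\<^esub>"
    using linear_map_closed[OF assms(1)] by simp
  finally show ?thesis .
qed

lemma linear_map_finsum:
  assumes f: "linear_map k V W f" and "module k V" "module k W"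
    and "finite S" "g \<in> S \<rightarrow> carrier V"
  shows "f (\<Oplus>\<^bsub>V\<^esub>i\<in>S. g i) = (\<Oplus>\<^bsub>W\<^esub>i\<in>S. f (g i))"
proof -
  interpret V: module k V by fact
  interpret W: module k W by fact
  show ?thesis
    using assms(4,5)
  proof (induction S rule: finite_induct)
    case empty
    then show ?case using linear_map_zero[OF f assms(2,3)] by (simp add: V.finsum_empty W.finsum_empty)
  next
    case (insert x S)
    then show ?case
      by (simp add: linear_mapD[OF f] Pi_iff)
  qed
qed

lemma (in abelian_monoid) finsum_swap:
  assumes "finite A" "finite B" "\<And>a b. \<lbrakk>a \<in> A; b \<in> B\<rbrakk> \<Longrightarrow> f a b \<in> carrier G"
  shows "(\<Oplus>a\<in>A. \<Oplus>b\<in>B. f a b) = (\<Oplus>b\<in>B. \<Oplus>a\<in>A. f a b)"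
  using assms(1,3)
proof (induction A rule: finite_induct)
  case empty
  then show ?case by (simp add: finsum_zero)
next
  case (insert x A)
  then show ?case
    using assms(2) by (subst finsum_insert) (auto simp flip: finsum_addf intro!: finsum_cong' finsum_closed)
qed


section \<open>The free vector space on pairs\<close>

context
  fixes k :: "('k, 'r) ring_scheme" and V :: "('k, 'v, 'x) module_scheme"
    and W :: "('k, 'w, 'y) module_scheme"
  assumes k: "cring k"
begin

interpretation k: cring k by (rule k)

private abbreviation (input) "F \<equiv> free_space k V W"

lemma free_space_simps:
  "r \<in> carrier F \<longleftrightarrow> finite {p. r p \<noteq> \<zero>\<^bsub>k\<^esub>} \<and> {p. r p \<noteq> \<zero>\<^bsub>k\<^esub>} \<subseteq> carrier V \<times> carrier W \<and>
     (\<forall>p. r p \<in> carrier k)"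
  "r \<oplus>\<^bsub>F\<^esub> s = (\<lambda>p. r p \<oplus>\<^bsub>k\<^esub> s p)"
  "c \<odot>\<^bsub>F\<^esub> r = (\<lambda>p. c \<otimes>\<^bsub>k\<^esub> r p)"
  "\<zero>\<^bsub>F\<^esub> = (\<lambda>p. \<zero>\<^bsub>k\<^esub>)"
  by (auto simp: free_space_def)

lemma free_space_val: "r \<in> carrier F \<Longrightarrow> r p \<in> carrier k"
  by (simp add: free_space_simps del: split_paired_All)

lemma free_spaceI:
  assumes "finite S" "S \<subseteq> carrier V \<times> carrier W" "\<And>p. r p \<in> carrier k"
    and "\<And>p. p \<notin> S \<Longrightarrow> r p = \<zero>\<^bsub>k\<^esub>"
  shows "r \<in> carrier F"
proof -
  have "{p. r p \<noteq> \<zero>\<^bsub>k\<^esub>} \<subseteq> S"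
    using assms(4) by blast
  with assms(1,2) have "finite {p. r p \<noteq> \<zero>\<^bsub>k\<^esub>}" "{p. r p \<noteq> \<zero>\<^bsub>k\<^esub>} \<subseteq> carrier V \<times> carrier W"
    by (blast intro: finite_subset)+
  with assms(3) show ?thesis
    by (simp add: free_space_simps(1))
qed

lemma free_space_support:
  assumes "r \<in> carrier F"
  shows "finite {p. r p \<noteq> \<zero>\<^bsub>k\<^esub>}" "{p. r p \<noteq> \<zero>\<^bsub>k\<^esub>} \<subseteq> carrier V \<times> carrier W"
  using assms by (simp_all add: free_space_simps(1))

lemma free_space_add_closed:
  assumes "r \<in> carrier F" "s \<in> carrier F"
  shows "r \<oplus>\<^bsub>F\<^esub> s \<in> carrier F"
  using free_space_support[OF assms(1)] free_space_support[OF assms(2)]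
  by (intro free_spaceI[of "{p. r p \<noteq> \<zero>\<^bsub>k\<^esub>} \<union> {p. s p \<noteq> \<zero>\<^bsub>k\<^esub>}"])
     (simp_all add: free_space_simps(2) free_space_val assms)

lemma free_space_smult_closed:
  assumes "c \<in> carrier k" "r \<in> carrier F"
  shows "c \<odot>\<^bsub>F\<^esub> r \<in> carrier F"
  using free_space_support[OF assms(2)]
  by (intro free_spaceI[of "{p. r p \<noteq> \<zero>\<^bsub>k\<^esub>}"])
     (simp_all add: free_space_simps(3) free_space_val assms)

lemma free_space_module: "module k F"
proof (rule moduleI[OF k], goal_cases)
  case 1
  have neg: "\<exists>s\<in>carrier F. s \<oplus>\<^bsub>F\<^esub> r = \<zero>\<^bsub>F\<^esub>" if r: "r \<in> carrier F" for r
  proof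
    have "(\<ominus>\<^bsub>k\<^esub> r p = \<zero>\<^bsub>k\<^esub>) = (r p = \<zero>\<^bsub>k\<^esub>)" for p
      using free_space_val[OF r, of p] by (metis k.minus_minus k.minus_zero)
    then show "(\<lambda>p. \<ominus>\<^bsub>k\<^esub> r p) \<in> carrier F"
      using r unfolding free_space_simps by (simp del: split_paired_All)
    show "(\<lambda>p. \<ominus>\<^bsub>k\<^esub> r p) \<oplus>\<^bsub>F\<^esub> r = \<zero>\<^bsub>F\<^esub>"
      using free_space_val[OF r] by (simp add: free_space_simps k.l_neg)
  qed
  show ?case
  proof (rule abelian_groupI, goal_cases)
    case 1 then show ?case by (rule free_space_add_closed)
  next
    case 6 then show ?case by (rule neg)
  qed (auto simp: free_space_simps(2-) free_space_val k.a_ac, simp add: free_space_simps)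
next
  case (2 c r)
  then show ?case by (rule free_space_smult_closed)
qed (auto simp: free_space_simps(2-) free_space_val k.l_distr k.r_distr k.m_assoc)

lemma basis_vec_closed:
  assumes "v \<in> carrier V" "w \<in> carrier W"
  shows "basis_vec k v w \<in> carrier F"
  by (rule free_spaceI[of "{(v, w)}"]) (use assms in \<open>auto simp: basis_vec_def\<close>)

text \<open>
  This is what \<^const>\<open>tlift\<close> computes from the representative that it chooses. Being linear on the free
  space, it can be compared on two representatives of a coset.
\<close>

definition free_ext :: "('k, 'u, 'z) module_scheme \<Rightarrow> ('v \<Rightarrow> 'w \<Rightarrow> 'u) \<Rightarrow> ('v \<times> 'w \<Rightarrow> 'k) \<Rightarrow> 'u"
  where "free_ext U f r = (\<Oplus>\<^bsub>U\<^esub>p\<in>{p. r p \<noteq> \<zero>\<^bsub>k\<^esub>}. r p \<odot>\<^bsub>U\<^esub> f (fst p) (snd p))"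

context
  fixes U :: "('k, 'u, 'z) module_scheme" and f :: "'v \<Rightarrow> 'w \<Rightarrow> 'u"
  assumes U: "module k U"
    and f: "\<And>v w. \<lbrakk>v \<in> carrier V; w \<in> carrier W\<rbrakk> \<Longrightarrow> f v w \<in> carrier U"
begin

interpretation U: module k U by (rule U)

lemma free_ext_superset:
  assumes "r \<in> carrier F" "finite S" "{p. r p \<noteq> \<zero>\<^bsub>k\<^esub>} \<subseteq> S" "S \<subseteq> carrier V \<times> carrier W"
  shows "free_ext U f r = (\<Oplus>\<^bsub>U\<^esub>p\<in>S. r p \<odot>\<^bsub>U\<^esub> f (fst p) (snd p))"
  unfolding free_ext_def
proof (rule U.add.finprod_mono_neutral_cong_left)
  show "finite S" "{p. r p \<noteq> \<zero>\<^bsub>k\<^esub>} \<subseteq> S" by fact+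
  show "r i \<odot>\<^bsub>U\<^esub> f (fst i) (snd i) = \<zero>\<^bsub>U\<^esub>"
    if "i \<in> S - {p. r p \<noteq> \<zero>\<^bsub>k\<^esub>}" for i
    using that assms(4) f by auto
  show "(\<lambda>p. r p \<odot>\<^bsub>U\<^esub> f (fst p) (snd p)) \<in> S \<rightarrow> carrier U"
    using assms(4) f free_space_val[OF assms(1)] by fastforce
qed auto

lemma free_ext_linear: "linear_map k F U (free_ext U f)"
proof (rule linear_mapI)
  have cl: "(\<lambda>p. r p \<odot>\<^bsub>U\<^esub> f (fst p) (snd p)) \<in> S \<rightarrow> carrier U"
    if "r \<in> carrier F" "S \<subseteq> carrier V \<times> carrier W" for r S
    using that f free_space_val by fastforce
  show "free_ext U f r \<in> carrier U" if "r \<in> carrier F" for r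
    unfolding free_ext_def using cl[OF that free_space_support(2)[OF that]]
    by (rule U.finsum_closed)
  show "free_ext U f (r \<oplus>\<^bsub>F\<^esub> s) = free_ext U f r \<oplus>\<^bsub>U\<^esub> free_ext U f s"
    if r: "r \<in> carrier F" and s: "s \<in> carrier F" for r s
  proof -
    let ?S = "{p. r p \<noteq> \<zero>\<^bsub>k\<^esub>} \<union> {p. s p \<noteq> \<zero>\<^bsub>k\<^esub>}"
    have S: "finite ?S" "?S \<subseteq> carrier V \<times> carrier W"
      using free_space_support[OF r] free_space_support[OF s] by simp_all
    have S': "{p. (r \<oplus>\<^bsub>F\<^esub> s) p \<noteq> \<zero>\<^bsub>k\<^esub>} \<subseteq> ?S"
      by (auto simp: free_space_simps(2))
    have "free_ext U f (r \<oplus>\<^bsub>F\<^esub> s) = (\<Oplus>\<^bsub>U\<^esub>p\<in>?S. (r \<oplus>\<^bsub>F\<^esub> s) p \<odot>\<^bsub>U\<^esub> f (fst p) (snd p))"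
      by (rule free_ext_superset[OF free_space_add_closed[OF r s] S(1) S' S(2)])
    also have "\<dots> = (\<Oplus>\<^bsub>U\<^esub>p\<in>?S. r p \<odot>\<^bsub>U\<^esub> f (fst p) (snd p) \<oplus>\<^bsub>U\<^esub> s p \<odot>\<^bsub>U\<^esub> f (fst p) (snd p))"
    proof (rule U.finsum_cong')
      fix p assume "p \<in> ?S"
      with S(2) have "f (fst p) (snd p) \<in> carrier U" by (intro f) auto
      with r s show "(r \<oplus>\<^bsub>F\<^esub> s) p \<odot>\<^bsub>U\<^esub> f (fst p) (snd p) =
          r p \<odot>\<^bsub>U\<^esub> f (fst p) (snd p) \<oplus>\<^bsub>U\<^esub> s p \<odot>\<^bsub>U\<^esub> f (fst p) (snd p)"
        by (simp add: free_space_simps(2) free_space_val U.smult_l_distr)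
    qed (use cl[OF r S(2)] cl[OF s S(2)] in auto)
    also have "\<dots> = free_ext U f r \<oplus>\<^bsub>U\<^esub> free_ext U f s"
      using free_ext_superset[OF r S(1) _ S(2)] free_ext_superset[OF s S(1) _ S(2)]
        cl[OF r S(2)] cl[OF s S(2)] S(1)
      by (simp add: U.finsum_addf)
    finally show ?thesis .
  qed
  show "free_ext U f (c \<odot>\<^bsub>F\<^esub> r) = c \<odot>\<^bsub>U\<^esub> free_ext U f r"
    if c: "c \<in> carrier k" and r: "r \<in> carrier F" for c r
  proof -
    let ?S = "{p. r p \<noteq> \<zero>\<^bsub>k\<^esub>}"
    have S: "finite ?S" "?S \<subseteq> carrier V \<times> carrier W"
      using free_space_support[OF r] by simp_all
    have S': "{p. (c \<odot>\<^bsub>F\<^esub> r) p \<noteq> \<zero>\<^bsub>k\<^esub>} \<subseteq> ?S"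
      using c by (auto simp: free_space_simps(3))
    have "free_ext U f (c \<odot>\<^bsub>F\<^esub> r) = (\<Oplus>\<^bsub>U\<^esub>p\<in>?S. (c \<odot>\<^bsub>F\<^esub> r) p \<odot>\<^bsub>U\<^esub> f (fst p) (snd p))"
      by (rule free_ext_superset[OF free_space_smult_closed[OF c r] S(1) S' S(2)])
    also have "\<dots> = (\<Oplus>\<^bsub>U\<^esub>p\<in>?S. c \<odot>\<^bsub>U\<^esub> (r p \<odot>\<^bsub>U\<^esub> f (fst p) (snd p)))"
    proof (rule U.finsum_cong')
      fix p assume "p \<in> ?S"
      with S(2) have "f (fst p) (snd p) \<in> carrier U" by (intro f) auto
      with c r show "(c \<odot>\<^bsub>F\<^esub> r) p \<odot>\<^bsub>U\<^esub> f (fst p) (snd p) =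
          c \<odot>\<^bsub>U\<^esub> (r p \<odot>\<^bsub>U\<^esub> f (fst p) (snd p))"
        by (simp add: free_space_simps(3) free_space_val U.smult_assoc1)
    qed (use cl[OF r S(2)] c in auto)
    also have "\<dots> = c \<odot>\<^bsub>U\<^esub> free_ext U f r"
      unfolding free_ext_def using U.finsum_smult_ldistr[OF S(1) c cl[OF r S(2)]] by simp
    finally show ?thesis .
  qed
qed

lemma free_ext_basis_vec:
  assumes "v \<in> carrier V" "w \<in> carrier W"
  shows "free_ext U f (basis_vec k v w) = f v w"
proof -
  have "free_ext U f (basis_vec k v w) =
      (\<Oplus>\<^bsub>U\<^esub>p\<in>{(v, w)}. basis_vec k v w p \<odot>\<^bsub>U\<^esub> f (fst p) (snd p))"
    by (rule free_ext_superset[OF basis_vec_closed[OF assms]]) (use assms in \<open>auto simp: basis_vec_def\<close>)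
  also have "\<dots> = f v w"
    using f[OF assms] by (simp add: basis_vec_def)
  finally show ?thesis .
qed

end

end

section \<open>Quotient modules and the tensor product\<close>

lemma submodule_abelian_subgroup:
  assumes "module k M" "submodule N k M"
  shows "abelian_subgroup N M"
proof -
  interpret M: module k M by fact
  interpret N: submodule N k M by fact
  show ?thesis
    by (rule abelian_subgroupI2[OF M.a_comm_group N.subgroup_axioms])
qed

lemma coset_smult:
  assumes M: "module k M" and N: "submodule N k M"
    and c: "c \<in> carrier k" and x: "x \<in> carrier M"
  shows "(\<Union>r\<in>N +>\<^bsub>M\<^esub> x. N +>\<^bsub>M\<^esub> (c \<odot>\<^bsub>M\<^esub> r)) = N +>\<^bsub>M\<^esub> (c \<odot>\<^bsub>M\<^esub> x)"
proof -
  interpret M: module k M by fact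
  interpret N: submodule N k M by fact
  interpret A: abelian_subgroup N M by (rule submodule_abelian_subgroup[OF M N])
  have "N +>\<^bsub>M\<^esub> (c \<odot>\<^bsub>M\<^esub> r) = N +>\<^bsub>M\<^esub> (c \<odot>\<^bsub>M\<^esub> x)" if r: "r \<in> N +>\<^bsub>M\<^esub> x" for r
  proof -
    from r obtain n where n: "n \<in> N" "r = n \<oplus>\<^bsub>M\<^esub> x"
      by (auto simp: a_r_coset_def')
    then have "c \<odot>\<^bsub>M\<^esub> r = (c \<odot>\<^bsub>M\<^esub> n) \<oplus>\<^bsub>M\<^esub> (c \<odot>\<^bsub>M\<^esub> x)"
      using c x A.a_subset by (simp add: M.smult_r_distr subsetD)
    then have "c \<odot>\<^bsub>M\<^esub> r \<in> N +>\<^bsub>M\<^esub> (c \<odot>\<^bsub>M\<^esub> x)"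
      using N.smult_closed[OF c n(1)] by (auto simp: a_r_coset_def')
    then show ?thesis
      using A.a_repr_independence' c x by simp
  qed
  moreover have "x \<in> N +>\<^bsub>M\<^esub> x"
    using A.a_rcos_self x by simp
  ultimately show ?thesis by blast
qed

lemma quotient_module:
  assumes M: "module k M" and N: "submodule N k M"
    and Q: "carrier Q = a_rcosets\<^bsub>M\<^esub> N" "\<zero>\<^bsub>Q\<^esub> = N" "add Q = (\<lambda>s t. s <+>\<^bsub>M\<^esub> t)"
      "smult Q = (\<lambda>c t. \<Union>r\<in>t. N +>\<^bsub>M\<^esub> (c \<odot>\<^bsub>M\<^esub> r))"
  shows "module k Q" and "linear_map k M Q (\<lambda>x. N +>\<^bsub>M\<^esub> x)"
proof -
  interpret M: module k M by fact
  interpret A: abelian_subgroup N M by (rule submodule_abelian_subgroup[OF M N])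
  let ?p = "\<lambda>x. N +>\<^bsub>M\<^esub> x"
  have carr: "t \<in> carrier Q \<longleftrightarrow> (\<exists>x\<in>carrier M. t = ?p x)" for t
    by (auto simp: Q A_RCOSETS_def')
  have add: "?p x \<oplus>\<^bsub>Q\<^esub> ?p y = ?p (x \<oplus>\<^bsub>M\<^esub> y)" if "x \<in> carrier M" "y \<in> carrier M" for x y
    using that by (simp add: Q A.a_rcos_sum)
  have smult: "c \<odot>\<^bsub>Q\<^esub> ?p x = ?p (c \<odot>\<^bsub>M\<^esub> x)" if "c \<in> carrier k" "x \<in> carrier M" for c x
    using that by (simp add: Q coset_smult[OF M N])
  have zero: "\<zero>\<^bsub>Q\<^esub> = ?p \<zero>\<^bsub>M\<^esub>"
    using A.a_rcos_const[OF A.zero_closed] by (simp add: Q)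
  show "linear_map k M Q ?p"
    by (rule linear_mapI) (auto simp: carr add smult)
  have "abelian_group Q"
  proof (rule abelian_groupI, goal_cases)
    case (1 s t) then show ?case unfolding carr using add M.a_closed by metis
  next
    case 2 then show ?case unfolding carr zero by blast
  next
    case (3 s t u)
    then obtain x y z where "x \<in> carrier M" "y \<in> carrier M" "z \<in> carrier M"
      "s = ?p x" "t = ?p y" "u = ?p z" unfolding carr by blast
    then show ?case by (simp add: add M.a_assoc)
  next
    case (4 s t)
    then obtain x y where "x \<in> carrier M" "y \<in> carrier M" "s = ?p x" "t = ?p y" unfolding carr by blast
    then show ?case by (simp add: add M.a_comm)
  next
    case (5 t)
    then obtain x where "x \<in> carrier M" "t = ?p x" unfolding carr by blast
    then show ?case by (simp add: add zero)
  next
    case (6 t)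
    then obtain x where x: "x \<in> carrier M" "t = ?p x" unfolding carr by blast
    then have "?p (\<ominus>\<^bsub>M\<^esub> x) \<oplus>\<^bsub>Q\<^esub> t = \<zero>\<^bsub>Q\<^esub>" by (simp add: add zero M.l_neg)
    moreover have "?p (\<ominus>\<^bsub>M\<^esub> x) \<in> carrier Q" using x unfolding carr by blast
    ultimately show ?case by blast
  qed
  moreover have "cring k" by (rule M.R.is_cring)
  ultimately show "module k Q"
  proof (intro moduleI, goal_cases)
    case (3 c t)
    then obtain x where "x \<in> carrier M" "t = ?p x" unfolding carr by blast
    then show ?case using 3 unfolding carr by (auto simp: smult)
  next
    case (4 c d t)
    then obtain x where "x \<in> carrier M" "t = ?p x" unfolding carr by blast
    then show ?case using 4 by (simp add: smult add M.smult_l_distr)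
  next
    case (5 c s t)
    then obtain x y where "x \<in> carrier M" "y \<in> carrier M" "s = ?p x" "t = ?p y" unfolding carr by blast
    then show ?case using 5 by (simp add: smult add M.smult_r_distr)
  next
    case (6 c d t)
    then obtain x where "x \<in> carrier M" "t = ?p x" unfolding carr by blast
    then show ?case using 6 by (simp add: smult M.smult_assoc1)
  next
    case (7 t)
    then obtain x where "x \<in> carrier M" "t = ?p x" unfolding carr by blast
    then show ?case by (simp add: smult)
  qed
qed

text \<open>
  Serves to show that a linear map vanishes on \<open>tensor_null\<close>, the least submodule containing the
  bilinearity relations: it is enough that the kernel contains the relations.
\<close>

lemma linear_map_kernel_submodule:
  assumes f: "linear_map k M U f" and M: "module k M" and U: "module k U"
  shows "submodule {x \<in> carrier M. f x = \<zero>\<^bsub>U\<^esub>} k M"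
proof -
  interpret M: module k M by fact
  interpret U: module k U by fact
  have neg: "f (\<ominus>\<^bsub>M\<^esub> x) = \<zero>\<^bsub>U\<^esub>" if "x \<in> carrier M" "f x = \<zero>\<^bsub>U\<^esub>" for x
  proof -
    have "f (\<ominus>\<^bsub>M\<^esub> x \<oplus>\<^bsub>M\<^esub> x) = f (\<ominus>\<^bsub>M\<^esub> x) \<oplus>\<^bsub>U\<^esub> f x"
      using that by (intro linear_map_add[OF f]) auto
    then show ?thesis
      using that linear_map_zero[OF f M U] linear_map_closed[OF f] by (simp add: M.l_neg)
  qed
  show ?thesis
    by (rule M.submoduleI) (use neg in \<open>auto simp: linear_map_zero[OF f M U] linear_mapD[OF f]\<close>)
qed

context
  fixes k :: "('k, 'r) ring_scheme" and V :: "('k, 'v, 'x) module_scheme"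
    and W :: "('k, 'w, 'y) module_scheme"
  assumes V: "module k V" and W: "module k W"
begin

interpretation V: module k V by (rule V)
interpretation W: module k W by (rule W)
interpretation F: module k "free_space k V W" by (rule free_space_module[OF V.R.is_cring])

private abbreviation (input) "VW \<equiv> free_space k V W"
private abbreviation (input) "N \<equiv> tensor_null k V W"
private abbreviation (input) "T \<equiv> tensor_space k V W"

lemmas basis_vec_closed' = basis_vec_closed[OF V.R.is_cring, of _ V _ W]

lemma bilinearity_relations_closed: "bilinearity_relations k V W \<subseteq> carrier VW"
  by (auto simp: bilinearity_relations_def Let_def basis_vec_closed')

lemma tensor_null_submodule: "submodule N k VW"
proof -
  let ?S = "{N. submodule N k VW \<and> bilinearity_relations k V W \<subseteq> N}"
  have car: "carrier VW \<in> ?S"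
    using F.carrier_is_submodule bilinearity_relations_closed by auto
  show ?thesis
  proof (rule F.submoduleI, goal_cases)
    case 1 then show ?case using car unfolding tensor_null_def by blast
  next
    case 2
    have "\<zero>\<^bsub>VW\<^esub> \<in> M" if "M \<in> ?S" for M
      using that additive_subgroup.zero_closed[OF abelian_subgroup.axioms(1)[OF submodule_abelian_subgroup[OF F.module_axioms]]]
      by blast
    then show ?case unfolding tensor_null_def by blast
  next
    case (3 a) then show ?case unfolding tensor_null_def using F.submoduleE(3) by blast
  next
    case (4 a b) then show ?case unfolding tensor_null_def using F.submoduleE(5) by blast
  next
    case (5 a b) then show ?case unfolding tensor_null_def using F.submoduleE(4) by blast
  qed
qed

lemma tensor_space_simps:
  "carrier T = a_rcosets\<^bsub>VW\<^esub> N" "\<zero>\<^bsub>T\<^esub> = N"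
  "add T = (\<lambda>s t. s <+>\<^bsub>VW\<^esub> t)"
  "smult T = (\<lambda>c t. \<Union>r\<in>t. N +>\<^bsub>VW\<^esub> (c \<odot>\<^bsub>VW\<^esub> r))"
  by (simp_all add: tensor_space_def Let_def)

lemma tensor_space_module: "module k T"
  by (rule quotient_module(1)[OF F.module_axioms tensor_null_submodule tensor_space_simps])

lemma tensor_quotient_linear:
  "linear_map k VW T (\<lambda>r. N +>\<^bsub>VW\<^esub> r)"
  by (rule quotient_module(2)[OF F.module_axioms tensor_null_submodule tensor_space_simps])

interpretation T: module k T by (rule tensor_space_module)
interpretation N: abelian_subgroup N VW
  by (rule submodule_abelian_subgroup[OF F.module_axioms tensor_null_submodule])

lemma tensor_relation:
  assumes "r \<in> carrier VW" "s \<in> carrier VW"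
    and "r \<ominus>\<^bsub>VW\<^esub> s \<in> bilinearity_relations k V W"
  shows "N +>\<^bsub>VW\<^esub> r = N +>\<^bsub>VW\<^esub> s"
proof -
  have "r \<ominus>\<^bsub>VW\<^esub> s \<in> N"
    using assms(3) unfolding tensor_null_def by blast
  then have "r \<in> N +>\<^bsub>VW\<^esub> s"
    using N.a_rcos_module[OF assms(2,1)] by (simp add: a_minus_def)
  from N.a_repr_independence'[OF this assms(2)] show ?thesis by simp
qed

lemma tpure_bilinear: "bilinear_map k V W T (tpure k V W)"
proof (rule bilinear_mapI; rule linear_mapI)
  note q = linear_mapD[OF tensor_quotient_linear]
  note [simp] = basis_vec_closed'
  fix v w assume v: "v \<in> carrier V" and w: "w \<in> carrier W"
  show "tpure k V W v w \<in> carrier T" "tpure k V W v w \<in> carrier T"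
    using v w by (simp_all add: tpure_def q(1))
  fix c assume c: "c \<in> carrier k"
  show "tpure k V W v (c \<odot>\<^bsub>W\<^esub> w) = c \<odot>\<^bsub>T\<^esub> tpure k V W v w"
    unfolding tpure_def using v w c
    by (subst q(3)[symmetric], simp, simp, intro tensor_relation)
       (auto simp: bilinearity_relations_def Let_def)
  show "tpure k V W (c \<odot>\<^bsub>V\<^esub> v) w = c \<odot>\<^bsub>T\<^esub> tpure k V W v w"
    unfolding tpure_def using v w c
    by (subst q(3)[symmetric], simp, simp, intro tensor_relation)
       (auto simp: bilinearity_relations_def Let_def)
next
  note q = linear_mapD[OF tensor_quotient_linear]
  note [simp] = basis_vec_closed'
  fix v w w' assume v: "v \<in> carrier V" and w: "w \<in> carrier W" "w' \<in> carrier W"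
  show "tpure k V W v (w \<oplus>\<^bsub>W\<^esub> w') = tpure k V W v w \<oplus>\<^bsub>T\<^esub> tpure k V W v w'"
    unfolding tpure_def using v w
    by (subst q(2)[symmetric], simp, simp, intro tensor_relation)
       (auto simp: bilinearity_relations_def Let_def)
next
  note q = linear_mapD[OF tensor_quotient_linear]
  note [simp] = basis_vec_closed'
  fix v v' w assume v: "v \<in> carrier V" "v' \<in> carrier V" and w: "w \<in> carrier W"
  show "tpure k V W (v \<oplus>\<^bsub>V\<^esub> v') w = tpure k V W v w \<oplus>\<^bsub>T\<^esub> tpure k V W v' w"
    unfolding tpure_def using v w
    by (subst q(2)[symmetric], simp, simp, intro tensor_relation)
       (auto simp: bilinearity_relations_def Let_def)
qed

lemma tensor_representative:
  assumes "t \<in> carrier T"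
  shows "(SOME r. r \<in> t) \<in> carrier VW"
    and "t = N +>\<^bsub>VW\<^esub> (SOME r. r \<in> t)"
proof -
  obtain s where s: "s \<in> carrier VW" "t = N +>\<^bsub>VW\<^esub> s"
    using assms by (auto simp: tensor_space_simps A_RCOSETS_def')
  then have "s \<in> t" by (simp add: N.a_rcos_self)
  then have t: "(SOME r. r \<in> t) \<in> t" by (rule someI[where P = "\<lambda>r. r \<in> t"])
  then show "t = N +>\<^bsub>VW\<^esub> (SOME r. r \<in> t)"
    using N.a_repr_independence' s by simp
  show "(SOME r. r \<in> t) \<in> carrier VW"
    using t N.a_rcosets_carrier[of t] assms by (auto simp: tensor_space_simps)
qed

text \<open>
  Pure tensors span: removing one point \<open>q\<close> from the support of \<open>r\<close> removes the summand
  \<open>r(q)\<close> times a pure tensor from its coset.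
\<close>

lemma coset_sum_of_pure:
  assumes "finite S" "S \<subseteq> carrier V \<times> carrier W"
    "r \<in> carrier VW" "\<And>p. p \<notin> S \<Longrightarrow> r p = \<zero>\<^bsub>k\<^esub>"
  shows "N +>\<^bsub>VW\<^esub> r = (\<Oplus>\<^bsub>T\<^esub>p\<in>S. r p \<odot>\<^bsub>T\<^esub> tpure k V W (fst p) (snd p))"
  using assms
proof (induction S arbitrary: r rule: finite_induct)
  case empty
  then have "r = \<zero>\<^bsub>VW\<^esub>" by (auto simp: free_space_simps[OF V.R.is_cring])
  then show ?case
    by (simp add: T.finsum_empty tensor_space_simps(2) N.a_rcos_const)
next
  case (insert q S)
  note val = free_space_val[OF V.R.is_cring]
  note tp = linear_map_closed[OF bilinear_map_right[OF tpure_bilinear]]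
  let ?r = "r(q := \<zero>\<^bsub>k\<^esub>)" and ?e = "basis_vec k (fst q) (snd q)"
  have rq: "r q \<in> carrier k" using val[OF insert.prems(2)] .
  have r': "?r \<in> carrier VW"
    by (rule free_spaceI[OF V.R.is_cring, of S]) (use insert val[OF insert.prems(2)] in auto)
  have tc: "r p \<odot>\<^bsub>T\<^esub> tpure k V W (fst p) (snd p) \<in> carrier T" if "p \<in> insert q S" for p
  proof -
    have "fst p \<in> carrier V" "snd p \<in> carrier W" using insert.prems(1) that by auto
    then show ?thesis using val[OF insert.prems(2), of p] tp by simp
  qed
  have e: "?e \<in> carrier VW"
    using insert.prems(1) by (auto intro: basis_vec_closed')
  have "r = (r q \<odot>\<^bsub>VW\<^esub> ?e) \<oplus>\<^bsub>VW\<^esub> ?r"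
    using val[OF insert.prems(2)] by (auto simp: free_space_simps(2,3)[OF V.R.is_cring] basis_vec_def fun_eq_iff)
  then have "N +>\<^bsub>VW\<^esub> r =
      N +>\<^bsub>VW\<^esub> ((r q \<odot>\<^bsub>VW\<^esub> ?e) \<oplus>\<^bsub>VW\<^esub> ?r)"
    by (rule arg_cong)
  also have "\<dots> = (r q \<odot>\<^bsub>T\<^esub> tpure k V W (fst q) (snd q)) \<oplus>\<^bsub>T\<^esub> (N +>\<^bsub>VW\<^esub> ?r)"
    using rq e r' by (simp add: linear_mapD[OF tensor_quotient_linear] tpure_def)
  also have "N +>\<^bsub>VW\<^esub> ?r =
      (\<Oplus>\<^bsub>T\<^esub>p\<in>S. ?r p \<odot>\<^bsub>T\<^esub> tpure k V W (fst p) (snd p))"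
  proof (rule insert.IH)
    show "?r \<in> carrier VW" by (rule r')
    show "?r p = \<zero>\<^bsub>k\<^esub>" if "p \<notin> S" for p
      using insert.prems(3)[of p] that by (cases "p = q") auto
  qed (use insert.prems(1) in auto)
  also have "\<dots> = (\<Oplus>\<^bsub>T\<^esub>p\<in>S. r p \<odot>\<^bsub>T\<^esub> tpure k V W (fst p) (snd p))"
    by (rule T.finsum_cong'[OF refl]) (use tc insert.hyps in auto)
  also have "(r q \<odot>\<^bsub>T\<^esub> tpure k V W (fst q) (snd q)) \<oplus>\<^bsub>T\<^esub> \<dots> =
      (\<Oplus>\<^bsub>T\<^esub>p\<in>insert q S. r p \<odot>\<^bsub>T\<^esub> tpure k V W (fst p) (snd p))"
    by (rule T.finsum_insert[symmetric]) (use tc insert.hyps in auto)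
  finally show ?case .
qed

lemma tlift_eq_free_ext: "tlift k U f t = free_ext k U f (SOME r. r \<in> t)"
  by (simp add: tlift_def Let_def free_ext_def[OF V.R.is_cring])

text \<open>
  The universal property. For bilinear \<open>f\<close> the kernel of \<open>free_ext k U f\<close> contains the bilinearity
  relations, so \<open>free_ext k U f\<close> takes equal values on representatives of the same coset.
\<close>

lemma tlift_coset:
  assumes U: "module k U" and f: "bilinear_map k V W U f"
    and r: "r \<in> carrier VW"
  shows "tlift k U f (N +>\<^bsub>VW\<^esub> r) = free_ext k U f r"
proof -
  interpret U: module k U by fact
  note fc = bilinear_map_closed[OF f]
  note L = free_ext_linear[OF V.R.is_cring U fc]
  let ?K = "{r \<in> carrier VW. free_ext k U f r = \<zero>\<^bsub>U\<^esub>}"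
  have K: "submodule ?K k VW"
    by (rule linear_map_kernel_submodule[OF L F.module_axioms U])
  have diff: "free_ext k U f (r \<ominus>\<^bsub>VW\<^esub> s) = \<zero>\<^bsub>U\<^esub> \<longleftrightarrow> free_ext k U f r = free_ext k U f s"
    if "r \<in> carrier VW" "s \<in> carrier VW" for r s
  proof -
    have "free_ext k U f r = free_ext k U f ((r \<ominus>\<^bsub>VW\<^esub> s) \<oplus>\<^bsub>VW\<^esub> s)"
      using that by (simp add: a_minus_def F.a_assoc F.l_neg)
    also have "\<dots> = free_ext k U f (r \<ominus>\<^bsub>VW\<^esub> s) \<oplus>\<^bsub>U\<^esub> free_ext k U f s"
      using that by (intro linear_map_add[OF L]) auto
    finally have "free_ext k U f r =
        free_ext k U f (r \<ominus>\<^bsub>VW\<^esub> s) \<oplus>\<^bsub>U\<^esub> free_ext k U f s" .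
    moreover have "free_ext k U f (r \<ominus>\<^bsub>VW\<^esub> s) \<in> carrier U" "free_ext k U f s \<in> carrier U"
      using that by (auto intro!: linear_map_closed[OF L])
    ultimately show ?thesis
      using U.add.r_cancel_one by simp
  qed
  have "bilinearity_relations k V W \<subseteq> ?K"
  proof
    fix s assume s: "s \<in> bilinearity_relations k V W"
    note [simp] = diff basis_vec_closed' linear_map_add[OF L] linear_map_smult[OF L]
      free_ext_basis_vec[OF V.R.is_cring U fc]
      linear_map_add[OF bilinear_map_left[OF f]] linear_map_add[OF bilinear_map_right[OF f]]
      linear_map_smult[OF bilinear_map_left[OF f]] linear_map_smult[OF bilinear_map_right[OF f]]
    have "free_ext k U f s = \<zero>\<^bsub>U\<^esub>"
      using s unfolding bilinearity_relations_def Let_def by (elim UnE CollectE exE conjE) simp_all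
    with s bilinearity_relations_closed show "s \<in> ?K" by blast
  qed
  then have NK: "N \<subseteq> ?K"
    using K unfolding tensor_null_def by blast
  let ?t = "N +>\<^bsub>VW\<^esub> r" and ?s = "SOME s. s \<in> N +>\<^bsub>VW\<^esub> r"
  have t: "?t \<in> carrier T"
    by (rule linear_map_closed[OF tensor_quotient_linear r])
  have s: "?s \<in> carrier VW"
    by (rule tensor_representative(1)[OF t])
  have "?s \<in> ?t"
    using tensor_representative(2)[OF t] N.a_rcos_self[OF s] by simp
  then have "?s \<ominus>\<^bsub>VW\<^esub> r \<in> N"
    using N.a_rcos_module[OF r s] by (simp add: a_minus_def)
  with NK diff[OF s r] show ?thesis
    unfolding tlift_eq_free_ext by blast
qed

lemma tlift_pure:
  assumes U: "module k U" and f: "bilinear_map k V W U f" and "v \<in> carrier V" "w \<in> carrier W"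
  shows "tlift k U f (tpure k V W v w) = f v w"
  unfolding tpure_def
  using tlift_coset[OF U f basis_vec_closed'] free_ext_basis_vec[OF V.R.is_cring U bilinear_map_closed[OF f]] assms
  by simp

lemma tlift_linear:
  assumes U: "module k U" and f: "bilinear_map k V W U f"
  shows "linear_map k T U (tlift k U f)"
proof -
  note L = free_ext_linear[OF V.R.is_cring U bilinear_map_closed[OF f]]
  note rep = tensor_representative
  have ev: "tlift k U f t = free_ext k U f (SOME r. r \<in> t)" for t
    by (rule tlift_eq_free_ext)
  show ?thesis
  proof (rule linear_mapI)
    show "tlift k U f t \<in> carrier U" if "t \<in> carrier T" for t
      unfolding ev using linear_map_closed[OF L rep(1)[OF that]] .
    show "tlift k U f (s \<oplus>\<^bsub>T\<^esub> t) = tlift k U f s \<oplus>\<^bsub>U\<^esub> tlift k U f t"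
      if s: "s \<in> carrier T" and t: "t \<in> carrier T" for s t
    proof -
      have "s \<oplus>\<^bsub>T\<^esub> t = N +>\<^bsub>VW\<^esub> ((SOME r. r \<in> s) \<oplus>\<^bsub>VW\<^esub> (SOME r. r \<in> t))"
        using linear_map_add[OF tensor_quotient_linear rep(1)[OF s] rep(1)[OF t]]
          rep(2)[OF s] rep(2)[OF t] by simp
      then show ?thesis
        using tlift_coset[OF U f] rep(1)[OF s] rep(1)[OF t] by (simp add: ev linear_map_add[OF L])
    qed
    show "tlift k U f (c \<odot>\<^bsub>T\<^esub> t) = c \<odot>\<^bsub>U\<^esub> tlift k U f t"
      if c: "c \<in> carrier k" and t: "t \<in> carrier T" for c t
    proof -
      have "c \<odot>\<^bsub>T\<^esub> t = N +>\<^bsub>VW\<^esub> (c \<odot>\<^bsub>VW\<^esub> (SOME r. r \<in> t))"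
        using linear_map_smult[OF tensor_quotient_linear c rep(1)[OF t]] rep(2)[OF t] by simp
      then show ?thesis
        using tlift_coset[OF U f] rep(1)[OF t] c by (simp add: ev linear_map_smult[OF L])
    qed
  qed
qed

lemma tlift_closed:
  assumes U: "module k U" and "t \<in> carrier T"
    and "\<And>v w. \<lbrakk>v \<in> carrier V; w \<in> carrier W\<rbrakk> \<Longrightarrow> f v w \<in> carrier U"
  shows "tlift k U f t \<in> carrier U"
  unfolding tlift_eq_free_ext
  by (rule linear_map_closed[OF free_ext_linear[OF V.R.is_cring U assms(3)] tensor_representative(1)[OF assms(2)]])

lemma tlift_cong:
  assumes U: "module k U" and t: "t \<in> carrier T"
    and f: "\<And>v w. \<lbrakk>v \<in> carrier V; w \<in> carrier W\<rbrakk> \<Longrightarrow> f v w = g v w"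
    and g: "\<And>v w. \<lbrakk>v \<in> carrier V; w \<in> carrier W\<rbrakk> \<Longrightarrow> g v w \<in> carrier U"
  shows "tlift k U f t = tlift k U g t"
proof -
  interpret U: module k U by fact
  note r = tensor_representative(1)[OF t]
  note supp = free_space_support(2)[OF V.R.is_cring r] and val = free_space_val[OF V.R.is_cring r]
  have p: "fst p \<in> carrier V" "snd p \<in> carrier W" if "(SOME r. r \<in> t) p \<noteq> \<zero>\<^bsub>k\<^esub>" for p
  proof -
    have "p \<in> carrier V \<times> carrier W" using subsetD[OF supp, of p] that by blast
    then show "fst p \<in> carrier V" "snd p \<in> carrier W" by (simp_all add: mem_Times_iff)
  qed
  show ?thesis
    unfolding tlift_def Let_def
  proof (rule U.finsum_cong'[OF refl])
    show "(\<lambda>p. (SOME r. r \<in> t) p \<odot>\<^bsub>U\<^esub> g (fst p) (snd p)) \<in> {p. (SOME r. r \<in> t) p \<noteq> \<zero>\<^bsub>k\<^esub>} \<rightarrow> carrier U"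
      using p g val by simp
  qed (use p f in simp)
qed

end

section \<open>Sums over a tensor\<close>

text \<open>
  For \<open>t = \<Sum>\<^sub>i v\<^sub>i \<otimes> w\<^sub>i\<close> this is \<open>\<Sum>\<^sub>i f(v\<^sub>i, w\<^sub>i)\<close>. It differs from \<^const>\<open>tlift\<close> in
  naming the spaces \<open>V\<close>, \<open>W\<close> and in erasing the values of \<open>f\<close> outside their carriers. Both serve the
  congruence rule below, which holds for arbitrary \<open>t\<close> and \<open>f\<close>: the simplifier can rewrite below a
  sum and knows there that the bound variables lie in the carriers.
\<close>

definition tsum ::
  "('k, 'r) ring_scheme \<Rightarrow> ('k, 'v, 'x) module_scheme \<Rightarrow> ('k, 'w, 'y) module_scheme \<Rightarrow>
    ('k, 'u, 'z) module_scheme \<Rightarrow> ('v \<Rightarrow> 'w \<Rightarrow> 'u) \<Rightarrow> ('k, 'v, 'w) tensor \<Rightarrow> 'u"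
  where "tsum k V W U f =
    tlift k U (\<lambda>v w. if v \<in> carrier V \<and> w \<in> carrier W then f v w else undefined)"

lemma tsum_cong [cong]:
  assumes "V = V'" "W = W'" "t = t'"
    and "\<And>v w. \<lbrakk>v \<in> carrier V'; w \<in> carrier W'\<rbrakk> \<Longrightarrow> f v w = g v w"
  shows "tsum k V W U f t = tsum k V' W' U g t'"
proof -
  have "(\<lambda>v w. if v \<in> carrier V \<and> w \<in> carrier W then f v w else undefined) =
      (\<lambda>v w. if v \<in> carrier V' \<and> w \<in> carrier W' then g v w else undefined)"
    using assms by (auto simp: fun_eq_iff)
  with assms(3) show ?thesis unfolding tsum_def by simp
qed

lemmas tsum_body_cong = tsum_cong[OF refl refl refl]

context
  fixes k :: "('k, 'r) ring_scheme" and V :: "('k, 'v, 'x) module_scheme"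
    and W :: "('k, 'w, 'y) module_scheme" and U :: "('k, 'u, 'z) module_scheme"
  assumes V: "module k V" and W: "module k W" and U: "module k U"
begin

lemma tlift_eq_tsum:
  assumes t: "t \<in> carrier (tensor_space k V W)"
    and f: "\<And>v w. \<lbrakk>v \<in> carrier V; w \<in> carrier W\<rbrakk> \<Longrightarrow> f v w \<in> carrier U"
  shows "tlift k U f t = tsum k V W U f t"
  unfolding tsum_def by (rule tlift_cong[OF V W U t]) (use f in auto)

lemma tsum_closed:
  assumes t: "t \<in> carrier (tensor_space k V W)"
    and f: "\<And>v w. \<lbrakk>v \<in> carrier V; w \<in> carrier W\<rbrakk> \<Longrightarrow> f v w \<in> carrier U"
  shows "tsum k V W U f t \<in> carrier U"
  unfolding tsum_def by (rule tlift_closed[OF V W U t]) (use f in auto)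

lemma tsum_pure:
  assumes f: "bilinear_map k V W U f" and vw: "v \<in> carrier V" "w \<in> carrier W"
  shows "tsum k V W U f (tpure k V W v w) = f v w"
proof -
  have "tsum k V W U f (tpure k V W v w) = tlift k U f (tpure k V W v w)"
    by (rule tlift_eq_tsum[OF bilinear_map_closed[OF tpure_bilinear[OF V W] vw], symmetric])
       (rule bilinear_map_closed[OF f])
  then show ?thesis using tlift_pure[OF V W U f vw] by simp
qed

lemma tsum_linear:
  assumes f: "bilinear_map k V W U f"
  shows "linear_map k (tensor_space k V W) U (tsum k V W U f)"
  by (rule linear_map_cong[OF tlift_linear[OF V W U f] tensor_space_module[OF V W]])
     (rule tlift_eq_tsum, assumption, rule bilinear_map_closed[OF f])

lemma tsum_eq_finsum:
  assumes t: "t \<in> carrier (tensor_space k V W)"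
    and f: "\<And>v w. \<lbrakk>v \<in> carrier V; w \<in> carrier W\<rbrakk> \<Longrightarrow> f v w \<in> carrier U"
  shows "tsum k V W U f t =
    (\<Oplus>\<^bsub>U\<^esub>p\<in>{p. (SOME r. r \<in> t) p \<noteq> \<zero>\<^bsub>k\<^esub>}. (SOME r. r \<in> t) p \<odot>\<^bsub>U\<^esub> f (fst p) (snd p))"
proof -
  have "tsum k V W U f t = tlift k U f t"
    by (rule tlift_eq_tsum[OF t, symmetric]) (rule f)
  then show ?thesis by (simp add: tlift_def Let_def)
qed

end

lemma tensor_representative_values:
  assumes V: "module k V" and W: "module k W" and t: "t \<in> carrier (tensor_space k V W)"
  shows "finite {p. (SOME r. r \<in> t) p \<noteq> \<zero>\<^bsub>k\<^esub>}"
    and "(SOME r. r \<in> t) p \<in> carrier k"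
    and "(SOME r. r \<in> t) p \<noteq> \<zero>\<^bsub>k\<^esub> \<Longrightarrow> fst p \<in> carrier V"
    and "(SOME r. r \<in> t) p \<noteq> \<zero>\<^bsub>k\<^esub> \<Longrightarrow> snd p \<in> carrier W"
proof -
  interpret V: module k V by fact
  note r = tensor_representative(1)[OF V W t]
  show "finite {p. (SOME r. r \<in> t) p \<noteq> \<zero>\<^bsub>k\<^esub>}" "(SOME r. r \<in> t) p \<in> carrier k"
    using free_space_support(1)[OF V.R.is_cring r] free_space_val[OF V.R.is_cring r] by simp_all
  assume "(SOME r. r \<in> t) p \<noteq> \<zero>\<^bsub>k\<^esub>"
  then have "p \<in> carrier V \<times> carrier W"
    using free_space_support(2)[OF V.R.is_cring r] by blast
  then show "fst p \<in> carrier V" "snd p \<in> carrier W" by (simp_all add: mem_Times_iff)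
qed

text \<open>
  The sum is a finite linear combination of values of \<open>f\<close>, with coefficients read off the chosen
  representative of \<open>t\<close>. The exchange of two sums below rests on the same fact.
\<close>

lemma linear_map_tsum:
  assumes L: "linear_map k U U' L"
    and V: "module k V" and W: "module k W" and U: "module k U" and U': "module k U'"
    and t: "t \<in> carrier (tensor_space k V W)"
    and f: "\<And>v w. \<lbrakk>v \<in> carrier V; w \<in> carrier W\<rbrakk> \<Longrightarrow> f v w \<in> carrier U"
  shows "L (tsum k V W U f t) = tsum k V W U' (\<lambda>v w. L (f v w)) t"
proof -
  interpret U: module k U by fact
  interpret U': module k U' by fact
  note r = tensor_representative_values[OF V W t]
  have "tsum k V W U f t =
      (\<Oplus>\<^bsub>U\<^esub>p\<in>{p. (SOME r. r \<in> t) p \<noteq> \<zero>\<^bsub>k\<^esub>}. (SOME r. r \<in> t) p \<odot>\<^bsub>U\<^esub> f (fst p) (snd p))"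
    by (rule tsum_eq_finsum[OF V W U t]) (rule f)
  also have "L \<dots> = (\<Oplus>\<^bsub>U'\<^esub>p\<in>{p. (SOME r. r \<in> t) p \<noteq> \<zero>\<^bsub>k\<^esub>}.
      L ((SOME r. r \<in> t) p \<odot>\<^bsub>U\<^esub> f (fst p) (snd p)))"
    by (rule linear_map_finsum[OF L U U' r(1)]) (use r(2-) f in simp)
  also have "\<dots> = (\<Oplus>\<^bsub>U'\<^esub>p\<in>{p. (SOME r. r \<in> t) p \<noteq> \<zero>\<^bsub>k\<^esub>}.
      (SOME r. r \<in> t) p \<odot>\<^bsub>U'\<^esub> L (f (fst p) (snd p)))"
    by (rule U'.finsum_cong'[OF refl]) (use r(2-) f linear_map_closed[OF L] linear_map_smult[OF L] in simp_all)
  also have "\<dots> = tsum k V W U' (\<lambda>v w. L (f v w)) t"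
    by (rule tsum_eq_finsum[OF V W U' t, symmetric]) (use f linear_map_closed[OF L] in simp)
  finally show ?thesis .
qed

lemma tsum_swap:
  assumes V: "module k V" and W: "module k W" and V': "module k V'" and W': "module k W'"
    and U: "module k U"
    and s: "s \<in> carrier (tensor_space k V W)" and t: "t \<in> carrier (tensor_space k V' W')"
    and f: "\<And>a b c d. \<lbrakk>a \<in> carrier V; b \<in> carrier W; c \<in> carrier V'; d \<in> carrier W'\<rbrakk> \<Longrightarrow>
      f a b c d \<in> carrier U"
  shows "tsum k V W U (\<lambda>a b. tsum k V' W' U (\<lambda>c d. f a b c d) t) s =
    tsum k V' W' U (\<lambda>c d. tsum k V W U (\<lambda>a b. f a b c d) s) t"
proof -
  interpret U: module k U by fact
  define x where "x = (SOME r. r \<in> s)"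
  define y where "y = (SOME r. r \<in> t)"
  note x = tensor_representative_values[OF V W s, folded x_def]
  note y = tensor_representative_values[OF V' W' t, folded y_def]
  let ?X = "{p. x p \<noteq> \<zero>\<^bsub>k\<^esub>}" and ?Y = "{p. y p \<noteq> \<zero>\<^bsub>k\<^esub>}"
  let ?g = "\<lambda>p q. f (fst p) (snd p) (fst q) (snd q)"
  have g: "?g p q \<in> carrier U" if "p \<in> ?X" "q \<in> ?Y" for p q
    using that x(3,4) y(3,4) f by simp
  have "tsum k V W U (\<lambda>a b. tsum k V' W' U (\<lambda>c d. f a b c d) t) s =
      (\<Oplus>\<^bsub>U\<^esub>p\<in>?X. x p \<odot>\<^bsub>U\<^esub> tsum k V' W' U (\<lambda>c d. f (fst p) (snd p) c d) t)"
    unfolding x_def by (rule tsum_eq_finsum[OF V W U s]) (rule tsum_closed[OF V' W' U t], rule f)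
  also have "\<dots> = (\<Oplus>\<^bsub>U\<^esub>p\<in>?X. \<Oplus>\<^bsub>U\<^esub>q\<in>?Y. x p \<odot>\<^bsub>U\<^esub> (y q \<odot>\<^bsub>U\<^esub> ?g p q))"
  proof (rule U.finsum_cong'[OF refl])
    fix p assume p: "p \<in> ?X"
    have "tsum k V' W' U (\<lambda>c d. f (fst p) (snd p) c d) t = (\<Oplus>\<^bsub>U\<^esub>q\<in>?Y. y q \<odot>\<^bsub>U\<^esub> ?g p q)"
      unfolding y_def by (rule tsum_eq_finsum[OF V' W' U t]) (use p x f in simp)
    then show "x p \<odot>\<^bsub>U\<^esub> tsum k V' W' U (\<lambda>c d. f (fst p) (snd p) c d) t =
        (\<Oplus>\<^bsub>U\<^esub>q\<in>?Y. x p \<odot>\<^bsub>U\<^esub> (y q \<odot>\<^bsub>U\<^esub> ?g p q))"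
      using U.finsum_smult_ldistr[OF y(1) x(2)] g[OF p] y(2) by simp
  qed (use g x(2) y(2) in \<open>auto intro!: U.finsum_closed\<close>)
  also have "\<dots> = (\<Oplus>\<^bsub>U\<^esub>q\<in>?Y. \<Oplus>\<^bsub>U\<^esub>p\<in>?X. x p \<odot>\<^bsub>U\<^esub> (y q \<odot>\<^bsub>U\<^esub> ?g p q))"
    by (rule U.finsum_swap[OF x(1) y(1)]) (use g x(2) y(2) in simp)
  also have "\<dots> = (\<Oplus>\<^bsub>U\<^esub>q\<in>?Y. y q \<odot>\<^bsub>U\<^esub> tsum k V W U (\<lambda>a b. f a b (fst q) (snd q)) s)"
  proof (rule U.finsum_cong'[OF refl])
    fix q assume q: "q \<in> ?Y"
    have "tsum k V W U (\<lambda>a b. f a b (fst q) (snd q)) s = (\<Oplus>\<^bsub>U\<^esub>p\<in>?X. x p \<odot>\<^bsub>U\<^esub> ?g p q)"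
      unfolding x_def by (rule tsum_eq_finsum[OF V W U s]) (use q y f in simp)
    moreover have "x p \<odot>\<^bsub>U\<^esub> (y q \<odot>\<^bsub>U\<^esub> ?g p q) = y q \<odot>\<^bsub>U\<^esub> (x p \<odot>\<^bsub>U\<^esub> ?g p q)"
      if p: "p \<in> ?X" for p
      using g[OF p q] x(2) y(2) by (metis U.R.m_comm U.smult_assoc1)
    ultimately show "(\<Oplus>\<^bsub>U\<^esub>p\<in>?X. x p \<odot>\<^bsub>U\<^esub> (y q \<odot>\<^bsub>U\<^esub> ?g p q)) =
        y q \<odot>\<^bsub>U\<^esub> tsum k V W U (\<lambda>a b. f a b (fst q) (snd q)) s"
      using U.finsum_smult_ldistr[OF x(1) y(2), of "\<lambda>p. x p \<odot>\<^bsub>U\<^esub> ?g p q"] g[OF _ q] x(2) y(2)[of q]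
      by (auto intro!: U.finsum_cong' simp: Pi_iff)
  next
    have "tsum k V W U (\<lambda>a b. f a b c d) s \<in> carrier U" if "c \<in> carrier V'" "d \<in> carrier W'" for c d
      by (rule tsum_closed[OF V W U s]) (use f that in simp)
    then show "(\<lambda>q. y q \<odot>\<^bsub>U\<^esub> tsum k V W U (\<lambda>a b. f a b (fst q) (snd q)) s) \<in> ?Y \<rightarrow> carrier U"
      using y by simp
  qed
  also have "\<dots> = tsum k V' W' U (\<lambda>c d. tsum k V W U (\<lambda>a b. f a b c d) s) t"
    unfolding y_def by (rule tsum_eq_finsum[OF V' W' U t, symmetric]) (rule tsum_closed[OF V W U s], rule f)
  finally show ?thesis .
qed

lemma tensor_linear_expansion:
  assumes L: "linear_map k (tensor_space k V W) U L"
    and V: "module k V" and W: "module k W" and U: "module k U"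
    and t: "t \<in> carrier (tensor_space k V W)"
  shows "L t = tsum k V W U (\<lambda>v w. L (tpure k V W v w)) t"
proof -
  interpret V: module k V by fact
  let ?T = "tensor_space k V W"
  note T = tensor_space_module[OF V W]
  note p = bilinear_map_closed[OF tpure_bilinear[OF V W]]
  note r = tensor_representative[OF V W t]
  note rv = tensor_representative_values[OF V W t]
  have supp: "{p. (SOME r. r \<in> t) p \<noteq> \<zero>\<^bsub>k\<^esub>} \<subseteq> carrier V \<times> carrier W"
    by (rule free_space_support(2)[OF V.R.is_cring r(1)])
  have "tsum k V W ?T (tpure k V W) t = (\<Oplus>\<^bsub>?T\<^esub>p\<in>{p. (SOME r. r \<in> t) p \<noteq> \<zero>\<^bsub>k\<^esub>}.
      (SOME r. r \<in> t) p \<odot>\<^bsub>?T\<^esub> tpure k V W (fst p) (snd p))"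
    by (rule tsum_eq_finsum[OF V W T t]) (rule p)
  then have "t = tsum k V W ?T (tpure k V W) t"
    using r(2) coset_sum_of_pure[OF V W rv(1) supp r(1)] by simp
  then have "L t = L (tsum k V W ?T (tpure k V W) t)"
    by (rule arg_cong)
  also have "\<dots> = tsum k V W U (\<lambda>v w. L (tpure k V W v w)) t"
    by (rule linear_map_tsum[OF L V W T U t]) (rule p)
  finally show ?thesis .
qed

lemma tensor_linear_ext:
  assumes "linear_map k (tensor_space k V W) U L" "linear_map k (tensor_space k V W) U L'"
    and "module k V" "module k W" "module k U"
    and "t \<in> carrier (tensor_space k V W)"
    and "\<And>v w. \<lbrakk>v \<in> carrier V; w \<in> carrier W\<rbrakk> \<Longrightarrow> L (tpure k V W v w) = L' (tpure k V W v w)"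
  shows "L t = L' t"
  using tensor_linear_expansion[OF assms(1,3-6)] tensor_linear_expansion[OF assms(2-6)] assms(7)
  by simp

lemma tsum_tpure:
  assumes "module k V" "module k W" "t \<in> carrier (tensor_space k V W)"
  shows "tsum k V W (tensor_space k V W) (tpure k V W) t = t"
  using tensor_linear_expansion[OF linear_map_id assms(1,2) tensor_space_module[OF assms(1,2)] assms(3)]
  by simp

section \<open>Linearity of nested sums\<close>

context
  fixes k :: "('k, 'r) ring_scheme"
    and X :: "('k, 'a, 'm) module_scheme"
    and V :: "('k, 'v, 'x) module_scheme"
    and W :: "('k, 'w, 'y) module_scheme" and U :: "('k, 'u, 'z) module_scheme"
  assumes V: "module k V" and W: "module k W"
begin

lemma lin_tpure1:
  assumes "w \<in> carrier W" "linear_map k X V f"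
  shows "linear_map k X (tensor_space k V W) (\<lambda>x. tpure k V W (f x) w)"
  by (rule linear_map_comp[OF bilinear_map_left[OF tpure_bilinear[OF V W]]]) fact+

lemma lin_tpure2:
  assumes "v \<in> carrier V" "linear_map k X W f"
  shows "linear_map k X (tensor_space k V W) (\<lambda>x. tpure k V W v (f x))"
  by (rule linear_map_comp[OF bilinear_map_right[OF tpure_bilinear[OF V W]]]) fact+

lemma tpure_closed:
  "\<lbrakk>v \<in> carrier V; w \<in> carrier W\<rbrakk> \<Longrightarrow> tpure k V W v w \<in> carrier (tensor_space k V W)"
  by (rule bilinear_map_closed[OF tpure_bilinear[OF V W]])

context
  assumes U: "module k U"
begin

text \<open>
  A variable can occur in a sum in two places. If it occurs in the tensor, then the summand has to be
  bilinear; if it occurs in the summand, then the summand only has to be linear in that variable.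
\<close>

lemma lin_tsum_arg:
  assumes "linear_map k X (tensor_space k V W) g"
    and "bilinear_map k V W U F"
  shows "linear_map k X U (\<lambda>x. tsum k V W U F (g x))"
  by (rule linear_map_comp[OF tsum_linear[OF V W U]]) fact+

lemma lin_tsum_param:
  assumes t: "t \<in> carrier (tensor_space k V W)" and X: "module k X"
    and F: "\<And>v w. \<lbrakk>v \<in> carrier V; w \<in> carrier W\<rbrakk> \<Longrightarrow> linear_map k X U (\<lambda>x. F x v w)"
  shows "linear_map k X U (\<lambda>x. tsum k V W U (F x) t)"
proof -
  interpret U: module k U by (rule U)
  interpret X: module k X by (rule X)
  let ?r = "SOME r. r \<in> t"
  let ?S = "{p. ?r p \<noteq> \<zero>\<^bsub>k\<^esub>}"
  note r = tensor_representative_values[OF V W t]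
  have cl: "F x v w \<in> carrier U" if "v \<in> carrier V" "w \<in> carrier W" "x \<in> carrier X" for x v w
    using linear_map_closed[OF F] that by blast
  have eq: "tsum k V W U (F x) t = (\<Oplus>\<^bsub>U\<^esub>p\<in>?S. ?r p \<odot>\<^bsub>U\<^esub> F x (fst p) (snd p))"
    if "x \<in> carrier X" for x
    by (rule tsum_eq_finsum[OF V W U t]) (use cl that in simp)
  show ?thesis
  proof (rule linear_mapI)
    show "tsum k V W U (F x) t \<in> carrier U" if "x \<in> carrier X" for x
      by (rule tsum_closed[OF V W U t]) (use cl that in simp)
    show "tsum k V W U (F (x \<oplus>\<^bsub>X\<^esub> y)) t = tsum k V W U (F x) t \<oplus>\<^bsub>U\<^esub> tsum k V W U (F y) t"
      if xy: "x \<in> carrier X" "y \<in> carrier X" for x y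
    proof -
      have "tsum k V W U (F (x \<oplus>\<^bsub>X\<^esub> y)) t =
          (\<Oplus>\<^bsub>U\<^esub>p\<in>?S. ?r p \<odot>\<^bsub>U\<^esub> F x (fst p) (snd p) \<oplus>\<^bsub>U\<^esub> ?r p \<odot>\<^bsub>U\<^esub> F y (fst p) (snd p))"
        unfolding eq[OF X.a_closed[OF xy]]
        by (rule U.finsum_cong'[OF refl])
          (use xy r cl linear_map_add[OF F] in \<open>simp_all add: U.smult_r_distr\<close>)
      also have "\<dots> = tsum k V W U (F x) t \<oplus>\<^bsub>U\<^esub> tsum k V W U (F y) t"
        using xy r cl by (simp add: eq U.finsum_addf)
      finally show ?thesis .
    qed
    show "tsum k V W U (F (c \<odot>\<^bsub>X\<^esub> x)) t = c \<odot>\<^bsub>U\<^esub> tsum k V W U (F x) t"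
      if c: "c \<in> carrier k" and x: "x \<in> carrier X" for c x
    proof -
      have "tsum k V W U (F (c \<odot>\<^bsub>X\<^esub> x)) t =
          (\<Oplus>\<^bsub>U\<^esub>p\<in>?S. c \<odot>\<^bsub>U\<^esub> (?r p \<odot>\<^bsub>U\<^esub> F x (fst p) (snd p)))"
        unfolding eq[OF X.smult_closed[OF c x]]
      proof (rule U.finsum_cong'[OF refl])
        fix p assume "p \<in> ?S"
        then show "?r p \<odot>\<^bsub>U\<^esub> F (c \<odot>\<^bsub>X\<^esub> x) (fst p) (snd p) = c \<odot>\<^bsub>U\<^esub> (?r p \<odot>\<^bsub>U\<^esub> F x (fst p) (snd p))"
          using c x r cl by (simp add: linear_map_smult[OF F] U.smult_assoc1[symmetric] U.R.m_comm)
      qed (use c x r cl in simp)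
      also have "\<dots> = c \<odot>\<^bsub>U\<^esub> tsum k V W U (F x) t"
        using x r cl by (simp add: eq U.finsum_smult_ldistr[OF r(1) c])
      finally show ?thesis .
    qed
  qed
qed

end

end

section \<open>Exchanging records with the same underlying space\<close>

text \<open>
  The fields on which the vector space constructions depend. The spaces of \<open>H\<^sup>o\<^sup>p\<close>, of the tensor algebra
  and of the tensor Hopf algebra are not equal as records to \<open>H\<close> and to the tensor space, but they agree in
  these fields, and the rewriting below brings all of them into one normal form.
\<close>

definition same_space :: "('k, 'v, 'x) module_scheme \<Rightarrow> ('k, 'v, 'y) module_scheme \<Rightarrow> bool"
  where "same_space V W \<longleftrightarrow> carrier V = carrier W \<and> \<zero>\<^bsub>V\<^esub> = \<zero>\<^bsub>W\<^esub> \<and> add V = add W \<and> smult V = smult W"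

context
  fixes V :: "('k, 'v, 'x) module_scheme" and W :: "('k, 'v, 'y) module_scheme"
  assumes VW: "same_space V W"
begin

lemma same_space_carrier: "carrier V = carrier W"
  and same_space_zero: "\<zero>\<^bsub>V\<^esub> = \<zero>\<^bsub>W\<^esub>"
  and same_space_add: "add V = add W"
  and same_space_smult: "smult V = smult W"
  using VW by (simp_all add: same_space_def)

private lemmas eqs = same_space_carrier same_space_zero same_space_add same_space_smult

lemma same_space_finsum: "finsum V = finsum W"
  by (intro ext) (simp add: finsum_def finprod_def eqs)

lemma same_space_free_space: "free_space k V X = free_space k W X" "free_space k X V = free_space k X W"
  by (simp_all add: free_space_def eqs)

lemma same_space_null: "tensor_null k V X = tensor_null k W X" "tensor_null k X V = tensor_null k X W"
  by (simp_all add: tensor_null_def bilinearity_relations_def eqs same_space_free_space)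

lemma same_space_tensor: "tensor_space k V X = tensor_space k W X" "tensor_space k X V = tensor_space k X W"
  by (simp_all add: tensor_space_def eqs same_space_free_space same_space_null)

lemma same_space_tpure: "tpure k V X = tpure k W X" "tpure k X V = tpure k X W"
  by (intro ext; simp add: tpure_def same_space_free_space same_space_null)+

lemma same_space_linear: "linear_map k V X = linear_map k W X" "linear_map k X V = linear_map k X W"
  by (intro ext; simp add: linear_map_def eqs)+

lemma same_space_tlift: "tlift k V = tlift k W"
  by (intro ext) (simp add: tlift_def eqs same_space_finsum)

lemma same_space_tsum: "tsum k V X U = tsum k W X U" "tsum k X V U = tsum k X W U"
   "tsum k X Y V = tsum k X Y W"
  by (intro ext; simp add: tsum_def eqs same_space_tlift)+

lemma same_space_tmap: "tmap k V X = tmap k W X" "tmap k X V = tmap k X W"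
  by (intro ext; simp add: tmap_def same_space_tpure same_space_tensor)+

lemma same_space_tassoc: "tassoc k V X Y = tassoc k W X Y" "tassoc k X V Y = tassoc k X W Y"
   "tassoc k X Y V = tassoc k X Y W"
  by (intro ext; simp add: tassoc_def same_space_tpure same_space_tensor)+

lemma same_space_bilinear: "bilinear_map k V X U = bilinear_map k W X U"
  "bilinear_map k X V U = bilinear_map k X W U" "bilinear_map k X U V = bilinear_map k X U W"
  by (intro ext; simp add: bilinear_map_def eqs same_space_linear)+

lemma same_space_module: "module k V = module k W"
  by (auto simp: module_def module_axioms_def abelian_group_def abelian_monoid_def
      abelian_group_axioms_def comm_monoid_def comm_group_def monoid_def comm_monoid_axioms_def
      group_def group_axioms_def Units_def eqs)

lemmas same_space_simps = eqs same_space_finsum same_space_tensor same_space_tpure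
  same_space_linear same_space_tlift same_space_tsum same_space_tmap same_space_tassoc
  same_space_bilinear same_space_module

end

lemma same_space_op_hopf: "same_space (op_hopf H) H"
  by (simp add: same_space_def op_hopf_def)

lemma same_space_tensor_alg: "same_space (tensor_alg k A B) (tensor_space k A B)"
  by (simp add: same_space_def tensor_alg_def Let_def)

lemma same_space_tensor_hopf: "same_space (tensor_hopf k A B) (tensor_space k A B)"
  by (simp add: same_space_def tensor_hopf_def tensor_alg_def Let_def)

lemmas space_simps [simp] = same_space_simps[OF same_space_op_hopf]
  same_space_simps[OF same_space_tensor_alg] same_space_simps[OF same_space_tensor_hopf]

lemma ground_space_module:
  assumes "cring k" shows "module k (ground_space k)"
proof -
  interpret cring k by fact
  show ?thesis
  proof (rule moduleI, goal_cases)
    case 2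
    show ?case by (rule abelian_groupI) (auto simp: ground_space_def a_ac intro!: bexI[of _ "\<ominus>\<^bsub>k\<^esub> _"] l_neg)
  qed (auto simp: ground_space_def l_distr r_distr m_assoc assms)
qed

lemma ground_space_simps [simp]: "carrier (ground_space k) = carrier k"
  "x \<oplus>\<^bsub>ground_space k\<^esub> y = x \<oplus>\<^bsub>k\<^esub> y" "x \<odot>\<^bsub>ground_space k\<^esub> y = x \<otimes>\<^bsub>k\<^esub> y"
  "x \<otimes>\<^bsub>ground_space k\<^esub> y = x \<otimes>\<^bsub>k\<^esub> y" "\<one>\<^bsub>ground_space k\<^esub> = \<one>\<^bsub>k\<^esub>"
  "\<zero>\<^bsub>ground_space k\<^esub> = \<zero>\<^bsub>k\<^esub>" "twist (ground_space k) = (\<lambda>x. x)"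
  by (simp_all add: ground_space_def)

text \<open>
  Scalars enter a sum through the counit, as a linear map into the ground field; these rules make
  counits linear factors like any other.
\<close>

lemma lin_smult1:
  assumes "module k V" "v \<in> carrier V" "linear_map k X (ground_space k) f"
  shows "linear_map k X V (\<lambda>x. f x \<odot>\<^bsub>V\<^esub> v)"
proof -
  interpret V: module k V by fact
  note f = linear_mapD[OF assms(3), simplified]
  show ?thesis
    by (rule linear_mapI) (simp_all add: assms f V.smult_l_distr V.smult_assoc1)
qed

lemma lin_smult2:
  assumes "module k V" "c \<in> carrier k" "linear_map k X V f"
  shows "linear_map k X V (\<lambda>x. c \<odot>\<^bsub>V\<^esub> f x)"
proof -
  interpret V: module k V by fact
  note f = linear_mapD[OF assms(3)]
  show ?thesis
    by (rule linear_mapI) (simp_all add: assms f V.smult_r_distr V.smult_assoc1[symmetric] V.R.m_comm)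
qed

lemma lin_ground_mult1:
  assumes "cring k" "c \<in> carrier k" "linear_map k X (ground_space k) f"
  shows "linear_map k X (ground_space k) (\<lambda>x. f x \<otimes>\<^bsub>k\<^esub> c)"
  using lin_smult1[OF ground_space_module[OF assms(1)], of c X f] assms by simp

lemma lin_ground_mult2:
  assumes "cring k" "c \<in> carrier k" "linear_map k X (ground_space k) f"
  shows "linear_map k X (ground_space k) (\<lambda>x. c \<otimes>\<^bsub>k\<^esub> f x)"
  using lin_smult2[OF ground_space_module[OF assms(1)], of c X f] assms by simp

section \<open>Maps between tensor products\<close>

definition trilinear_map where
  "trilinear_map k V W X U F \<longleftrightarrow>
    (\<forall>v\<in>carrier V. bilinear_map k W X U (F v)) \<and>
    (\<forall>w\<in>carrier W. \<forall>x\<in>carrier X. linear_map k V U (\<lambda>v. F v w x))"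

lemma trilinear_mapD:
  assumes "trilinear_map k V W X U F"
  shows "\<lbrakk>v \<in> carrier V; w \<in> carrier W\<rbrakk> \<Longrightarrow> linear_map k X U (\<lambda>x. F v w x)"
    and "\<lbrakk>v \<in> carrier V; x \<in> carrier X\<rbrakk> \<Longrightarrow> linear_map k W U (\<lambda>w. F v w x)"
    and "\<lbrakk>w \<in> carrier W; x \<in> carrier X\<rbrakk> \<Longrightarrow> linear_map k V U (\<lambda>v. F v w x)"
    and "\<lbrakk>v \<in> carrier V; w \<in> carrier W; x \<in> carrier X\<rbrakk> \<Longrightarrow> F v w x \<in> carrier U"
  using assms by (auto simp: trilinear_map_def bilinear_map_def dest: linear_map_closed)

lemma trilinear_map_comp:
  assumes F: "trilinear_map k V W X U F"
  shows "\<lbrakk>linear_map k Y V f; w \<in> carrier W; x \<in> carrier X\<rbrakk> \<Longrightarrow> linear_map k Y U (\<lambda>y. F (f y) w x)"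
    and "\<lbrakk>linear_map k Y W g; v \<in> carrier V; x \<in> carrier X\<rbrakk> \<Longrightarrow> linear_map k Y U (\<lambda>y. F v (g y) x)"
    and "\<lbrakk>linear_map k Y X h; v \<in> carrier V; w \<in> carrier W\<rbrakk> \<Longrightarrow> linear_map k Y U (\<lambda>y. F v w (h y))"
  using trilinear_mapD(1-3)[OF F] linear_map_comp by blast+

lemma tmap_tsum:
  assumes "module k A" "module k B" "module k V" "module k W" "t \<in> carrier (tensor_space k A B)"
    and "linear_map k A V f" "linear_map k B W g"
  shows "tmap k V W f g t = tsum k A B (tensor_space k V W) (\<lambda>a b. tpure k V W (f a) (g b)) t"
  unfolding tmap_def
  by (rule tlift_eq_tsum)
     (use assms in \<open>auto intro!: tensor_space_module tpure_closed linear_map_closed[OF assms(6)] linear_map_closed[OF assms(7)]\<close>)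

lemma tmap_linear:
  assumes "module k A" "module k B" "module k V" "module k W" 
    and f: "linear_map k A V f" and g: "linear_map k B W g"
  shows "linear_map k (tensor_space k A B) (tensor_space k V W) (tmap k V W f g)"
  unfolding tmap_def
  by (intro tlift_linear assms tensor_space_module bilinear_mapI lin_tpure1 lin_tpure2 linear_map_closed[OF f] linear_map_closed[OF g])

lemma tassoc_expand:
  assumes M: "module k X" "module k V" "module k W"
    and t: "t \<in> carrier (tensor_space k (tensor_space k X V) W)"
  shows "tassoc k X V W t = tsum k (tensor_space k X V) W (tensor_space k X (tensor_space k V W))
    (\<lambda>s w. tsum k X V (tensor_space k X (tensor_space k V W))
      (\<lambda>x v. tpure k X (tensor_space k V W) x (tpure k V W v w)) s) t"
proof -
  note [simp] = M tensor_space_module tpure_closed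
  let ?T = "tensor_space k X (tensor_space k V W)"
  have "tassoc k X V W t = tlift k ?T (\<lambda>s w. tlift k ?T (\<lambda>u v. tpure k X (tensor_space k V W) u (tpure k V W v w)) s) t"
    by (simp add: tassoc_def Let_def)
  also have "\<dots> = tsum k (tensor_space k X V) W ?T (\<lambda>s w. tlift k ?T (\<lambda>u v. tpure k X (tensor_space k V W) u (tpure k V W v w)) s) t"
    by (rule tlift_eq_tsum) (use t in \<open>auto intro!: tlift_closed[OF M(1,2)]\<close>)
  also have "\<dots> = tsum k (tensor_space k X V) W ?T (\<lambda>s w. tsum k X V ?T (\<lambda>u v. tpure k X (tensor_space k V W) u (tpure k V W v w)) s) t"
    by (rule tsum_body_cong, rule tlift_eq_tsum) (simp_all add: M)
  finally show ?thesis .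
qed

lemma tsum_tassoc:
  assumes M: "module k X" "module k V" "module k W" "module k U"
    and t: "t \<in> carrier (tensor_space k (tensor_space k X V) W)"
    and F: "trilinear_map k X V W U F"
  shows "tsum k X (tensor_space k V W) U (\<lambda>x s. tsum k V W U (F x) s) (tassoc k X V W t) =
    tsum k (tensor_space k X V) W U (\<lambda>s w. tsum k X V U (\<lambda>x v. F x v w) s) t"
proof -
  note [simp] = M tensor_space_module tpure_closed
  note Fl = trilinear_mapD[OF F]
  let ?T = "tensor_space k X (tensor_space k V W)"
  let ?G = "\<lambda>x s. tsum k V W U (F x) s"
  have G: "bilinear_map k X (tensor_space k V W) U ?G"
    by (intro bilinear_mapI tsum_linear lin_tsum_param) (auto intro: Fl)
  show ?thesis
    unfolding tassoc_expand[OF M(1-3) t]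
    apply (subst linear_map_tsum[OF tsum_linear[OF _ _ _ G]])
    using t apply (auto intro!: tsum_closed)[8]
    apply (rule tsum_body_cong)
    apply (subst linear_map_tsum[OF tsum_linear[OF _ _ _ G]])
    apply (auto)[8]
    apply (rule tsum_body_cong)
    apply (subst tsum_pure[OF _ _ _ G], simp_all)
    apply (subst tsum_pure, simp_all)
    apply (auto intro!: bilinear_mapI Fl)
    done
qed

section \<open>Rewriting rules for Hom-structures\<close>

lemmas [simp] = tensor_space_module tpure_closed tsum_closed

lemma tsum_tsum:
  assumes "module k V" "module k W" "module k V'" "module k W'" "module k U"
    and "t \<in> carrier (tensor_space k V W)"
    and "\<And>v w. \<lbrakk>v \<in> carrier V; w \<in> carrier W\<rbrakk> \<Longrightarrow> g v w \<in> carrier (tensor_space k V' W')"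
    and f: "bilinear_map k V' W' U f"
  shows "tsum k V' W' U f (tsum k V W (tensor_space k V' W') g t) =
    tsum k V W U (\<lambda>a b. tsum k V' W' U f (g a b)) t"
  by (rule linear_map_tsum[OF tsum_linear[OF _ _ _ f]]) (simp_all add: assms)

lemmas [simp] = tsum_pure tsum_tsum bilinear_map_def trilinear_map_def
lemmas lin_simps [simp] = linear_map_id lin_tpure1 lin_tpure2 lin_tsum_arg lin_tsum_param lin_smult1 lin_smult2

context hom_vector_space
begin

lemma space [simp]: "module k V"
  by (rule V.module_axioms)

lemma cring_k [simp]: "cring k"
  by (rule k.is_cring)

lemma ground [simp]: "module k (ground_space k)"
  by (rule ground_space_module) simp

lemma twist_closed [simp]: "x \<in> carrier V \<Longrightarrow> twist V x \<in> carrier V"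
  by (rule linear_map_closed[OF twist_linear])

lemma lin_twist [simp]: "linear_map k X V f \<Longrightarrow> linear_map k X V (\<lambda>x. twist V (f x))"
  by (rule linear_map_comp[OF twist_linear])

lemma twist_inv_closed [simp]: "x \<in> carrier V \<Longrightarrow> twist_inv V x \<in> carrier V"
  unfolding twist_inv_def using twist_bij by (metis bij_betw_def inv_into_into)

lemma twist_twist_inv [simp]: "x \<in> carrier V \<Longrightarrow> twist V (twist_inv V x) = x"
  unfolding twist_inv_def using twist_bij by (metis bij_betw_def f_inv_into_f)

lemma twist_inv_twist [simp]: "x \<in> carrier V \<Longrightarrow> twist_inv V (twist V x) = x"
  unfolding twist_inv_def using twist_bij by (metis bij_betw_def inv_into_f_f)

lemma twist_eq_iff: "\<lbrakk>x \<in> carrier V; y \<in> carrier V\<rbrakk> \<Longrightarrow> twist V x = twist V y \<longleftrightarrow> x = y"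
  by (metis twist_inv_twist)

lemma twist_inv_linear: "linear_map k V V (twist_inv V)"
  by (rule linear_mapI)
     (simp_all add: linear_mapD[OF twist_linear] flip: twist_eq_iff)

lemma lin_twist_inv [simp]: "linear_map k X V f \<Longrightarrow> linear_map k X V (\<lambda>x. twist_inv V (f x))"
  by (rule linear_map_comp[OF twist_inv_linear])

end

context hom_algebra
begin

lemma mult_closed [simp]: "\<lbrakk>x \<in> carrier A; y \<in> carrier A\<rbrakk> \<Longrightarrow> x \<otimes>\<^bsub>A\<^esub> y \<in> carrier A"
  by (rule bilinear_map_closed[OF mult_bilinear])

lemma lin_mult1 [simp]: "\<lbrakk>c \<in> carrier A; linear_map k X A f\<rbrakk> \<Longrightarrow> linear_map k X A (\<lambda>x. f x \<otimes>\<^bsub>A\<^esub> c)"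
  by (rule linear_map_comp[OF bilinear_map_left[OF mult_bilinear]])

lemma lin_mult2 [simp]: "\<lbrakk>c \<in> carrier A; linear_map k X A f\<rbrakk> \<Longrightarrow> linear_map k X A (\<lambda>x. c \<otimes>\<^bsub>A\<^esub> f x)"
  by (rule linear_map_comp[OF bilinear_map_right[OF mult_bilinear]])

lemmas algebra_rules = mult_closed lin_mult1 lin_mult2

declare one_closed [simp] twist_one [simp] one_mult [simp] mult_one [simp]

lemma twist_inv_mult: "\<lbrakk>x \<in> carrier A; y \<in> carrier A\<rbrakk> \<Longrightarrow>
    twist_inv A (x \<otimes>\<^bsub>A\<^esub> y) = twist_inv A x \<otimes>\<^bsub>A\<^esub> twist_inv A y"
  by (simp add: twist_mult flip: twist_eq_iff)

end

context hom_coalgebra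
begin

abbreviation CC where "CC \<equiv> tensor_space k C C"

lemma comult_closed [simp]: "x \<in> carrier C \<Longrightarrow> comult C x \<in> carrier CC"
  by (rule linear_map_closed[OF comult_linear])

lemma lin_comult [simp]: "linear_map k X C f \<Longrightarrow> linear_map k X CC (\<lambda>x. comult C (f x))"
  by (rule linear_map_comp[OF comult_linear])

lemma counit_closed [simp]: "x \<in> carrier C \<Longrightarrow> counit C x \<in> carrier k"
  using linear_map_closed[OF counit_linear] by simp

lemma lin_counit [simp]: "linear_map k X C f \<Longrightarrow> linear_map k X (ground_space k) (\<lambda>x. counit C (f x))"
  by (rule linear_map_comp[OF counit_linear])

lemmas coalgebra_rules = comult_closed lin_comult counit_closed lin_counit

lemma tsum_counit_left:
  assumes c: "c \<in> carrier C"
  shows "tsum k C C C (\<lambda>x y. counit C x \<odot>\<^bsub>C\<^esub> y) (comult C c) = twist C c"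
  using counit_left[OF c] tlift_eq_tsum[OF space space space comult_closed[OF c], of "\<lambda>x y. counit C x \<odot>\<^bsub>C\<^esub> y"]
  by simp

lemma tsum_counit_right:
  assumes c: "c \<in> carrier C"
  shows "tsum k C C C (\<lambda>x y. counit C y \<odot>\<^bsub>C\<^esub> x) (comult C c) = twist C c"
  using counit_right[OF c] tlift_eq_tsum[OF space space space comult_closed[OF c], of "\<lambda>x y. counit C y \<odot>\<^bsub>C\<^esub> x"]
  by simp

text \<open>
  In a calculation the other factor usually stands inside a linear function \<open>f\<close>; the axiom applies after
  \<open>f\<close> has been pulled out of the sum.
\<close>

lemma tsum_counit1 [simp]:
  assumes c: "c \<in> carrier C" and U: "module k U" and f: "linear_map k C U f"
  shows "tsum k C C U (\<lambda>x y. counit C x \<odot>\<^bsub>U\<^esub> f y) (comult C c) = f (twist C c)"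
  unfolding tsum_counit_left[OF c, symmetric]
  by (subst linear_map_tsum[OF f]) (simp_all add: c U linear_map_smult[OF f])

lemma tsum_counit2 [simp]:
  assumes c: "c \<in> carrier C" and U: "module k U" and f: "linear_map k C U f"
  shows "tsum k C C U (\<lambda>x y. counit C y \<odot>\<^bsub>U\<^esub> f x) (comult C c) = f (twist C c)"
  unfolding tsum_counit_right[OF c, symmetric]
  by (subst linear_map_tsum[OF f]) (simp_all add: c U linear_map_smult[OF f])

lemma tmap_comult [simp]:
  assumes "c \<in> carrier C" "linear_map k C V f" "linear_map k C W g" "module k V" "module k W"
  shows "tmap k V W f g (comult C c) = tsum k C C (tensor_space k V W) (\<lambda>x y. tpure k V W (f x) (g y)) (comult C c)"
  by (rule tmap_tsum) (simp_all add: assms)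

lemma tsum_comult_twist:
  assumes c: "c \<in> carrier C" and U: "module k U" and F: "bilinear_map k C C U F"
  shows "tsum k C C U F (comult C (twist C c)) = tsum k C C U (\<lambda>x y. F (twist C x) (twist C y)) (comult C c)"
proof -
  note [simp] = bilinear_map_closed[OF F]
  have "comult C (twist C c) = tsum k C C CC (\<lambda>x y. tpure k C C (twist C x) (twist C y)) (comult C c)"
    unfolding comult_twist[OF c, symmetric] using c by (intro tmap_tsum) auto
  then show ?thesis
    using c U F by (simp add: linear_map_tsum[OF tsum_linear[OF _ _ _ F]] tsum_pure)
qed

text \<open>
  Apply to both sides of the axiom the map on \<open>C \<otimes> (C \<otimes> C)\<close> induced by the trilinear \<open>F\<close>.
\<close>

lemma tsum_coassoc:
  assumes c: "c \<in> carrier C" and U: "module k U" and F: "trilinear_map k C C C U F"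
  shows "tsum k C C U (\<lambda>x y. tsum k C C U (\<lambda>x1 x2. F x1 x2 (twist C y)) (comult C x)) (comult C c) =
    tsum k C C U (\<lambda>x y. tsum k C C U (\<lambda>y1 y2. F (twist C x) y1 y2) (comult C y)) (comult C c)"
proof -
  note Fl = trilinear_mapD[OF F]
  note [simp] = c U Fl
  have G: "bilinear_map k CC C U (\<lambda>s y. tsum k C C U (\<lambda>x1 x2. F x1 x2 y) s)"
    "bilinear_map k C CC U (\<lambda>x s. tsum k C C U (\<lambda>y1 y2. F x y1 y2) s)"
    by (auto simp: bilinear_map_def)
  let ?G = "\<lambda>s. tsum k C CC U (\<lambda>x s. tsum k C C U (\<lambda>y1 y2. F x y1 y2) s) s"
  have "?G (tassoc k C C C (tmap k CC C (comult C) (twist C) (comult C c))) =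
      tsum k C C U (\<lambda>x y. tsum k C C U (\<lambda>x1 x2. F x1 x2 (twist C y)) (comult C x)) (comult C c)"
    using linear_map_closed[of k C C "twist C"] by (simp add: tsum_tassoc[OF _ _ _ _ _ F] linear_map_closed[OF comult_linear])
  moreover have "?G (tmap k C CC (twist C) (comult C) (comult C c)) =
      tsum k C C U (\<lambda>x y. tsum k C C U (\<lambda>y1 y2. F (twist C x) y1 y2) (comult C y)) (comult C c)"
    by simp
  ultimately show ?thesis
    using hom_coassoc[OF c] by simp
qed

end

section \<open>Tensor products of Hom-algebras\<close>

lemma tensor_twist:
  assumes A: "hom_vector_space k A" and B: "hom_vector_space k B"
  shows "linear_map k (tensor_space k A B) (tensor_space k A B) (tmap k A B (twist A) (twist B))"
    and "bij_betw (tmap k A B (twist A) (twist B)) (carrier (tensor_space k A B)) (carrier (tensor_space k A B))"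
    and "\<lbrakk>a \<in> carrier A; b \<in> carrier B\<rbrakk> \<Longrightarrow>
      tmap k A B (twist A) (twist B) (tpure k A B a b) = tpure k A B (twist A a) (twist B b)"
proof -
  interpret A: hom_vector_space k A by fact
  interpret B: hom_vector_space k B by fact
  let ?T = "tensor_space k A B"
  let ?f = "tmap k A B (twist A) (twist B)" and ?g = "tmap k A B (twist_inv A) (twist_inv B)"
  show f: "linear_map k ?T ?T ?f"
    by (rule tmap_linear) simp_all
  have g: "linear_map k ?T ?T ?g"
    by (rule tmap_linear) simp_all
  have pure: "tmap k A B p q (tpure k A B a b) = tpure k A B (p a) (q b)"
    if "linear_map k A A p" "linear_map k B B q" "a \<in> carrier A" "b \<in> carrier B" for p q a b
    by (subst tmap_tsum[of k A B A B])
       (use that linear_map_closed[OF that(1)] linear_map_closed[OF that(2)] in simp_all)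
  show "?f (tpure k A B a b) = tpure k A B (twist A a) (twist B b)"
    if "a \<in> carrier A" "b \<in> carrier B"
    by (rule pure) (use that in simp_all)
  have gf: "?g (?f t) = t" if "t \<in> carrier ?T" for t
    by (rule tensor_linear_ext[OF linear_map_comp[OF g f] linear_map_id])
       (use that in \<open>simp_all add: pure\<close>)
  have fg: "?f (?g t) = t" if "t \<in> carrier ?T" for t
    by (rule tensor_linear_ext[OF linear_map_comp[OF f g] linear_map_id])
       (use that in \<open>simp_all add: pure\<close>)
  show "bij_betw ?f (carrier ?T) (carrier ?T)"
    by (rule bij_betwI[where g = ?g])
       (auto simp: fg gf linear_map_closed[OF f] linear_map_closed[OF g])
qed

lemma hom_vector_space_transfer:
  assumes "hom_vector_space k W" "same_space V W" "twist V = twist W"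
  shows "hom_vector_space k V"
  using assms(1,3) unfolding hom_vector_space_def hom_vector_space_axioms_def
  by (simp add: same_space_simps[OF assms(2)])

lemma hom_algebra_transfer:
  assumes "hom_algebra k W" "same_space V W" "twist V = twist W" "mult V = mult W" "\<one>\<^bsub>V\<^esub> = \<one>\<^bsub>W\<^esub>"
  shows "hom_algebra k V"
proof -
  interpret W: hom_algebra k W by fact
  interpret V: hom_vector_space k V by (rule hom_vector_space_transfer[OF _ assms(2,3)]) unfold_locales
  note [simp] = same_space_simps[OF assms(2)] assms(3-)
  show ?thesis
    by unfold_locales (simp_all add: W.twist_mult W.hom_assoc)
qed

lemma hom_vector_space_tensor_alg:
  assumes A: "hom_vector_space k A" and B: "hom_vector_space k B"
  shows "hom_vector_space k (tensor_alg k A B)"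
proof -
  interpret A: hom_vector_space k A by fact
  interpret B: hom_vector_space k B by fact
  have [simp]: "twist (tensor_alg k A B) = tmap k A B (twist A) (twist B)"
    by (simp add: tensor_alg_def Let_def)
  show ?thesis
    unfolding hom_vector_space_def hom_vector_space_axioms_def
    using tensor_twist(1,2)[OF A B] A.k.field_axioms by simp
qed

lemma tensor_alg_mult_tsum:
  assumes A: "hom_algebra k A" and B: "hom_algebra k B"
    and s: "s \<in> carrier (tensor_space k A B)" and t: "t \<in> carrier (tensor_space k A B)"
  shows "s \<otimes>\<^bsub>tensor_alg k A B\<^esub> t = tsum k A B (tensor_space k A B) (\<lambda>a b.
    tsum k A B (tensor_space k A B) (\<lambda>a' b'. tpure k A B (a \<otimes>\<^bsub>A\<^esub> a') (b \<otimes>\<^bsub>B\<^esub> b')) t) s"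
proof -
  interpret A: hom_algebra k A by fact
  interpret B: hom_algebra k B by fact
  let ?T = "tensor_space k A B"
  have inner: "tlift k ?T (\<lambda>a' b'. tpure k A B (a \<otimes>\<^bsub>A\<^esub> a') (b \<otimes>\<^bsub>B\<^esub> b')) t =
     tsum k A B ?T (\<lambda>a' b'. tpure k A B (a \<otimes>\<^bsub>A\<^esub> a') (b \<otimes>\<^bsub>B\<^esub> b')) t"
    if "a \<in> carrier A" "b \<in> carrier B" for a b
    by (rule tlift_eq_tsum) (use t that in simp_all)
  have "s \<otimes>\<^bsub>tensor_alg k A B\<^esub> t =
      tlift k ?T (\<lambda>a b. tlift k ?T (\<lambda>a' b'. tpure k A B (a \<otimes>\<^bsub>A\<^esub> a') (b \<otimes>\<^bsub>B\<^esub> b')) t) s"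
    by (simp add: tensor_alg_def Let_def)
  also have "\<dots> = tsum k A B ?T (\<lambda>a b. tlift k ?T (\<lambda>a' b'. tpure k A B (a \<otimes>\<^bsub>A\<^esub> a') (b \<otimes>\<^bsub>B\<^esub> b')) t) s"
    by (rule tlift_eq_tsum) (use s t inner in simp_all)
  also have "\<dots> = tsum k A B ?T (\<lambda>a b. tsum k A B ?T (\<lambda>a' b'. tpure k A B (a \<otimes>\<^bsub>A\<^esub> a') (b \<otimes>\<^bsub>B\<^esub> b')) t) s"
    by (rule tsum_cong[OF refl refl refl inner])
  finally show ?thesis .
qed

lemma tensor_alg_mult_pure:
  assumes A: "hom_algebra k A" and B: "hom_algebra k B"
    and "a \<in> carrier A" "b \<in> carrier B" "a' \<in> carrier A" "b' \<in> carrier B"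
  shows "tpure k A B a b \<otimes>\<^bsub>tensor_alg k A B\<^esub> tpure k A B a' b' = tpure k A B (a \<otimes>\<^bsub>A\<^esub> a') (b \<otimes>\<^bsub>B\<^esub> b')"
proof -
  interpret A: hom_algebra k A by fact
  interpret B: hom_algebra k B by fact
  show ?thesis using assms by (simp add: tensor_alg_mult_tsum[OF A B])
qed

lemma tensor_alg_simps:
  "\<one>\<^bsub>tensor_alg k A B\<^esub> = tpure k A B \<one>\<^bsub>A\<^esub> \<one>\<^bsub>B\<^esub>"
  "twist (tensor_alg k A B) = tmap k A B (twist A) (twist B)"
  by (simp_all add: tensor_alg_def Let_def)

lemma hom_algebra_tensor_alg:
  assumes A: "hom_algebra k A" and B: "hom_algebra k B"
  shows "hom_algebra k (tensor_alg k A B)"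
proof -
  interpret A: hom_algebra k A by fact
  interpret B: hom_algebra k B by fact
  let ?K = "tensor_alg k A B" and ?T = "tensor_space k A B"
  interpret K: hom_vector_space k ?K by (rule hom_vector_space_tensor_alg) unfold_locales
  note mult = tensor_alg_mult_tsum[OF A B]
  have K: "twist ?K = tmap k A B (twist A) (twist B)" "\<one>\<^bsub>?K\<^esub> = tpure k A B \<one>\<^bsub>A\<^esub> \<one>\<^bsub>B\<^esub>"
    by (simp_all add: tensor_alg_def Let_def)
  have [simp]: "twist ?K (tpure k A B a b) = tpure k A B (twist A a) (twist B b)"
    if "a \<in> carrier A" "b \<in> carrier B" for a b
    unfolding K by (rule tensor_twist(3)) (use that in \<open>simp_all, unfold_locales\<close>)
  have [simp]: "twist ?K t \<in> carrier ?T" if "t \<in> carrier ?T" for t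
    using K.twist_closed that by simp
  have bil: "bilinear_map k ?T ?T ?T (mult ?K)"
  proof (rule bilinear_mapI)
    show "linear_map k ?T ?T (mult ?K s)" if "s \<in> carrier ?T" for s
      by (rule linear_map_cong[of k _ _ "\<lambda>t. tsum k A B ?T (\<lambda>a b.
          tsum k A B ?T (\<lambda>a' b'. tpure k A B (a \<otimes>\<^bsub>A\<^esub> a') (b \<otimes>\<^bsub>B\<^esub> b')) t) s"])
         (use that in \<open>simp_all add: mult\<close>)
    show "linear_map k ?T ?T (\<lambda>s. s \<otimes>\<^bsub>?K\<^esub> t)" if "t \<in> carrier ?T" for t
      by (rule linear_map_cong[of k _ _ "\<lambda>s. tsum k A B ?T (\<lambda>a b.
          tsum k A B ?T (\<lambda>a' b'. tpure k A B (a \<otimes>\<^bsub>A\<^esub> a') (b \<otimes>\<^bsub>B\<^esub> b')) t) s"])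
         (use that in \<open>simp_all add: mult\<close>)
  qed
  have pure [simp]: "tpure k A B a b \<otimes>\<^bsub>?K\<^esub> tpure k A B a' b' = tpure k A B (a \<otimes>\<^bsub>A\<^esub> a') (b \<otimes>\<^bsub>B\<^esub> b')"
    if "a \<in> carrier A" "b \<in> carrier B" "a' \<in> carrier A" "b' \<in> carrier B" for a b a' b'
    using that by (rule tensor_alg_mult_pure[OF A B])
  have [simp]: "s \<otimes>\<^bsub>?K\<^esub> t \<in> carrier ?T" if "s \<in> carrier ?T" "t \<in> carrier ?T" for s t
    by (rule bilinear_map_closed[OF bil that])
  have [simp]: "linear_map k X ?T (\<lambda>x. c \<otimes>\<^bsub>?K\<^esub> f x)" "linear_map k X ?T (\<lambda>x. f x \<otimes>\<^bsub>?K\<^esub> c)"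
    if "c \<in> carrier ?T" "linear_map k X ?T f" for X f c
    using linear_map_comp[OF bilinear_map_right[OF bil]] linear_map_comp[OF bilinear_map_left[OF bil]] that by auto
  have [simp]: "linear_map k X ?T (\<lambda>x. twist ?K (f x))" if "linear_map k X ?T f" for X f
    using K.lin_twist that by simp
  have [simp]: "\<one>\<^bsub>?K\<^esub> \<in> carrier ?T" by (simp add: K)
  have ext: "L t = L' t" if "linear_map k ?T ?T L" "linear_map k ?T ?T L'" "t \<in> carrier ?T"
      "\<And>a b. \<lbrakk>a \<in> carrier A; b \<in> carrier B\<rbrakk> \<Longrightarrow> L (tpure k A B a b) = L' (tpure k A B a b)" for L L' t
    by (rule tensor_linear_ext[OF that(1,2) _ _ _ that(3,4)]) simp_all
  show ?thesis
  proof unfold_locales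
    show "bilinear_map k ?K ?K ?K (mult ?K)" using bil by (simp del: bilinear_map_def)
    show "\<one>\<^bsub>?K\<^esub> \<in> carrier ?K" by simp
    show "twist ?K \<one>\<^bsub>?K\<^esub> = \<one>\<^bsub>?K\<^esub>" by (simp add: K(2))
    show "\<one>\<^bsub>?K\<^esub> \<otimes>\<^bsub>?K\<^esub> s = twist ?K s" if "s \<in> carrier ?K" for s
      by (rule ext[of "\<lambda>s. \<one>\<^bsub>?K\<^esub> \<otimes>\<^bsub>?K\<^esub> s"]) (use that in \<open>simp_all add: K(2)\<close>)
    show "s \<otimes>\<^bsub>?K\<^esub> \<one>\<^bsub>?K\<^esub> = twist ?K s" if "s \<in> carrier ?K" for s
      by (rule ext[of "\<lambda>s. s \<otimes>\<^bsub>?K\<^esub> \<one>\<^bsub>?K\<^esub>"]) (use that in \<open>simp_all add: K(2)\<close>)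
    show "twist ?K (s \<otimes>\<^bsub>?K\<^esub> t) = twist ?K s \<otimes>\<^bsub>?K\<^esub> twist ?K t"
      if "s \<in> carrier ?K" "t \<in> carrier ?K" for s t
    proof (rule ext[of "\<lambda>s. twist ?K (s \<otimes>\<^bsub>?K\<^esub> t)"], goal_cases)
      case (4 a b)
      then show ?case
        by (intro ext[of "\<lambda>t. twist ?K (_ \<otimes>\<^bsub>?K\<^esub> t)" _ t])
           (use that in \<open>simp_all add: A.twist_mult B.twist_mult\<close>)
    qed (use that in simp_all)
    show "twist ?K s \<otimes>\<^bsub>?K\<^esub> (t \<otimes>\<^bsub>?K\<^esub> u) = (s \<otimes>\<^bsub>?K\<^esub> t) \<otimes>\<^bsub>?K\<^esub> twist ?K u"
      if "s \<in> carrier ?K" "t \<in> carrier ?K" "u \<in> carrier ?K" for s t u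
    proof (rule ext[of "\<lambda>s. twist ?K s \<otimes>\<^bsub>?K\<^esub> (t \<otimes>\<^bsub>?K\<^esub> u)"], goal_cases)
      case (4 a b)
      show ?case
      proof (rule ext[of "\<lambda>t. twist ?K (tpure k A B a b) \<otimes>\<^bsub>?K\<^esub> (t \<otimes>\<^bsub>?K\<^esub> u)"], goal_cases)
        case (4 a' b')
        show ?case
          by (rule ext[of "\<lambda>u. twist ?K (tpure k A B a b) \<otimes>\<^bsub>?K\<^esub> (tpure k A B a' b' \<otimes>\<^bsub>?K\<^esub> u)"])
             (use that 4 \<open>a \<in> carrier A\<close> \<open>b \<in> carrier B\<close> in \<open>simp_all add: A.hom_assoc B.hom_assoc\<close>)
      qed (use that 4 in simp_all)
    qed (use that in simp_all)
  qed
qed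

section \<open>Distributing maps over sums\<close>

lemma tmap_tpure [simp]:
  assumes "module k A" "module k B" "module k V" "module k W"
    "linear_map k A V f" "linear_map k B W g" "a \<in> carrier A" "b \<in> carrier B"
  shows "tmap k V W f g (tpure k A B a b) = tpure k V W (f a) (g b)"
  by (subst tmap_tsum[of k A B V W])
     (use assms linear_map_closed[OF assms(5)] linear_map_closed[OF assms(6)] in simp_all)

lemma tmap_of_tsum [simp]:
  assumes "module k A" "module k B" "module k V" "module k W"
    "linear_map k A V f" "linear_map k B W g" "module k C" "module k D" "t \<in> carrier (tensor_space k C D)"
    "\<And>c d. \<lbrakk>c \<in> carrier C; d \<in> carrier D\<rbrakk> \<Longrightarrow> h c d \<in> carrier (tensor_space k A B)"
  shows "tmap k V W f g (tsum k C D (tensor_space k A B) h t) =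
    tsum k C D (tensor_space k V W) (\<lambda>c d. tmap k V W f g (h c d)) t"
  by (rule linear_map_tsum[OF tmap_linear]) (use assms in simp_all)

lemma lin_tmap:
  assumes "module k A" "module k B" "module k V" "module k W"
    "linear_map k A V f" "linear_map k B W g" "linear_map k X (tensor_space k A B) h"
  shows "linear_map k X (tensor_space k V W) (\<lambda>x. tmap k V W f g (h x))"
  by (rule linear_map_comp[OF tmap_linear assms(7)]) (use assms in simp_all)

lemma tassoc_linear:
  assumes M: "module k X" "module k V" "module k W"
  shows "linear_map k (tensor_space k (tensor_space k X V) W) (tensor_space k X (tensor_space k V W)) (tassoc k X V W)"
  by (rule linear_map_cong[OF _ _ tassoc_expand[OF M, symmetric]]) (simp_all add: M)

lemma lin_tassoc [simp]:
  assumes M: "module k X" "module k V" "module k W"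
    and f: "linear_map k Y (tensor_space k (tensor_space k X V) W) f"
  shows "linear_map k Y (tensor_space k X (tensor_space k V W)) (\<lambda>y. tassoc k X V W (f y))"
  by (rule linear_map_comp[OF tassoc_linear[OF M] f])

lemma tassoc_tpure [simp]:
  assumes M: "module k X" "module k V" "module k W"
    and "s \<in> carrier (tensor_space k X V)" "w \<in> carrier W"
  shows "tassoc k X V W (tpure k (tensor_space k X V) W s w) = tsum k X V (tensor_space k X (tensor_space k V W))
      (\<lambda>x v. tpure k X (tensor_space k V W) x (tpure k V W v w)) s"
  by (subst tassoc_expand) (simp_all add: assms)

lemma tassoc_of_tsum [simp]:
  assumes "module k X" "module k V" "module k W" "module k C" "module k D" "t \<in> carrier (tensor_space k C D)"
    "\<And>c d. \<lbrakk>c \<in> carrier C; d \<in> carrier D\<rbrakk> \<Longrightarrow> h c d \<in> carrier (tensor_space k (tensor_space k X V) W)"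
  shows "tassoc k X V W (tsum k C D (tensor_space k (tensor_space k X V) W) h t) =
    tsum k C D (tensor_space k X (tensor_space k V W)) (\<lambda>c d. tassoc k X V W (h c d)) t"
  by (rule linear_map_tsum[OF tassoc_linear]) (use assms in simp_all)

lemma tpure_tsum_right [simp]:
  assumes "module k V" "module k W" "module k C" "module k D" "t \<in> carrier (tensor_space k C D)"
    "\<And>c d. \<lbrakk>c \<in> carrier C; d \<in> carrier D\<rbrakk> \<Longrightarrow> h c d \<in> carrier W" "v \<in> carrier V"
  shows "tpure k V W v (tsum k C D W h t) = tsum k C D (tensor_space k V W) (\<lambda>c d. tpure k V W v (h c d)) t"
  by (rule linear_map_tsum[of k W _ "tpure k V W v"]) (use assms in simp_all)

lemma tpure_tsum_left [simp]:
  assumes "module k V" "module k W" "module k C" "module k D" "t \<in> carrier (tensor_space k C D)"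
    "\<And>c d. \<lbrakk>c \<in> carrier C; d \<in> carrier D\<rbrakk> \<Longrightarrow> h c d \<in> carrier V" "w \<in> carrier W"
  shows "tpure k V W (tsum k C D V h t) w = tsum k C D (tensor_space k V W) (\<lambda>c d. tpure k V W (h c d) w) t"
  by (rule linear_map_tsum[of k V _ "\<lambda>v. tpure k V W v w"]) (use assms in simp_all)

section \<open>Tensor products of Hom-coalgebras\<close>

lemma tensor_hopf_simps:
  "twist (tensor_hopf k A B) = tmap k A B (twist A) (twist B)"
  "mult (tensor_hopf k A B) = mult (tensor_alg k A B)"
  "\<one>\<^bsub>tensor_hopf k A B\<^esub> = tpure k A B \<one>\<^bsub>A\<^esub> \<one>\<^bsub>B\<^esub>"
  "antipode (tensor_hopf k A B) = tmap k A B (antipode A) (antipode B)"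
  by (simp_all add: tensor_hopf_def tensor_alg_def Let_def)

lemma tensor_hopf_counit_tsum:
  assumes A: "hom_coalgebra k A" and B: "hom_coalgebra k B" and t: "t \<in> carrier (tensor_space k A B)"
  shows "counit (tensor_hopf k A B) t = tsum k A B (ground_space k) (\<lambda>a b. counit A a \<otimes>\<^bsub>k\<^esub> counit B b) t"
proof -
  interpret A: hom_coalgebra k A by fact
  interpret B: hom_coalgebra k B by fact
  have "counit (tensor_hopf k A B) t = tlift k (ground_space k) (\<lambda>a b. counit A a \<otimes>\<^bsub>k\<^esub> counit B b) t"
    by (simp add: tensor_hopf_def Let_def)
  also have "\<dots> = tsum k A B (ground_space k) (\<lambda>a b. counit A a \<otimes>\<^bsub>k\<^esub> counit B b) t"
    by (rule tlift_eq_tsum) (simp_all add: t)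
  finally show ?thesis .
qed

lemma tensor_hopf_comult_tsum:
  assumes A: "hom_coalgebra k A" and B: "hom_coalgebra k B" and t: "t \<in> carrier (tensor_space k A B)"
  defines "T \<equiv> tensor_space k A B"
  shows "comult (tensor_hopf k A B) t = tsum k A B (tensor_space k T T) (\<lambda>a b.
    tsum k A A (tensor_space k T T) (\<lambda>a1 a2. tsum k B B (tensor_space k T T)
      (\<lambda>b1 b2. tpure k T T (tpure k A B a1 b1) (tpure k A B a2 b2)) (comult B b)) (comult A a)) t"
proof -
  interpret A: hom_coalgebra k A by fact
  interpret B: hom_coalgebra k B by fact
  let ?TT = "tensor_space k T T"
  have T: "module k T" unfolding T_def by simp
  have p: "tpure k A B a b \<in> carrier T" if "a \<in> carrier A" "b \<in> carrier B" for a b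
    unfolding T_def using that by simp
  have 1: "tlift k ?TT (\<lambda>b1 b2. tpure k T T (tpure k A B a1 b1) (tpure k A B a2 b2)) (comult B b) =
      tsum k B B ?TT (\<lambda>b1 b2. tpure k T T (tpure k A B a1 b1) (tpure k A B a2 b2)) (comult B b)"
    if "a1 \<in> carrier A" "a2 \<in> carrier A" "b \<in> carrier B" for a1 a2 b
    by (rule tlift_eq_tsum) (simp_all add: that T p)
  have 2: "tlift k ?TT (\<lambda>a1 a2. tlift k ?TT (\<lambda>b1 b2. tpure k T T (tpure k A B a1 b1) (tpure k A B a2 b2)) (comult B b)) (comult A a) =
      tsum k A A ?TT (\<lambda>a1 a2. tlift k ?TT (\<lambda>b1 b2. tpure k T T (tpure k A B a1 b1) (tpure k A B a2 b2)) (comult B b)) (comult A a)"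
    if "a \<in> carrier A" "b \<in> carrier B" for a b
    by (rule tlift_eq_tsum) (simp_all add: that T p 1)
  have "comult (tensor_hopf k A B) t = tlift k ?TT (\<lambda>a b. tlift k ?TT (\<lambda>a1 a2. tlift k ?TT
     (\<lambda>b1 b2. tpure k T T (tpure k A B a1 b1) (tpure k A B a2 b2)) (comult B b)) (comult A a)) t"
    by (simp add: tensor_hopf_def Let_def T_def)
  also have "\<dots> = tsum k A B ?TT (\<lambda>a b. tlift k ?TT (\<lambda>a1 a2. tlift k ?TT
     (\<lambda>b1 b2. tpure k T T (tpure k A B a1 b1) (tpure k A B a2 b2)) (comult B b)) (comult A a)) t"
    by (rule tlift_eq_tsum) (use t in \<open>simp_all add: T p 1 2\<close>)
  also have "\<dots> = tsum k A B ?TT (\<lambda>a b. tsum k A A ?TT (\<lambda>a1 a2. tsum k B B ?TT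
     (\<lambda>b1 b2. tpure k T T (tpure k A B a1 b1) (tpure k A B a2 b2)) (comult B b)) (comult A a)) t"
    by (simp add: 1 2)
  finally show ?thesis .
qed

lemma tensor_hopf_comult_pure:
  assumes A: "hom_coalgebra k A" and B: "hom_coalgebra k B" and "a \<in> carrier A" "b \<in> carrier B"
  defines "T \<equiv> tensor_space k A B"
  shows "comult (tensor_hopf k A B) (tpure k A B a b) = tsum k A A (tensor_space k T T) (\<lambda>a1 a2. tsum k B B (tensor_space k T T)
      (\<lambda>b1 b2. tpure k T T (tpure k A B a1 b1) (tpure k A B a2 b2)) (comult B b)) (comult A a)"
proof -
  interpret A: hom_coalgebra k A by fact
  interpret B: hom_coalgebra k B by fact
  show ?thesis using assms(3,4) unfolding T_def by (simp add: tensor_hopf_comult_tsum[OF A B])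
qed

lemma tensor_hopf_counit_pure:
  assumes A: "hom_coalgebra k A" and B: "hom_coalgebra k B" and "a \<in> carrier A" "b \<in> carrier B"
  shows "counit (tensor_hopf k A B) (tpure k A B a b) = counit A a \<otimes>\<^bsub>k\<^esub> counit B b"
proof -
  interpret A: hom_coalgebra k A by fact
  interpret B: hom_coalgebra k B by fact
  show ?thesis using assms(3,4)
    by (simp add: tensor_hopf_counit_tsum[OF A B] lin_ground_mult1 lin_ground_mult2)
qed

lemma hom_coalgebra_tensor_hopf:
  assumes A: "hom_coalgebra k A" and B: "hom_coalgebra k B"
  shows "hom_coalgebra k (tensor_hopf k A B)"
proof -
  interpret A: hom_coalgebra k A by fact
  interpret B: hom_coalgebra k B by fact
  let ?K = "tensor_hopf k A B" and ?T = "tensor_space k A B"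
  let ?TT = "tensor_space k ?T ?T"
  interpret K: hom_vector_space k ?K
    by (rule hom_vector_space_transfer[OF hom_vector_space_tensor_alg[of k A B]])
       (unfold_locales, simp_all add: same_space_def tensor_hopf_def tensor_alg_def Let_def)
  note [simp] = tensor_hopf_simps(1)
  have lin: "linear_map k ?T ?TT (comult ?K)"
    by (rule linear_map_cong[OF _ _ tensor_hopf_comult_tsum[OF A B, symmetric]]) simp_all
  have clin: "linear_map k ?T (ground_space k) (counit ?K)"
    by (rule linear_map_cong[OF _ _ tensor_hopf_counit_tsum[OF A B, symmetric]])
       (simp_all add: lin_ground_mult1 lin_ground_mult2)
  have [simp]: "comult ?K t \<in> carrier ?TT" if "t \<in> carrier ?T" for t
    by (rule linear_map_closed[OF lin that])
  have [simp]: "counit ?K t \<in> carrier k" if "t \<in> carrier ?T" for t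
    using linear_map_closed[OF clin that] by simp
  have [simp]: "linear_map k X ?TT (\<lambda>x. comult ?K (f x))" if "linear_map k X ?T f" for X f
    by (rule linear_map_comp[OF lin that])
  have [simp]: "linear_map k X (ground_space k) (\<lambda>x. counit ?K (f x))" if "linear_map k X ?T f" for X f
    by (rule linear_map_comp[OF clin that])
  note [simp] = tensor_hopf_comult_pure[OF A B] tensor_hopf_counit_pure[OF A B]
  have [simp]: "linear_map k X ?T (\<lambda>x. tmap k A B (twist A) (twist B) (f x))" if "linear_map k X ?T f" for X f
    using K.lin_twist that by simp
  have [simp]: "tmap k A B (twist A) (twist B) t \<in> carrier ?T" if "t \<in> carrier ?T" for t
    using K.twist_closed that by simp
  have tm: "linear_map k ?T (tensor_space k V W) (\<lambda>c. tmap k V W f g (comult ?K c))"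
    if "module k V" "module k W" "linear_map k ?T V f" "linear_map k ?T W g" for V W f g
    by (rule lin_tmap[of k ?T ?T]) (simp_all add: that)
  note [simp] = tm[of ?T ?T, simplified] tm[of ?T ?TT, simplified] tm[of ?TT ?T, simplified]
  note [simp] = linear_map_closed[OF tm[of ?TT ?T, simplified]]
  have sm: "(x \<otimes>\<^bsub>k\<^esub> y) \<odot>\<^bsub>?T\<^esub> t = y \<odot>\<^bsub>?T\<^esub> (x \<odot>\<^bsub>?T\<^esub> t)"
    if "x \<in> carrier k" "y \<in> carrier k" "t \<in> carrier ?T" for x y t
    using that module.smult_assoc1[OF tensor_space_module[OF A.space B.space], of y x t]
    by (simp add: A.k.m_comm)
  have sm_closed [simp]: "x \<odot>\<^bsub>?T\<^esub> t \<in> carrier ?T"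
    if "x \<in> carrier k" "t \<in> carrier ?T" for x t
    using that module.smult_closed[OF tensor_space_module[OF A.space B.space]] by simp
  show ?thesis
  proof (intro hom_coalgebra.intro hom_coalgebra_axioms.intro K.hom_vector_space_axioms)
    show "linear_map k ?K (tensor_space k ?K ?K) (comult ?K)" using lin by simp
    show "linear_map k ?K (ground_space k) (counit ?K)" using clin by simp
    fix c assume c: "c \<in> carrier ?K"
    then have c' [simp]: "c \<in> carrier ?T" by simp
    show "counit ?K (twist ?K c) = counit ?K c"
      by (rule tensor_linear_ext[OF _ _ A.space B.space A.ground, of _ _ c])
         (simp_all add: A.counit_twist B.counit_twist)
    show "tmap k ?K ?K (twist ?K) (twist ?K) (comult ?K c) = comult ?K (twist ?K c)"
      by (simp, rule tensor_linear_ext[where L = "\<lambda>c. tmap k ?T ?T _ _ (comult ?K c)" and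
            L' = "\<lambda>c. comult ?K (tmap k A B _ _ c)", of k A B ?TT])
         (simp_all add: A.tsum_comult_twist B.tsum_comult_twist)
    show "tlift k ?K (\<lambda>c1 c2. counit ?K c1 \<odot>\<^bsub>?K\<^esub> c2) (comult ?K c) = twist ?K c"
    proof -
      have "tlift k ?T (\<lambda>c1 c2. counit ?K c1 \<odot>\<^bsub>?T\<^esub> c2) (comult ?K c) =
          tsum k ?T ?T ?T (\<lambda>c1 c2. counit ?K c1 \<odot>\<^bsub>?T\<^esub> c2) (comult ?K c)"
        by (rule tlift_eq_tsum) simp_all
      also have "\<dots> = tmap k A B (twist A) (twist B) c"
        by (rule tensor_linear_ext[where L = "\<lambda>c. tsum k ?T ?T ?T _ (comult ?K c)", of k A B ?T])
           (simp_all add: sm)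
      finally show ?thesis by simp
    qed
    show "tlift k ?K (\<lambda>c1 c2. counit ?K c2 \<odot>\<^bsub>?K\<^esub> c1) (comult ?K c) = twist ?K c"
    proof -
      have "tlift k ?T (\<lambda>c1 c2. counit ?K c2 \<odot>\<^bsub>?T\<^esub> c1) (comult ?K c) =
          tsum k ?T ?T ?T (\<lambda>c1 c2. counit ?K c2 \<odot>\<^bsub>?T\<^esub> c1) (comult ?K c)"
        by (rule tlift_eq_tsum) simp_all
      also have "\<dots> = tmap k A B (twist A) (twist B) c"
        by (rule tensor_linear_ext[where L = "\<lambda>c. tsum k ?T ?T ?T _ (comult ?K c)", of k A B ?T])
           (simp_all add: sm)
      finally show ?thesis by simp
    qed
    \<comment> \<open>Coassociativity on \<open>a \<otimes> b\<close>: separate the sums over \<open>a\<close> from those over \<open>b\<close>, regroup each, and interleave them again.\<close>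
    let ?TTT = "tensor_space k ?T ?TT"
    let ?p = "\<lambda>a b a' b' a'' b''. tpure k ?T ?TT (tpure k A B a b) (tpure k ?T ?T (tpure k A B a' b') (tpure k A B a'' b''))"
    have "tassoc k ?T ?T ?T (tmap k ?TT ?T (comult ?K) (twist ?K) (comult ?K c)) =
        tmap k ?T ?TT (twist ?K) (comult ?K) (comult ?K c)"
    proof (rule tensor_linear_ext[where L = "\<lambda>c. tassoc k ?T ?T ?T (tmap k ?TT ?T _ _ (comult ?K c))"
          and L' = "\<lambda>c. tmap k ?T ?TT (twist ?K) (comult ?K) (comult ?K c)", of k A B ?TTT], goal_cases)
      case (7 a b)
      have "tassoc k ?T ?T ?T (tmap k ?TT ?T (comult ?K) (twist ?K) (comult ?K (tpure k A B a b))) =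
        tsum k A A ?TTT (\<lambda>x y. tsum k B B ?TTT (\<lambda>u v. tsum k A A ?TTT (\<lambda>x1 x2. tsum k B B ?TTT (\<lambda>u1 u2.
          ?p x1 u1 x2 u2 (twist A y) (twist B v)) (comult B u)) (comult A x)) (comult B b)) (comult A a)"
        using 7 by simp
      also have "\<dots> = tsum k A A ?TTT (\<lambda>x y. tsum k A A ?TTT (\<lambda>x1 x2. tsum k B B ?TTT (\<lambda>u v. tsum k B B ?TTT (\<lambda>u1 u2.
          ?p x1 u1 x2 u2 (twist A y) (twist B v)) (comult B u)) (comult B b)) (comult A x)) (comult A a)"
        by (rule tsum_body_cong, rule tsum_swap) (use 7 in simp_all)
      also have "\<dots> = tsum k A A ?TTT (\<lambda>x y. tsum k A A ?TTT (\<lambda>y1 y2. tsum k B B ?TTT (\<lambda>u v. tsum k B B ?TTT (\<lambda>u1 u2.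
          ?p (twist A x) u1 y1 u2 y2 (twist B v)) (comult B u)) (comult B b)) (comult A y)) (comult A a)"
        by (rule A.tsum_coassoc) (use 7 in simp_all)
      also have "\<dots> = tsum k A A ?TTT (\<lambda>x y. tsum k A A ?TTT (\<lambda>y1 y2. tsum k B B ?TTT (\<lambda>u v. tsum k B B ?TTT (\<lambda>v1 v2.
          ?p (twist A x) (twist B u) y1 v1 y2 v2) (comult B v)) (comult B b)) (comult A y)) (comult A a)"
        by (rule tsum_body_cong, rule tsum_body_cong, rule B.tsum_coassoc) (use 7 in simp_all)
      also have "\<dots> = tsum k A A ?TTT (\<lambda>x y. tsum k B B ?TTT (\<lambda>u v. tsum k A A ?TTT (\<lambda>y1 y2. tsum k B B ?TTT (\<lambda>v1 v2.
          ?p (twist A x) (twist B u) y1 v1 y2 v2) (comult B v)) (comult A y)) (comult B b)) (comult A a)"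
        by (rule tsum_body_cong, rule tsum_swap) (use 7 in simp_all)
      also have "\<dots> = tmap k ?T ?TT (twist ?K) (comult ?K) (comult ?K (tpure k A B a b))"
        using 7 by simp
      finally show ?case .
    qed simp_all
    then show "tassoc k ?K ?K ?K (tmap k (tensor_space k ?K ?K) ?K (comult ?K) (twist ?K) (comult ?K c)) =
        tmap k ?K (tensor_space k ?K ?K) (twist ?K) (comult ?K) (comult ?K c)"
      by simp
  qed
qed

section \<open>Convolution\<close>

context hom_algebra
begin

lemma mult_smult_left [simp]:
  "\<lbrakk>c \<in> carrier k; x \<in> carrier A; y \<in> carrier A\<rbrakk> \<Longrightarrow> (c \<odot>\<^bsub>A\<^esub> x) \<otimes>\<^bsub>A\<^esub> y = c \<odot>\<^bsub>A\<^esub> (x \<otimes>\<^bsub>A\<^esub> y)"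
  by (rule linear_map_smult[of k A A "\<lambda>x. x \<otimes>\<^bsub>A\<^esub> y"]) simp_all

lemma mult_smult_right [simp]:
  "\<lbrakk>c \<in> carrier k; x \<in> carrier A; y \<in> carrier A\<rbrakk> \<Longrightarrow> x \<otimes>\<^bsub>A\<^esub> (c \<odot>\<^bsub>A\<^esub> y) = c \<odot>\<^bsub>A\<^esub> (x \<otimes>\<^bsub>A\<^esub> y)"
  by (rule linear_map_smult[of k A A "\<lambda>y. x \<otimes>\<^bsub>A\<^esub> y"]) simp_all

lemma mult_tsum_left [simp]:
  "\<lbrakk>module k X; module k Y; t \<in> carrier (tensor_space k X Y);
    \<And>x y. \<lbrakk>x \<in> carrier X; y \<in> carrier Y\<rbrakk> \<Longrightarrow> f x y \<in> carrier A; z \<in> carrier A\<rbrakk> \<Longrightarrow>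
   tsum k X Y A f t \<otimes>\<^bsub>A\<^esub> z = tsum k X Y A (\<lambda>x y. f x y \<otimes>\<^bsub>A\<^esub> z) t"
  by (rule linear_map_tsum[of k A A "\<lambda>x. x \<otimes>\<^bsub>A\<^esub> z"]) simp_all

lemma mult_tsum_right [simp]:
  "\<lbrakk>module k X; module k Y; t \<in> carrier (tensor_space k X Y);
    \<And>x y. \<lbrakk>x \<in> carrier X; y \<in> carrier Y\<rbrakk> \<Longrightarrow> f x y \<in> carrier A; z \<in> carrier A\<rbrakk> \<Longrightarrow>
   z \<otimes>\<^bsub>A\<^esub> tsum k X Y A f t = tsum k X Y A (\<lambda>x y. z \<otimes>\<^bsub>A\<^esub> f x y) t"
  by (rule linear_map_tsum[of k A A "\<lambda>x. z \<otimes>\<^bsub>A\<^esub> x"]) simp_all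

end

text \<open>
  A left inverse \<open>f\<close> and a right inverse \<open>h\<close> of \<open>g\<close> for the convolution product agree, as in a
  monoid: evaluate \<open>f * g * h\<close> with both bracketings. Convolution is associative only up to twists.
  These are accounted for by evaluating \<open>f(\<alpha>\<^sup>2 x) (g(\<alpha> y) h(\<alpha> z)) = (f(\<alpha> x) g(\<alpha> y)) h(\<alpha>\<^sup>2 z)\<close>,
  the instance of Hom-associativity in which the arguments of \<open>f, g\<close> on one side, and those of \<open>g, h\<close> on the
  other, carry equal powers of \<open>\<alpha>\<close>. The result is \<open>\<alpha>\<^sup>5(f(c)) = \<alpha>\<^sup>5(h(c))\<close>, and \<open>\<alpha>\<close> is injective.
\<close>

lemma convolution_inverse_unique:
  assumes C: "hom_coalgebra k C" and A: "hom_algebra k A"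
    and lin: "linear_map k C A f" "linear_map k C A g" "linear_map k C A h"
    and tw: "\<And>c. c \<in> carrier C \<Longrightarrow> f (twist C c) = twist A (f c)"
      "\<And>c. c \<in> carrier C \<Longrightarrow> g (twist C c) = twist A (g c)"
      "\<And>c. c \<in> carrier C \<Longrightarrow> h (twist C c) = twist A (h c)"
    and left: "\<And>c. c \<in> carrier C \<Longrightarrow>
      tsum k C C A (\<lambda>x y. f x \<otimes>\<^bsub>A\<^esub> g y) (comult C c) = counit C c \<odot>\<^bsub>A\<^esub> \<one>\<^bsub>A\<^esub>"
    and right: "\<And>c. c \<in> carrier C \<Longrightarrow>
      tsum k C C A (\<lambda>x y. g x \<otimes>\<^bsub>A\<^esub> h y) (comult C c) = counit C c \<odot>\<^bsub>A\<^esub> \<one>\<^bsub>A\<^esub>"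
    and c: "c \<in> carrier C"
  shows "f c = h c"
proof -
  interpret C: hom_coalgebra k C by fact
  interpret A: hom_algebra k A by fact
  have [simp]: "f x \<in> carrier A" "g x \<in> carrier A" "h x \<in> carrier A" if "x \<in> carrier C" for x
    using linear_map_closed[OF lin(1) that] linear_map_closed[OF lin(2) that] linear_map_closed[OF lin(3) that] .
  have [simp]: "linear_map k X A (\<lambda>x. f (p x))" "linear_map k X A (\<lambda>x. g (p x))" "linear_map k X A (\<lambda>x. h (p x))"
    if "linear_map k X C p" for X p
    using linear_map_comp[OF lin(1) that] linear_map_comp[OF lin(2) that] linear_map_comp[OF lin(3) that] .
  note [simp] = c
  let ?a = "twist C"
  let ?F = "\<lambda>x y z. f (?a (?a x)) \<otimes>\<^bsub>A\<^esub> (g (?a y) \<otimes>\<^bsub>A\<^esub> h (?a z))"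
  have F: "?F x y z = (f (?a x) \<otimes>\<^bsub>A\<^esub> g (?a y)) \<otimes>\<^bsub>A\<^esub> h (?a (?a z))"
    if "x \<in> carrier C" "y \<in> carrier C" "z \<in> carrier C" for x y z
    using that A.hom_assoc[of "f (?a x)" "g (?a y)" "h (?a z)"] by (simp add: tw)
  have lt: "tsum k C C A (\<lambda>x y. f (?a x) \<otimes>\<^bsub>A\<^esub> g (?a y)) (comult C x) = counit C x \<odot>\<^bsub>A\<^esub> \<one>\<^bsub>A\<^esub>"
    if "x \<in> carrier C" for x
    using that C.tsum_comult_twist[of x A "\<lambda>x y. f x \<otimes>\<^bsub>A\<^esub> g y"] left[of "?a x"]
    by (simp add: C.counit_twist)
  have rt: "tsum k C C A (\<lambda>x y. g (?a x) \<otimes>\<^bsub>A\<^esub> h (?a y)) (comult C x) = counit C x \<odot>\<^bsub>A\<^esub> \<one>\<^bsub>A\<^esub>"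
    if "x \<in> carrier C" for x
    using that C.tsum_comult_twist[of x A "\<lambda>x y. g x \<otimes>\<^bsub>A\<^esub> h y"] right[of "?a x"]
    by (simp add: C.counit_twist)
  have "tsum k C C A (\<lambda>x y. tsum k C C A (\<lambda>x1 x2. ?F x1 x2 (?a y)) (comult C x)) (comult C c) =
      tsum k C C A (\<lambda>x y. tsum k C C A (\<lambda>x1 x2. f (?a x1) \<otimes>\<^bsub>A\<^esub> g (?a x2)) (comult C x) \<otimes>\<^bsub>A\<^esub> h (?a (?a (?a y)))) (comult C c)"
    by (simp add: F)
  also have "\<dots> = twist A (h (?a (?a (?a (?a c)))))"
    by (simp only: lt cong: tsum_cong) simp
  finally have 1: "tsum k C C A (\<lambda>x y. tsum k C C A (\<lambda>x1 x2. ?F x1 x2 (?a y)) (comult C x)) (comult C c) = \<dots>" .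
  have "tsum k C C A (\<lambda>x y. tsum k C C A (\<lambda>y1 y2. ?F (?a x) y1 y2) (comult C y)) (comult C c) =
      tsum k C C A (\<lambda>x y. f (?a (?a (?a x))) \<otimes>\<^bsub>A\<^esub> tsum k C C A (\<lambda>y1 y2. g (?a y1) \<otimes>\<^bsub>A\<^esub> h (?a y2)) (comult C y)) (comult C c)"
    by simp
  also have "\<dots> = twist A (f (?a (?a (?a (?a c)))))"
    by (simp only: rt cong: tsum_cong) simp
  finally have 2: "tsum k C C A (\<lambda>x y. tsum k C C A (\<lambda>y1 y2. ?F (?a x) y1 y2) (comult C y)) (comult C c) = \<dots>" .
  have "twist A (h (?a (?a (?a (?a c))))) = twist A (f (?a (?a (?a (?a c)))))"
    unfolding 1[symmetric] 2[symmetric] by (rule C.tsum_coassoc) simp_all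
  then show ?thesis
    by (simp add: tw A.twist_eq_iff)
qed

section \<open>Hom-bialgebras and their opposites\<close>

context hom_bialgebra
begin

abbreviation HH where "HH \<equiv> tensor_space k H H"

lemma hom_algebra_HH: "hom_algebra k (tensor_alg k H H)"
  by (rule hom_algebra_tensor_alg) unfold_locales

lemma comult_mult:
  assumes "x \<in> carrier H" "y \<in> carrier H"
  shows "comult H (x \<otimes>\<^bsub>H\<^esub> y) = tsum k H H HH (\<lambda>x1 x2. tsum k H H HH (\<lambda>y1 y2.
    tpure k H H (x1 \<otimes>\<^bsub>H\<^esub> y1) (x2 \<otimes>\<^bsub>H\<^esub> y2)) (comult H y)) (comult H x)"
proof -
  have "comult H (x \<otimes>\<^bsub>H\<^esub> y) = comult H x \<otimes>\<^bsub>tensor_alg k H H\<^esub> comult H y"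
    using comult_morphism assms by (simp add: hom_algebra_morphism_def)
  also have "\<dots> = tsum k H H HH (\<lambda>x1 x2. tsum k H H HH (\<lambda>y1 y2.
    tpure k H H (x1 \<otimes>\<^bsub>H\<^esub> y1) (x2 \<otimes>\<^bsub>H\<^esub> y2)) (comult H y)) (comult H x)"
    by (rule tensor_alg_mult_tsum) (unfold_locales, simp_all add: assms)
  finally show ?thesis .
qed

lemma tsum_comult_mult:
  assumes "x \<in> carrier H" "y \<in> carrier H" "module k U" "bilinear_map k H H U F"
  shows "tsum k H H U F (comult H (x \<otimes>\<^bsub>H\<^esub> y)) = tsum k H H U (\<lambda>x1 x2. tsum k H H U (\<lambda>y1 y2.
    F (x1 \<otimes>\<^bsub>H\<^esub> y1) (x2 \<otimes>\<^bsub>H\<^esub> y2)) (comult H y)) (comult H x)"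
  unfolding comult_mult[OF assms(1,2)] using assms by (simp del: bilinear_map_def)

lemma comult_one [simp]: "comult H \<one>\<^bsub>H\<^esub> = tpure k H H \<one>\<^bsub>H\<^esub> \<one>\<^bsub>H\<^esub>"
  using comult_morphism by (simp add: hom_algebra_morphism_def tensor_alg_simps)

lemma counit_mult [simp]: "\<lbrakk>x \<in> carrier H; y \<in> carrier H\<rbrakk> \<Longrightarrow> counit H (x \<otimes>\<^bsub>H\<^esub> y) = counit H x \<otimes>\<^bsub>k\<^esub> counit H y"
  using counit_morphism by (simp add: hom_algebra_morphism_def)

lemma counit_one [simp]: "counit H \<one>\<^bsub>H\<^esub> = \<one>\<^bsub>k\<^esub>"
  using counit_morphism by (simp add: hom_algebra_morphism_def)

declare counit_twist [simp]

end

lemma op_hopf_simps [simp]: "twist (op_hopf H) = twist H" "\<one>\<^bsub>op_hopf H\<^esub> = \<one>\<^bsub>H\<^esub>"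
  "mult (op_hopf H) = (\<lambda>x y. y \<otimes>\<^bsub>H\<^esub> x)" "comult (op_hopf H) = comult H" "counit (op_hopf H) = counit H"
  "antipode (op_hopf H) = antipode_inv H"
  by (simp_all add: op_hopf_def)

lemma hom_algebra_op:
  assumes "hom_algebra k H" shows "hom_algebra k (op_hopf H)"
proof -
  interpret H: hom_algebra k H by fact
  interpret V: hom_vector_space k "op_hopf H"
    by (rule hom_vector_space_transfer[OF H.hom_vector_space_axioms]) (simp_all add: same_space_op_hopf)
  show ?thesis
  proof unfold_locales
    fix a b c assume "a \<in> carrier (op_hopf H)" "b \<in> carrier (op_hopf H)" "c \<in> carrier (op_hopf H)"
    then show "twist (op_hopf H) a \<otimes>\<^bsub>op_hopf H\<^esub> (b \<otimes>\<^bsub>op_hopf H\<^esub> c) =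
        (a \<otimes>\<^bsub>op_hopf H\<^esub> b) \<otimes>\<^bsub>op_hopf H\<^esub> twist (op_hopf H) c"
      using H.hom_assoc[of c b a] by simp
  qed (simp_all add: H.twist_mult)
qed

lemma hom_coalgebra_op:
  assumes "hom_coalgebra k H" shows "hom_coalgebra k (op_hopf H)"
proof -
  interpret H: hom_coalgebra k H by fact
  interpret V: hom_vector_space k "op_hopf H"
    by (rule hom_vector_space_transfer[OF H.hom_vector_space_axioms]) (simp_all add: same_space_op_hopf)
  show ?thesis
    using H.comult_linear H.counit_linear H.counit_twist H.comult_twist H.counit_left H.counit_right H.hom_coassoc
    by unfold_locales (simp_all del: H.tmap_comult)
qed

lemma hom_bialgebra_op:
  assumes "hom_bialgebra k H" shows "hom_bialgebra k (op_hopf H)"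
proof -
  interpret H: hom_bialgebra k H by fact
  interpret A: hom_algebra k "op_hopf H" by (rule hom_algebra_op) unfold_locales
  interpret C: hom_coalgebra k "op_hopf H" by (rule hom_coalgebra_op) unfold_locales
  have "comult H (y \<otimes>\<^bsub>H\<^esub> x) = comult H x \<otimes>\<^bsub>tensor_alg k (op_hopf H) (op_hopf H)\<^esub> comult H y"
    if "x \<in> carrier H" "y \<in> carrier H" for x y
    using that
    by (subst tensor_alg_mult_tsum[OF A.hom_algebra_axioms A.hom_algebra_axioms])
       (simp_all add: H.comult_mult, rule tsum_swap, simp_all)
  moreover have "comult H (twist H x) = tmap k H H (twist H) (twist H) (comult H x)" if "x \<in> carrier H" for x
    using H.comult_twist[OF that] by simp
  ultimately have "hom_algebra_morphism k (op_hopf H) (tensor_alg k (op_hopf H) (op_hopf H)) (comult H)"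
    using H.comult_linear by (simp add: hom_algebra_morphism_def tensor_alg_simps del: H.tmap_comult)
  moreover have "hom_algebra_morphism k (op_hopf H) (ground_space k) (counit H)"
    using H.counit_linear by (simp add: hom_algebra_morphism_def H.k.m_comm)
  ultimately show ?thesis
    by unfold_locales simp_all
qed

section \<open>Strictly coassociative sums\<close>

context hom_coalgebra
begin

text \<open>
  The sum over the coproduct \<open>\<Delta> \<circ> \<alpha>\<^sup>-\<^sup>1\<close> of the ordinary coalgebra underlying \<open>C\<close>. It is an abbreviation,
  so that the rewriting rules for \<^const>\<open>tsum\<close> apply to it.
\<close>

abbreviation sw where "sw U F c \<equiv> tsum k C C U F (comult C (twist_inv C c))"

lemma counit_twist_inv [simp]: "c \<in> carrier C \<Longrightarrow> counit C (twist_inv C c) = counit C c"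
  using counit_twist[of "twist_inv C c"] by simp

lemma tsum_sw:
  assumes "c \<in> carrier C" "module k U" "bilinear_map k C C U F"
  shows "tsum k C C U F (comult C c) = sw U (\<lambda>x y. F (twist C x) (twist C y)) c"
  using tsum_comult_twist[of "twist_inv C c" U F] assms by (simp del: bilinear_map_def)

lemma sw_tsum:
  assumes "c \<in> carrier C" "module k U" "bilinear_map k C C U F"
  shows "sw U F c = tsum k C C U (\<lambda>x y. F (twist_inv C x) (twist_inv C y)) (comult C c)"
proof -
  have "bilinear_map k C C U (\<lambda>x y. F (twist_inv C x) (twist_inv C y))"
    by (rule bilinear_map_comp[OF assms(3) twist_inv_linear twist_inv_linear])
  then show ?thesis
    using assms(1,2) tsum_sw[of c U "\<lambda>x y. F (twist_inv C x) (twist_inv C y)"] by (simp del: bilinear_map_def)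
qed

text \<open>
  No twist appears: the factor \<open>\<alpha>\<close> that Hom-coassociativity puts on the outer leg is absorbed by the
  \<open>\<alpha>\<^sup>-\<^sup>1\<close> in front of the inner coproduct.
\<close>

lemma sw_coassoc:
  assumes c: "c \<in> carrier C" and U: "module k U" and F: "trilinear_map k C C C U F"
  shows "sw U (\<lambda>x y. sw U (\<lambda>x1 x2. F x1 x2 y) x) c = sw U (\<lambda>x y. sw U (\<lambda>y1 y2. F x y1 y2) y) c"
proof -
  note [simp] = c U trilinear_mapD[OF F]
  note [simp] = trilinear_map_comp[OF F]
  let ?i = "twist_inv C"
  have "sw U (\<lambda>x y. sw U (\<lambda>x1 x2. F x1 x2 y) x) c =
      sw U (\<lambda>x y. tsum k C C U (\<lambda>x1 x2. F (?i x1) (?i x2) (?i (twist C y))) (comult C x)) c"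
    by (rule tsum_body_cong, subst sw_tsum, simp_all)
  also have "\<dots> = sw U (\<lambda>x y. tsum k C C U (\<lambda>y1 y2. F (?i (twist C x)) (?i y1) (?i y2)) (comult C y)) c"
    by (rule tsum_coassoc) simp_all
  also have "\<dots> = sw U (\<lambda>x y. sw U (\<lambda>y1 y2. F x y1 y2) y) c"
    by (rule tsum_body_cong, simp, rule sw_tsum[symmetric], simp_all)
  finally show ?thesis .
qed

end

context hom_algebra
begin

text \<open>
  Brings the two inner factors together, where an antipode can cancel them.
\<close>

lemma mult_reassoc_four:
  assumes "x \<in> carrier A" "y \<in> carrier A" "z \<in> carrier A" "w \<in> carrier A"
  shows "(x \<otimes>\<^bsub>A\<^esub> y) \<otimes>\<^bsub>A\<^esub> (z \<otimes>\<^bsub>A\<^esub> w) = twist A x \<otimes>\<^bsub>A\<^esub> (twist_inv A (y \<otimes>\<^bsub>A\<^esub> z) \<otimes>\<^bsub>A\<^esub> w)"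
  using hom_assoc[of x y "twist_inv A z \<otimes>\<^bsub>A\<^esub> twist_inv A w"]
    hom_assoc[of "twist_inv A y" "twist_inv A z" "twist_inv A w"] assms
  by (simp add: twist_mult twist_inv_mult)

lemma twist_inv_one [simp]: "twist_inv A \<one>\<^bsub>A\<^esub> = \<one>\<^bsub>A\<^esub>"
  using twist_inv_twist[OF one_closed] by simp

end

section \<open>The antipode\<close>

context hom_hopf_algebra
begin

lemma antipode_closed [simp]: "x \<in> carrier H \<Longrightarrow> antipode H x \<in> carrier H"
  by (rule linear_map_closed[OF antipode_linear])

lemma lin_antipode [simp]: "linear_map k X H f \<Longrightarrow> linear_map k X H (\<lambda>x. antipode H (f x))"
  by (rule linear_map_comp[OF antipode_linear])

declare antipode_twist [simp]

lemma tsum_antipode_left [simp]: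
  assumes "h \<in> carrier H"
  shows "tsum k H H H (\<lambda>x y. antipode H x \<otimes>\<^bsub>H\<^esub> y) (comult H h) = counit H h \<odot>\<^bsub>H\<^esub> \<one>\<^bsub>H\<^esub>"
  using antipode_left[OF assms] tlift_eq_tsum[of k H H H "comult H h" "\<lambda>x y. antipode H x \<otimes>\<^bsub>H\<^esub> y"] assms
  by simp

lemma tsum_antipode_right [simp]:
  assumes "h \<in> carrier H"
  shows "tsum k H H H (\<lambda>x y. x \<otimes>\<^bsub>H\<^esub> antipode H y) (comult H h) = counit H h \<odot>\<^bsub>H\<^esub> \<one>\<^bsub>H\<^esub>"
  using antipode_right[OF assms] tlift_eq_tsum[of k H H H "comult H h" "\<lambda>x y. x \<otimes>\<^bsub>H\<^esub> antipode H y"] assms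
  by simp

lemma tsum_antipode_right_twist [simp]:
  assumes "h \<in> carrier H"
  shows "tsum k H H H (\<lambda>x y. twist H x \<otimes>\<^bsub>H\<^esub> twist H (antipode H y)) (comult H h) = counit H h \<odot>\<^bsub>H\<^esub> \<one>\<^bsub>H\<^esub>"
  using tsum_comult_twist[of h H "\<lambda>x y. x \<otimes>\<^bsub>H\<^esub> antipode H y"] assms by simp

lemma antipode_one [simp]: "antipode H \<one>\<^bsub>H\<^esub> = \<one>\<^bsub>H\<^esub>"
proof -
  have "twist H (antipode H \<one>\<^bsub>H\<^esub>) = twist H \<one>\<^bsub>H\<^esub>"
    using tsum_antipode_left[of "\<one>\<^bsub>H\<^esub>"] by simp
  then show ?thesis by (simp only: twist_eq_iff antipode_closed one_closed)
qed

text \<open>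
  Apply the counit to \<open>S(h\<^sub>1) h\<^sub>2 = \<epsilon>(h) 1\<close> and contract \<open>\<epsilon>(h\<^sub>2)\<close> with the coproduct.
\<close>

lemma counit_antipode [simp]:
  assumes h: "h \<in> carrier H" shows "counit H (antipode H h) = counit H h"
proof -
  note L = counit_linear
  have "tsum k H H (ground_space k) (\<lambda>x y. counit H (antipode H x) \<otimes>\<^bsub>k\<^esub> counit H y) (comult H (twist_inv H h)) = counit H h"
    using linear_map_tsum[OF L, of H H "comult H (twist_inv H h)" "\<lambda>x y. antipode H x \<otimes>\<^bsub>H\<^esub> y"] h
    by (simp add: linear_map_smult[OF L])
  moreover have "tsum k H H (ground_space k) (\<lambda>x y. counit H y \<odot>\<^bsub>ground_space k\<^esub> counit H (antipode H x)) (comult H (twist_inv H h)) =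
      counit H (antipode H h)"
    by (subst tsum_counit2) (simp_all add: h del: ground_space_simps(3))
  ultimately show ?thesis
    by (simp add: k.m_comm cong: tsum_cong)
qed

text \<open>
  On the coalgebra \<open>H \<otimes> H\<close>, the map \<open>x \<otimes> y \<mapsto> S(x y)\<close> is a left convolution inverse of the
  multiplication because \<open>\<Delta>\<close> is multiplicative, and \<open>x \<otimes> y \<mapsto> S(y) S(x)\<close> is a right inverse
  because \<open>(x\<^sub>1 y\<^sub>1) (S(y\<^sub>2) S(x\<^sub>2))\<close> cancels from the inside.
\<close>

lemma antipode_mult:
  assumes x: "x \<in> carrier H" and y: "y \<in> carrier H"
  shows "antipode H (x \<otimes>\<^bsub>H\<^esub> y) = antipode H y \<otimes>\<^bsub>H\<^esub> antipode H x"
proof -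
  let ?S = "antipode H" and ?K = "tensor_hopf k H H"
  interpret K: hom_coalgebra k ?K by (rule hom_coalgebra_tensor_hopf) unfold_locales
  have [simp]: "linear_map k HH X (\<lambda>t. tsum k HH HH X F (comult ?K t))"
    if "module k X" "bilinear_map k HH HH X F" for X F
    using lin_tsum_arg[OF _ _ that(1) K.comult_linear[unfolded space_simps] that(2)] by simp
  have [simp]: "comult ?K t \<in> carrier (tensor_space k HH HH)" if "t \<in> carrier HH" for t
    using K.comult_closed that by simp
  have [simp]: "linear_map k HH H (\<lambda>t. counit ?K t \<odot>\<^bsub>H\<^esub> \<one>\<^bsub>H\<^esub>)"
    using lin_smult1[OF _ _ K.counit_linear[unfolded space_simps]] by simp
  note [simp] = tensor_hopf_comult_pure[OF hom_coalgebra_axioms hom_coalgebra_axioms]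
    tensor_hopf_counit_pure[OF hom_coalgebra_axioms hom_coalgebra_axioms]
  let ?f = "tsum k H H H (\<lambda>x y. ?S (x \<otimes>\<^bsub>H\<^esub> y))" and ?g = "tsum k H H H (\<lambda>x y. x \<otimes>\<^bsub>H\<^esub> y)"
    and ?h = "tsum k H H H (\<lambda>x y. ?S y \<otimes>\<^bsub>H\<^esub> ?S x)"
  have tw: "tsum k H H H F (twist ?K t) = twist H (tsum k H H H F t)"
    if F: "bilinear_map k H H H F" "\<And>x y. \<lbrakk>x \<in> carrier H; y \<in> carrier H\<rbrakk> \<Longrightarrow> F (twist H x) (twist H y) = twist H (F x y)"
      and t: "t \<in> carrier HH" for F t
  proof (rule tensor_linear_ext[where L = "\<lambda>t. tsum k H H H F (twist ?K t)" and L' = "\<lambda>t. twist H (tsum k H H H F t)"])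
    show "linear_map k HH H (\<lambda>t. tsum k H H H F (twist ?K t))"
      using lin_tsum_arg[OF _ _ _ K.twist_linear[unfolded space_simps] F(1)] by simp
  qed (use F t bilinear_map_closed[OF F(1)] in \<open>simp_all add: tensor_hopf_simps(1)\<close>)
  have "?f (tpure k H H x y) = ?h (tpure k H H x y)"
  proof (rule convolution_inverse_unique[of k ?K H ?f ?g ?h])
    show "hom_coalgebra k ?K" "hom_algebra k H" by unfold_locales
    fix t assume t: "t \<in> carrier ?K"
    then have t' [simp]: "t \<in> carrier HH" by simp
    show "?f (twist ?K t) = twist H (?f t)"
      by (rule tw) (simp_all flip: twist_mult)
    show "?g (twist ?K t) = twist H (?g t)"
      by (rule tw) (simp_all add: twist_mult)
    show "?h (twist ?K t) = twist H (?h t)"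
      by (rule tw) (simp_all add: twist_mult)
    have "tsum k HH HH H (\<lambda>s t. ?f s \<otimes>\<^bsub>H\<^esub> ?g t) (comult ?K t) = counit ?K t \<odot>\<^bsub>H\<^esub> \<one>\<^bsub>H\<^esub>"
    proof (rule tensor_linear_ext[of k H H H "\<lambda>t. tsum k HH HH H (\<lambda>s t. ?f s \<otimes>\<^bsub>H\<^esub> ?g t) (comult ?K t)"
          "\<lambda>t. counit ?K t \<odot>\<^bsub>H\<^esub> \<one>\<^bsub>H\<^esub>" t], goal_cases)
      case (7 a b)
      have "tsum k HH HH H (\<lambda>s t. ?f s \<otimes>\<^bsub>H\<^esub> ?g t) (comult ?K (tpure k H H a b)) =
          tsum k H H H (\<lambda>x y. ?S x \<otimes>\<^bsub>H\<^esub> y) (comult H (a \<otimes>\<^bsub>H\<^esub> b))"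
        using 7 by (subst tsum_comult_mult) simp_all
      then show ?case using 7 by simp
    qed simp_all
    then show "tsum k ?K ?K H (\<lambda>s t. ?f s \<otimes>\<^bsub>H\<^esub> ?g t) (comult ?K t) = counit ?K t \<odot>\<^bsub>H\<^esub> \<one>\<^bsub>H\<^esub>"
      by (simp only: space_simps)
    have "tsum k HH HH H (\<lambda>s t. ?g s \<otimes>\<^bsub>H\<^esub> ?h t) (comult ?K t) = counit ?K t \<odot>\<^bsub>H\<^esub> \<one>\<^bsub>H\<^esub>"
    proof (rule tensor_linear_ext[of k H H H "\<lambda>t. tsum k HH HH H (\<lambda>s t. ?g s \<otimes>\<^bsub>H\<^esub> ?h t) (comult ?K t)"
          "\<lambda>t. counit ?K t \<odot>\<^bsub>H\<^esub> \<one>\<^bsub>H\<^esub>" t], goal_cases)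
      case (7 a b)
      have "tsum k HH HH H (\<lambda>s t. ?g s \<otimes>\<^bsub>H\<^esub> ?h t) (comult ?K (tpure k H H a b)) =
          tsum k H H H (\<lambda>a1 a2. tsum k H H H (\<lambda>b1 b2. (a1 \<otimes>\<^bsub>H\<^esub> b1) \<otimes>\<^bsub>H\<^esub> (?S b2 \<otimes>\<^bsub>H\<^esub> ?S a2)) (comult H b)) (comult H a)"
        using 7 by simp
      also have "\<dots> = tsum k H H H (\<lambda>a1 a2. twist H a1 \<otimes>\<^bsub>H\<^esub>
          (twist_inv H (tsum k H H H (\<lambda>b1 b2. b1 \<otimes>\<^bsub>H\<^esub> ?S b2) (comult H b)) \<otimes>\<^bsub>H\<^esub> ?S a2)) (comult H a)"
        using 7 by (simp add: mult_reassoc_four linear_map_tsum[OF twist_inv_linear] del: tsum_antipode_right)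
      also have "\<dots> = tsum k H H H (\<lambda>a1 a2. counit H b \<odot>\<^bsub>H\<^esub> (twist H a1 \<otimes>\<^bsub>H\<^esub> twist H (?S a2))) (comult H a)"
        using 7 by (simp add: linear_map_smult[OF twist_inv_linear])
      also have "\<dots> = counit H b \<odot>\<^bsub>H\<^esub> tsum k H H H (\<lambda>a1 a2. twist H a1 \<otimes>\<^bsub>H\<^esub> twist H (?S a2)) (comult H a)"
        by (rule linear_map_tsum[symmetric]) (use 7 in simp_all)
      finally show ?case
        using 7 by (simp add: V.smult_assoc1[symmetric] k.m_comm)
    qed simp_all
    then show "tsum k ?K ?K H (\<lambda>s t. ?g s \<otimes>\<^bsub>H\<^esub> ?h t) (comult ?K t) = counit ?K t \<odot>\<^bsub>H\<^esub> \<one>\<^bsub>H\<^esub>"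
      by (simp only: space_simps)
  qed (use x y in simp_all)
  then show ?thesis using x y by simp
qed

text \<open>
  Into the algebra \<open>H \<otimes> H\<close>, the map \<open>\<Delta> \<circ> S\<close> is a left convolution inverse of \<open>\<Delta>\<close> because \<open>\<Delta>\<close> is
  multiplicative, and \<open>h \<mapsto> S(h\<^sub>2) \<otimes> S(h\<^sub>1)\<close> is a right inverse: its product with \<open>\<Delta>\<close> is
  \<open>h\<^sub>1 S(h\<^sub>4) \<otimes> h\<^sub>2 S(h\<^sub>3)\<close> in strict numbering, where the second leg cancels first and then the first.
\<close>

lemma comult_antipode:
  assumes h: "h \<in> carrier H"
  shows "comult H (antipode H h) = tsum k H H HH (\<lambda>x y. tpure k H H (antipode H y) (antipode H x)) (comult H h)"
proof -
  let ?S = "antipode H" and ?T = "tensor_alg k H H"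
  interpret T: hom_algebra k ?T by (rule hom_algebra_HH)
  note [simp] = T.algebra_rules[unfolded space_simps]
    T.mult_tsum_left[unfolded space_simps] T.mult_tsum_right[unfolded space_simps]
  have one [simp]: "\<one>\<^bsub>?T\<^esub> = tpure k H H \<one>\<^bsub>H\<^esub> \<one>\<^bsub>H\<^esub>" by (simp add: tensor_alg_simps)
  have [simp]: "tpure k H H a b \<otimes>\<^bsub>?T\<^esub> tpure k H H a' b' = tpure k H H (a \<otimes>\<^bsub>H\<^esub> a') (b \<otimes>\<^bsub>H\<^esub> b')"
    if "a \<in> carrier H" "b \<in> carrier H" "a' \<in> carrier H" "b' \<in> carrier H" for a b a' b'
    using that by (rule tensor_alg_mult_pure[OF hom_algebra_axioms hom_algebra_axioms])
  have mor: "comult H (x \<otimes>\<^bsub>H\<^esub> y) = comult H x \<otimes>\<^bsub>?T\<^esub> comult H y" if "x \<in> carrier H" "y \<in> carrier H" for x y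
    using comult_morphism that by (simp add: hom_algebra_morphism_def)
  let ?h = "\<lambda>c. tsum k H H HH (\<lambda>x y. tpure k H H (?S y) (?S x)) (comult H c)"
  have "comult H (?S h) = ?h h"
  proof (rule convolution_inverse_unique[of k H ?T "\<lambda>c. comult H (?S c)" "comult H" ?h])
    show "hom_coalgebra k H" "hom_algebra k ?T" by unfold_locales
    fix c assume c [simp]: "c \<in> carrier H"
    show "comult H (?S (twist H c)) = twist ?T (comult H (?S c))" "comult H (twist H c) = twist ?T (comult H c)"
      using comult_twist[of "?S c"] comult_twist[of c] by (simp_all add: tensor_alg_simps)
    show "?h (twist H c) = twist ?T (?h c)"
      by (simp add: tensor_alg_simps tsum_comult_twist)
    have "tsum k H H HH (\<lambda>x y. comult H (?S x) \<otimes>\<^bsub>?T\<^esub> comult H y) (comult H c) =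
        comult H (tsum k H H H (\<lambda>x y. ?S x \<otimes>\<^bsub>H\<^esub> y) (comult H c))"
      by (subst linear_map_tsum[OF comult_linear]) (simp_all add: mor)
    also have "\<dots> = counit H c \<odot>\<^bsub>HH\<^esub> tpure k H H \<one>\<^bsub>H\<^esub> \<one>\<^bsub>H\<^esub>"
      by (simp add: linear_map_smult[OF comult_linear])
    finally show "tsum k H H ?T (\<lambda>x y. comult H (?S x) \<otimes>\<^bsub>?T\<^esub> comult H y) (comult H c) = counit H c \<odot>\<^bsub>?T\<^esub> \<one>\<^bsub>?T\<^esub>"
      by simp
    let ?a = "twist H"
    let ?G = "\<lambda>p q r s. tpure k H H (?a p \<otimes>\<^bsub>H\<^esub> ?a (?S s)) (?a q \<otimes>\<^bsub>H\<^esub> ?a (?S r))"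
    have "tsum k H H HH (\<lambda>x y. comult H x \<otimes>\<^bsub>?T\<^esub> ?h y) (comult H c) =
       tsum k H H HH (\<lambda>x y. tsum k H H HH (\<lambda>p q. tpure k H H p q) (comult H x) \<otimes>\<^bsub>?T\<^esub> ?h y) (comult H c)"
      by (simp add: tsum_tpure)
    also have "\<dots> = tsum k H H HH (\<lambda>x y. tsum k H H HH (\<lambda>p q. tsum k H H HH (\<lambda>r s.
        tpure k H H (p \<otimes>\<^bsub>H\<^esub> ?S s) (q \<otimes>\<^bsub>H\<^esub> ?S r)) (comult H y)) (comult H x)) (comult H c)"
      by (simp del: T.mult_tsum_right[unfolded space_simps], simp)
    also have "\<dots> = tsum k H H HH (\<lambda>x y. sw HH (\<lambda>p q. sw HH (\<lambda>r s. ?G p q r s) y) x) (comult H c)"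
      by (rule tsum_body_cong, subst tsum_sw, simp_all, rule tsum_body_cong,
          subst tsum_sw) simp_all
    also have "\<dots> = sw HH (\<lambda>x y. sw HH (\<lambda>p q. sw HH (\<lambda>r s. ?G p q r s) y) x) (?a c)"
      by simp
    also have "\<dots> = sw HH (\<lambda>x y. sw HH (\<lambda>q z. sw HH (\<lambda>r s. ?G x q r s) z) y) (?a c)"
      by (rule sw_coassoc) simp_all
    also have "\<dots> = sw HH (\<lambda>x y. sw HH (\<lambda>z s. sw HH (\<lambda>q r. ?G x q r s) z) y) (?a c)"
      by (rule tsum_body_cong, rule sw_coassoc[symmetric]) simp_all
    also have "\<dots> = sw HH (\<lambda>x y. sw HH (\<lambda>z s. tpure k H H (?a x \<otimes>\<^bsub>H\<^esub> ?a (?S s))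
        (sw H (\<lambda>q r. ?a q \<otimes>\<^bsub>H\<^esub> ?a (?S r)) z)) y) (?a c)"
      by (simp del: tsum_antipode_right_twist)
    also have "\<dots> = sw HH (\<lambda>x y. sw HH (\<lambda>z s. counit H z \<odot>\<^bsub>HH\<^esub> tpure k H H (?a x \<otimes>\<^bsub>H\<^esub> ?a (?S s)) \<one>\<^bsub>H\<^esub>) y) (?a c)"
      by (simp add: linear_map_smult[OF bilinear_map_right[OF tpure_bilinear]])
    also have "\<dots> = sw HH (\<lambda>x y. tpure k H H (?a x \<otimes>\<^bsub>H\<^esub> ?a (?S y)) \<one>\<^bsub>H\<^esub>) (?a c)"
      by simp
    also have "\<dots> = tpure k H H (sw H (\<lambda>x y. ?a x \<otimes>\<^bsub>H\<^esub> ?a (?S y)) (?a c)) \<one>\<^bsub>H\<^esub>"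
      by (simp del: tsum_antipode_right_twist)
    also have "\<dots> = counit H c \<odot>\<^bsub>HH\<^esub> tpure k H H \<one>\<^bsub>H\<^esub> \<one>\<^bsub>H\<^esub>"
      by (simp add: linear_map_smult[OF bilinear_map_left[OF tpure_bilinear]])
    finally show "tsum k H H ?T (\<lambda>x y. comult H x \<otimes>\<^bsub>?T\<^esub> ?h y) (comult H c) = counit H c \<odot>\<^bsub>?T\<^esub> \<one>\<^bsub>?T\<^esub>"
      by simp
  qed (use h in simp_all)
  then show ?thesis .
qed

end

section \<open>The opposite Hom-Hopf algebra\<close>

locale regular_hom_hopf_algebra = hom_hopf_algebra k H for k (structure) and H (structure) +
  assumes antipode_bij: "bij_betw (antipode H) (carrier H) (carrier H)"
begin

lemma antipode_inv_closed [simp]: "x \<in> carrier H \<Longrightarrow> antipode_inv H x \<in> carrier H"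
  unfolding antipode_inv_def using antipode_bij by (metis bij_betw_def inv_into_into)

lemma antipode_antipode_inv [simp]: "x \<in> carrier H \<Longrightarrow> antipode H (antipode_inv H x) = x"
  unfolding antipode_inv_def using antipode_bij by (metis bij_betw_def f_inv_into_f)

lemma antipode_inv_antipode [simp]: "x \<in> carrier H \<Longrightarrow> antipode_inv H (antipode H x) = x"
  unfolding antipode_inv_def using antipode_bij by (metis bij_betw_def inv_into_f_f)

lemma antipode_eq_iff: "\<lbrakk>x \<in> carrier H; y \<in> carrier H\<rbrakk> \<Longrightarrow> antipode H x = antipode H y \<longleftrightarrow> x = y"
  by (metis antipode_inv_antipode)

lemma antipode_inv_linear: "linear_map k H H (antipode_inv H)"
  by (rule linear_mapI)
     (simp_all add: linear_mapD[OF antipode_linear] flip: antipode_eq_iff)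

lemma lin_antipode_inv [simp]: "linear_map k X H f \<Longrightarrow> linear_map k X H (\<lambda>x. antipode_inv H (f x))"
  by (rule linear_map_comp[OF antipode_inv_linear])

lemma antipode_inv_twist [simp]: "x \<in> carrier H \<Longrightarrow> antipode_inv H (twist H x) = twist H (antipode_inv H x)"
  by (simp flip: antipode_eq_iff)

lemma antipode_inv_one [simp]: "antipode_inv H \<one>\<^bsub>H\<^esub> = \<one>\<^bsub>H\<^esub>"
  by (simp flip: antipode_eq_iff)

lemma counit_antipode_inv [simp]: "x \<in> carrier H \<Longrightarrow> counit H (antipode_inv H x) = counit H x"
  using counit_antipode[of "antipode_inv H x"] by simp

lemma antipode_inv_mult: "\<lbrakk>x \<in> carrier H; y \<in> carrier H\<rbrakk> \<Longrightarrow>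
    antipode_inv H (x \<otimes>\<^bsub>H\<^esub> y) = antipode_inv H y \<otimes>\<^bsub>H\<^esub> antipode_inv H x"
  by (simp add: antipode_mult flip: antipode_eq_iff)

lemma tsum_comult_antipode:
  assumes "x \<in> carrier H" "module k U" "bilinear_map k H H U F"
  shows "tsum k H H U F (comult H (antipode H x)) =
    tsum k H H U (\<lambda>a b. F (antipode H b) (antipode H a)) (comult H x)"
  using assms by (simp add: comult_antipode)

text \<open>
  Write \<open>h = S(u)\<close>; the coproduct of \<open>h\<close> is \<open>S(u\<^sub>2) \<otimes> S(u\<^sub>1)\<close>, and applying \<open>S\<^sup>-\<^sup>1\<close> to both legs after
  exchanging them recovers the coproduct of \<open>u\<close>. The two cancellation rules that follow are obtained in the
  same way.
\<close>

lemma comult_antipode_inv: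
  assumes h: "h \<in> carrier H"
  shows "comult H (antipode_inv H h) = tsum k H H HH (\<lambda>x y. tpure k H H (antipode_inv H y) (antipode_inv H x)) (comult H h)"
  using tsum_comult_antipode[of "antipode_inv H h" HH "\<lambda>x y. tpure k H H (antipode_inv H y) (antipode_inv H x)"] h
  by (simp add: tsum_tpure)

lemma tsum_antipode_inv_left [simp]:
  assumes "h \<in> carrier H"
  shows "tsum k H H H (\<lambda>x y. y \<otimes>\<^bsub>H\<^esub> antipode_inv H x) (comult H h) = counit H h \<odot>\<^bsub>H\<^esub> \<one>\<^bsub>H\<^esub>"
  using tsum_comult_antipode[of "antipode_inv H h" H "\<lambda>x y. y \<otimes>\<^bsub>H\<^esub> antipode_inv H x"] assms
  by simp

lemma tsum_antipode_inv_right [simp]: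
  assumes "h \<in> carrier H"
  shows "tsum k H H H (\<lambda>x y. antipode_inv H y \<otimes>\<^bsub>H\<^esub> x) (comult H h) = counit H h \<odot>\<^bsub>H\<^esub> \<one>\<^bsub>H\<^esub>"
  using tsum_comult_antipode[of "antipode_inv H h" H "\<lambda>x y. antipode_inv H y \<otimes>\<^bsub>H\<^esub> x"] assms
  by simp

lemma hom_hopf_algebra_op: "hom_hopf_algebra k (op_hopf H)"
proof -
  interpret O: hom_bialgebra k "op_hopf H" by (rule hom_bialgebra_op) unfold_locales
  show ?thesis
  proof unfold_locales
    show "linear_map k (op_hopf H) (op_hopf H) (antipode (op_hopf H))"
      using antipode_inv_linear by simp
    fix h assume "h \<in> carrier (op_hopf H)"
    then have h [simp]: "h \<in> carrier H" by simp
    show "antipode (op_hopf H) (twist (op_hopf H) h) = twist (op_hopf H) (antipode (op_hopf H) h)"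
      by simp
    have "tlift k H (\<lambda>x y. y \<otimes>\<^bsub>H\<^esub> antipode_inv H x) (comult H h) = tsum k H H H (\<lambda>x y. y \<otimes>\<^bsub>H\<^esub> antipode_inv H x) (comult H h)"
      "tlift k H (\<lambda>x y. antipode_inv H y \<otimes>\<^bsub>H\<^esub> x) (comult H h) = tsum k H H H (\<lambda>x y. antipode_inv H y \<otimes>\<^bsub>H\<^esub> x) (comult H h)"
      by (rule tlift_eq_tsum; simp)+
    then show "tlift k (op_hopf H) (\<lambda>h1 h2. antipode (op_hopf H) h1 \<otimes>\<^bsub>op_hopf H\<^esub> h2) (comult (op_hopf H) h) =
         counit (op_hopf H) h \<odot>\<^bsub>op_hopf H\<^esub> \<one>\<^bsub>op_hopf H\<^esub>"
      "tlift k (op_hopf H) (\<lambda>h1 h2. h1 \<otimes>\<^bsub>op_hopf H\<^esub> antipode (op_hopf H) h2) (comult (op_hopf H) h) =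
         counit (op_hopf H) h \<odot>\<^bsub>op_hopf H\<^esub> \<one>\<^bsub>op_hopf H\<^esub>"
      by simp_all
  qed
qed

end

section \<open>Tensor products of Hom-Hopf algebras\<close>

lemma hom_algebra_tensor_hopf:
  assumes "hom_algebra k A" "hom_algebra k B"
  shows "hom_algebra k (tensor_hopf k A B)"
  by (rule hom_algebra_transfer[OF hom_algebra_tensor_alg[OF assms]])
     (simp_all add: same_space_def tensor_hopf_simps tensor_alg_simps)

lemma hom_bialgebra_tensor_hopf:
  assumes A: "hom_bialgebra k A" and B: "hom_bialgebra k B"
  shows "hom_bialgebra k (tensor_hopf k A B)"
proof -
  interpret A: hom_bialgebra k A by fact
  interpret B: hom_bialgebra k B by fact
  let ?K = "tensor_hopf k A B" and ?T = "tensor_space k A B"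
  let ?TT = "tensor_space k ?T ?T"
  interpret K: hom_algebra k ?K by (rule hom_algebra_tensor_hopf) unfold_locales
  interpret K: hom_coalgebra k ?K by (rule hom_coalgebra_tensor_hopf) unfold_locales
  interpret KK: hom_algebra k "tensor_alg k ?K ?K" by (rule hom_algebra_tensor_alg) unfold_locales
  let ?KK = "tensor_alg k ?K ?K"
  note [simp] = K.algebra_rules[unfolded space_simps]
    K.coalgebra_rules[unfolded space_simps]
    KK.algebra_rules[unfolded space_simps]
  note dist = KK.mult_tsum_left[unfolded space_simps] KK.mult_tsum_right[unfolded space_simps]
  note [simp] = tensor_hopf_comult_pure[OF A.hom_coalgebra_axioms B.hom_coalgebra_axioms]
    tensor_hopf_counit_pure[OF A.hom_coalgebra_axioms B.hom_coalgebra_axioms]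
    tensor_alg_mult_pure[OF A.hom_algebra_axioms B.hom_algebra_axioms, folded tensor_hopf_simps(2)]
    tensor_alg_mult_pure[OF K.hom_algebra_axioms K.hom_algebra_axioms, unfolded space_simps]
  note [simp] = lin_ground_mult1 lin_ground_mult2
  have comult_mult: "comult ?K (s \<otimes>\<^bsub>?K\<^esub> t) = comult ?K s \<otimes>\<^bsub>?KK\<^esub> comult ?K t"
    if s [simp]: "s \<in> carrier ?T" and t [simp]: "t \<in> carrier ?T" for s t
  proof (rule tensor_linear_ext[of k A B ?TT "\<lambda>s. comult ?K (s \<otimes>\<^bsub>?K\<^esub> t)" "\<lambda>s. comult ?K s \<otimes>\<^bsub>?KK\<^esub> comult ?K t" s], goal_cases)
    case (7 a b)
    note [simp] = 7
    show ?case
    proof (rule tensor_linear_ext[of k A B ?TT "\<lambda>t. comult ?K (tpure k A B a b \<otimes>\<^bsub>?K\<^esub> t)" "\<lambda>t. comult ?K (tpure k A B a b) \<otimes>\<^bsub>?KK\<^esub> comult ?K t" t], goal_cases)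
      case (7 a' b')
      note [simp] = 7
      have "comult ?K (tpure k A B a b \<otimes>\<^bsub>?K\<^esub> tpure k A B a' b') =
         tsum k A A ?TT (\<lambda>a1 a2. tsum k A A ?TT (\<lambda>a1' a2'. tsum k B B ?TT (\<lambda>b1 b2. tsum k B B ?TT (\<lambda>b1' b2'.
           tpure k ?T ?T (tpure k A B (a1 \<otimes>\<^bsub>A\<^esub> a1') (b1 \<otimes>\<^bsub>B\<^esub> b1')) (tpure k A B (a2 \<otimes>\<^bsub>A\<^esub> a2') (b2 \<otimes>\<^bsub>B\<^esub> b2')))
           (comult B b')) (comult B b)) (comult A a')) (comult A a)"
        by (simp add: A.comult_mult B.comult_mult)
      also have "\<dots> = tsum k A A ?TT (\<lambda>a1 a2. tsum k B B ?TT (\<lambda>b1 b2. tsum k A A ?TT (\<lambda>a1' a2'. tsum k B B ?TT (\<lambda>b1' b2'.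
           tpure k ?T ?T (tpure k A B (a1 \<otimes>\<^bsub>A\<^esub> a1') (b1 \<otimes>\<^bsub>B\<^esub> b1')) (tpure k A B (a2 \<otimes>\<^bsub>A\<^esub> a2') (b2 \<otimes>\<^bsub>B\<^esub> b2')))
           (comult B b')) (comult A a')) (comult B b)) (comult A a)"
        by (rule tsum_body_cong, rule tsum_swap) simp_all
      also have "\<dots> = tsum k A A ?TT (\<lambda>a1 a2. tsum k B B ?TT (\<lambda>b1 b2. 
           tpure k ?T ?T (tpure k A B a1 b1) (tpure k A B a2 b2) \<otimes>\<^bsub>?KK\<^esub> comult ?K (tpure k A B a' b')) (comult B b)) (comult A a)"
        by (simp add: dist(2))
      also have "\<dots> = comult ?K (tpure k A B a b) \<otimes>\<^bsub>?KK\<^esub> comult ?K (tpure k A B a' b')"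
        by (simp add: dist(1))
      finally show ?case .
    qed simp_all
  qed simp_all
  have counit_mult: "counit ?K (s \<otimes>\<^bsub>?K\<^esub> t) = counit ?K s \<otimes>\<^bsub>k\<^esub> counit ?K t"
    if s [simp]: "s \<in> carrier ?T" and t [simp]: "t \<in> carrier ?T" for s t
  proof (rule tensor_linear_ext[of k A B "ground_space k" "\<lambda>s. counit ?K (s \<otimes>\<^bsub>?K\<^esub> t)" "\<lambda>s. counit ?K s \<otimes>\<^bsub>k\<^esub> counit ?K t" s], goal_cases)
    case (7 a b)
    note [simp] = 7
    show ?case
      by (rule tensor_linear_ext[of k A B "ground_space k" "\<lambda>t. counit ?K (tpure k A B a b \<otimes>\<^bsub>?K\<^esub> t)"
            "\<lambda>t. counit ?K (tpure k A B a b) \<otimes>\<^bsub>k\<^esub> counit ?K t" t])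
         (simp_all add: A.k.m_ac)
  qed simp_all
  show ?thesis
  proof (intro hom_bialgebra.intro hom_bialgebra_axioms.intro K.hom_algebra_axioms K.hom_coalgebra_axioms)
    show "hom_algebra_morphism k ?K ?KK (comult ?K)"
      using K.comult_linear comult_mult K.comult_twist
      by (simp add: hom_algebra_morphism_def tensor_alg_simps tensor_hopf_simps(3) del: K.tmap_comult)
    show "hom_algebra_morphism k ?K (ground_space k) (counit ?K)"
      using K.counit_linear counit_mult K.counit_twist
      by (simp add: hom_algebra_morphism_def tensor_hopf_simps(3))
  qed
qed

lemma hom_hopf_algebra_tensor_hopf:
  assumes A: "hom_hopf_algebra k A" and B: "hom_hopf_algebra k B"
  shows "hom_hopf_algebra k (tensor_hopf k A B)"
proof -
  interpret A: hom_hopf_algebra k A by fact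
  interpret B: hom_hopf_algebra k B by fact
  let ?K = "tensor_hopf k A B" and ?T = "tensor_space k A B"
  let ?TT = "tensor_space k ?T ?T"
  interpret K: hom_bialgebra k ?K by (rule hom_bialgebra_tensor_hopf) unfold_locales
  note [simp] = K.algebra_rules[unfolded space_simps]
    K.coalgebra_rules[unfolded space_simps]
  note [simp] = tensor_hopf_comult_pure[OF A.hom_coalgebra_axioms B.hom_coalgebra_axioms]
    tensor_hopf_counit_pure[OF A.hom_coalgebra_axioms B.hom_coalgebra_axioms]
    tensor_alg_mult_pure[OF A.hom_algebra_axioms B.hom_algebra_axioms, folded tensor_hopf_simps(2)]
  let ?S = "antipode ?K"
  have S: "linear_map k ?T ?T ?S"
    unfolding tensor_hopf_simps by (rule tmap_linear) simp_all
  have [simp]: "linear_map k X ?T (\<lambda>x. ?S (f x))" if "linear_map k X ?T f" for X f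
    by (rule linear_map_comp[OF S that])
  have [simp]: "?S t \<in> carrier ?T" if "t \<in> carrier ?T" for t
    by (rule linear_map_closed[OF S that])
  have [simp]: "?S (tpure k A B a b) = tpure k A B (antipode A a) (antipode B b)" if "a \<in> carrier A" "b \<in> carrier B" for a b
    using that by (simp add: tensor_hopf_simps)
  have [simp]: "twist ?K (tpure k A B a b) = tpure k A B (twist A a) (twist B b)" if "a \<in> carrier A" "b \<in> carrier B" for a b
    using that by (simp add: tensor_hopf_simps)
  have one [simp]: "\<one>\<^bsub>?K\<^esub> = tpure k A B \<one>\<^bsub>A\<^esub> \<one>\<^bsub>B\<^esub>"
    by (simp add: tensor_hopf_simps)
  note sm = linear_map_smult[OF bilinear_map_right[OF tpure_bilinear]] linear_map_smult[OF bilinear_map_left[OF tpure_bilinear]]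
  have [simp]: "x \<odot>\<^bsub>?T\<^esub> (y \<odot>\<^bsub>?T\<^esub> t) = (x \<otimes>\<^bsub>k\<^esub> y) \<odot>\<^bsub>?T\<^esub> t"
    if "x \<in> carrier k" "y \<in> carrier k" "t \<in> carrier ?T" for x y t
    using that module.smult_assoc1[OF tensor_space_module[OF A.space B.space], of x y t] by simp
  show ?thesis
  proof unfold_locales
    show "linear_map k ?K ?K ?S" using S by simp
    fix h assume "h \<in> carrier ?K"
    then have h [simp]: "h \<in> carrier ?T" by simp
    show "?S (twist ?K h) = twist ?K (?S h)"
    proof (rule tensor_linear_ext[of k A B ?T "\<lambda>h. ?S (twist ?K h)" "\<lambda>h. twist ?K (?S h)" h], goal_cases)
      case 1
      show ?case by (rule linear_map_comp[OF S]) (use K.twist_linear in simp)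
    next
      case 2
      show ?case by (rule linear_map_comp[OF _ S]) (use K.twist_linear in simp)
    qed simp_all
    have L: "tlift k ?T (\<lambda>x y. ?S x \<otimes>\<^bsub>?K\<^esub> y) (comult ?K h) = tsum k ?T ?T ?T (\<lambda>x y. ?S x \<otimes>\<^bsub>?K\<^esub> y) (comult ?K h)"
      by (rule tlift_eq_tsum) simp_all
    have R: "tlift k ?T (\<lambda>x y. x \<otimes>\<^bsub>?K\<^esub> ?S y) (comult ?K h) = tsum k ?T ?T ?T (\<lambda>x y. x \<otimes>\<^bsub>?K\<^esub> ?S y) (comult ?K h)"
      by (rule tlift_eq_tsum) simp_all
    have "tsum k ?T ?T ?T (\<lambda>x y. ?S x \<otimes>\<^bsub>?K\<^esub> y) (comult ?K h) = counit ?K h \<odot>\<^bsub>?T\<^esub> \<one>\<^bsub>?K\<^esub>"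
    proof (rule tensor_linear_ext[of k A B ?T "\<lambda>h. tsum k ?T ?T ?T (\<lambda>x y. ?S x \<otimes>\<^bsub>?K\<^esub> y) (comult ?K h)" "\<lambda>h. counit ?K h \<odot>\<^bsub>?T\<^esub> \<one>\<^bsub>?K\<^esub>" h], goal_cases)
      case (7 a b)
      then have "tsum k ?T ?T ?T (\<lambda>x y. ?S x \<otimes>\<^bsub>?K\<^esub> y) (comult ?K (tpure k A B a b)) =
          tpure k A B (tsum k A A A (\<lambda>x y. antipode A x \<otimes>\<^bsub>A\<^esub> y) (comult A a)) (tsum k B B B (\<lambda>x y. antipode B x \<otimes>\<^bsub>B\<^esub> y) (comult B b))"
        by (simp del: A.tsum_antipode_left B.tsum_antipode_left) (rule tsum_swap, simp_all)
      then show ?case using 7 by (simp add: sm A.k.m_comm)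
    qed simp_all
    with L show "tlift k ?K (\<lambda>x y. ?S x \<otimes>\<^bsub>?K\<^esub> y) (comult ?K h) = counit ?K h \<odot>\<^bsub>?K\<^esub> \<one>\<^bsub>?K\<^esub>"
      by (simp only: space_simps)
    have "tsum k ?T ?T ?T (\<lambda>x y. x \<otimes>\<^bsub>?K\<^esub> ?S y) (comult ?K h) = counit ?K h \<odot>\<^bsub>?T\<^esub> \<one>\<^bsub>?K\<^esub>"
    proof (rule tensor_linear_ext[of k A B ?T "\<lambda>h. tsum k ?T ?T ?T (\<lambda>x y. x \<otimes>\<^bsub>?K\<^esub> ?S y) (comult ?K h)" "\<lambda>h. counit ?K h \<odot>\<^bsub>?T\<^esub> \<one>\<^bsub>?K\<^esub>" h], goal_cases)
      case (7 a b)
      then have "tsum k ?T ?T ?T (\<lambda>x y. x \<otimes>\<^bsub>?K\<^esub> ?S y) (comult ?K (tpure k A B a b)) =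
          tpure k A B (tsum k A A A (\<lambda>x y. x \<otimes>\<^bsub>A\<^esub> antipode A y) (comult A a)) (tsum k B B B (\<lambda>x y. x \<otimes>\<^bsub>B\<^esub> antipode B y) (comult B b))"
        by (simp del: A.tsum_antipode_right B.tsum_antipode_right) (rule tsum_swap, simp_all)
      then show ?case using 7 by (simp add: sm A.k.m_comm)
    qed simp_all
    with R show "tlift k ?K (\<lambda>x y. x \<otimes>\<^bsub>?K\<^esub> ?S y) (comult ?K h) = counit ?K h \<odot>\<^bsub>?K\<^esub> \<one>\<^bsub>?K\<^esub>"
      by (simp only: space_simps)
  qed
qed

section \<open>The coaction of the opposite tensor algebra\<close>

context hom_coalgebra
begin

text \<open>
  This rule and the next one translate a two-fold coproduct into strict numbering. The legs that are split
  off by the inner coproduct acquire \<open>\<alpha>\<^sup>2\<close>, the remaining one \<open>\<alpha>\<close>.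
\<close>

lemma tsum_nested_left_sw:
  assumes "c \<in> carrier C" "module k U" and F: "trilinear_map k C C C U F"
  shows "tsum k C C U (\<lambda>x y. tsum k C C U (\<lambda>x1 x2. F x1 x2 y) (comult C x)) (comult C c) =
    sw U (\<lambda>x y. sw U (\<lambda>x1 x2. F (twist C (twist C x1)) (twist C (twist C x2)) (twist C y)) x) c"
proof -
  note F' = trilinear_mapD[OF F]
  note [simp] = assms(1,2) F'(4)
  note [simp] = trilinear_map_comp[OF F]
  have "tsum k C C U (\<lambda>x y. tsum k C C U (\<lambda>x1 x2. F x1 x2 y) (comult C x)) (comult C c) =
     sw U (\<lambda>x y. tsum k C C U (\<lambda>x1 x2. F x1 x2 (twist C y)) (comult C (twist C x))) c"
    by (rule tsum_sw) simp_all
  also have "\<dots> = sw U (\<lambda>x y. sw U (\<lambda>x1 x2. F (twist C (twist C x1)) (twist C (twist C x2)) (twist C y)) x) c"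
    by (rule tsum_body_cong, subst tsum_comult_twist, simp_all, rule tsum_sw, simp_all)
  finally show ?thesis .
qed

lemma tsum_nested_right_sw:
  assumes "c \<in> carrier C" "module k U" and F: "trilinear_map k C C C U F"
  shows "tsum k C C U (\<lambda>x y. tsum k C C U (\<lambda>y1 y2. F x y1 y2) (comult C y)) (comult C c) =
    sw U (\<lambda>x y. sw U (\<lambda>y1 y2. F (twist C x) (twist C (twist C y1)) (twist C (twist C y2))) y) c"
proof -
  note F' = trilinear_mapD[OF F]
  note [simp] = assms(1,2) F'(4)
  note [simp] = trilinear_map_comp[OF F]
  have "tsum k C C U (\<lambda>x y. tsum k C C U (\<lambda>y1 y2. F x y1 y2) (comult C y)) (comult C c) =
     sw U (\<lambda>x y. tsum k C C U (\<lambda>y1 y2. F (twist C x) y1 y2) (comult C (twist C y))) c"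
    by (rule tsum_sw) simp_all
  also have "\<dots> = sw U (\<lambda>x y. sw U (\<lambda>y1 y2. F (twist C x) (twist C (twist C y1)) (twist C (twist C y2))) y) c"
    by (rule tsum_body_cong, subst tsum_comult_twist, simp_all, rule tsum_sw, simp_all)
  finally show ?thesis .
qed

end

context regular_hom_hopf_algebra
begin

abbreviation K where "K \<equiv> tensor_hopf k (op_hopf H) H"
abbreviation HK where "HK \<equiv> tensor_space k H HH"
abbreviation rho where "rho \<equiv> yd_coaction k H"

lemma hom_structures_op: "hom_hopf_algebra k (op_hopf H)" "hom_algebra k (op_hopf H)" "hom_coalgebra k (op_hopf H)"
  using hom_hopf_algebra_op
  by (auto simp: hom_hopf_algebra_def hom_bialgebra_def)

lemma hom_hopf_algebra_K: "hom_hopf_algebra k K"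
  by (rule hom_hopf_algebra_tensor_hopf[OF hom_structures_op(1) hom_hopf_algebra_axioms])

lemmas K_pure [simp] =
  tensor_hopf_comult_pure[OF hom_structures_op(3) hom_coalgebra_axioms, unfolded space_simps op_hopf_simps]
  tensor_hopf_counit_pure[OF hom_structures_op(3) hom_coalgebra_axioms, unfolded space_simps op_hopf_simps]
  tensor_alg_mult_pure[OF hom_structures_op(2) hom_algebra_axioms, folded tensor_hopf_simps(2), unfolded space_simps op_hopf_simps]

lemma K_one [simp]: "\<one>\<^bsub>K\<^esub> = tpure k H H \<one>\<^bsub>H\<^esub> \<one>\<^bsub>H\<^esub>"
  by (simp add: tensor_hopf_simps)

lemma K_twist [simp]: "\<lbrakk>x \<in> carrier H; y \<in> carrier H\<rbrakk> \<Longrightarrow> twist K (tpure k H H x y) = tpure k H H (twist H x) (twist H y)"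
  by (simp add: tensor_hopf_simps)

lemma yd_coaction_tsum:
  assumes h: "h \<in> carrier H"
  shows "rho h = tsum k H H HK (\<lambda>h1 h2. tsum k H H HK (\<lambda>h11 h12.
     tpure k H HH (twist_inv H h12) (tpure k H H (antipode_inv H (twist_inv H (twist_inv H h11))) (twist_inv H h2)))
     (comult H h1)) (comult H h)"
proof -
  let ?f = "\<lambda>h11 h12 h2. tpure k H HH (twist_inv H h12) (tpure k H H (antipode_inv H (twist_inv H (twist_inv H h11))) (twist_inv H h2))"
  have 1: "tlift k HK (\<lambda>h11 h12. ?f h11 h12 h2) (comult H h1) = tsum k H H HK (\<lambda>h11 h12. ?f h11 h12 h2) (comult H h1)"
    if "h1 \<in> carrier H" "h2 \<in> carrier H" for h1 h2
    by (rule tlift_eq_tsum) (simp_all add: that)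
  have "rho h = tlift k HK (\<lambda>h1 h2. tlift k HK (\<lambda>h11 h12. ?f h11 h12 h2) (comult H h1)) (comult H h)"
    by (simp add: yd_coaction_def op_tensor_hopf_def Let_def)
  also have "\<dots> = tsum k H H HK (\<lambda>h1 h2. tlift k HK (\<lambda>h11 h12. ?f h11 h12 h2) (comult H h1)) (comult H h)"
    by (rule tlift_eq_tsum) (use h in \<open>simp_all add: 1\<close>)
  also have "\<dots> = tsum k H H HK (\<lambda>h1 h2. tsum k H H HK (\<lambda>h11 h12. ?f h11 h12 h2) (comult H h1)) (comult H h)"
    by (simp add: 1)
  finally show ?thesis .
qed

text \<open>
  The powers of \<open>\<alpha>\<^sup>-\<^sup>1\<close> in the definition of the coaction cancel the twists that strict numbering produces,
  apart from one \<open>\<alpha>\<close> on the middle leg: \<open>\<rho>(h) = \<alpha>(h\<^sub>2) \<otimes> (S\<^sup>-\<^sup>1(h\<^sub>1) \<otimes> h\<^sub>3)\<close>.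
\<close>

lemma yd_coaction_sw:
  assumes h: "h \<in> carrier H"
  shows "rho h = sw HK (\<lambda>u z. sw HK (\<lambda>x y.
     tpure k H HH (twist H y) (tpure k H H (antipode_inv H x) z)) u) h"
  unfolding yd_coaction_tsum[OF h]
  by (subst tsum_nested_left_sw) (simp_all add: h)

lemma yd_coaction_linear: "linear_map k H HK rho"
  by (rule linear_map_cong[OF _ _ yd_coaction_sw[symmetric]]) simp_all

lemma yd_coaction_closed [simp]: "h \<in> carrier H \<Longrightarrow> rho h \<in> carrier HK"
  by (rule linear_map_closed[OF yd_coaction_linear])

lemma lin_yd_coaction [simp]: "linear_map k X H f \<Longrightarrow> linear_map k X HK (\<lambda>x. rho (f x))"
  by (rule linear_map_comp[OF yd_coaction_linear])

text \<open>
  In strict numbering both sides of the coassociativity axiom are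
  \<open>\<alpha>\<^sup>2(m\<^sub>3) \<otimes> ((\<alpha> S\<^sup>-\<^sup>1(m\<^sub>2) \<otimes> \<alpha>(m\<^sub>4)) \<otimes> (\<alpha> S\<^sup>-\<^sup>1(m\<^sub>1) \<otimes> \<alpha>(m\<^sub>5)))\<close>. On the left the middle leg
  of \<open>\<rho>(m)\<close> is split into three; on the right the outer legs are split into two each, and \<open>S\<^sup>-\<^sup>1\<close>
  exchanges the halves of the first one.
\<close>

lemma hom_comodule_yd: "hom_comodule k K H rho"
proof -
  interpret K: hom_hopf_algebra k K by (rule hom_hopf_algebra_K)
  note [simp] = K.coalgebra_rules[unfolded space_simps]
    K.twist_closed[unfolded space_simps] K.lin_twist[unfolded space_simps]
  have twist_K: "linear_map k HH HH (twist K)" using K.twist_linear by simp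
  have comult_K: "linear_map k HH (tensor_space k HH HH) (comult K)" using K.comult_linear by simp
  note tm = tmap_tsum[of k H HH] 
  show ?thesis
  proof (intro hom_comodule.intro hom_comodule_axioms.intro K.hom_coalgebra_axioms hom_vector_space_axioms)
    show "linear_map k H (tensor_space k H K) rho" using yd_coaction_linear by simp
    fix m assume m [simp]: "m \<in> carrier H"
    have "tlift k H (\<lambda>m0 m1. counit K m1 \<odot>\<^bsub>H\<^esub> m0) (rho m) = tsum k H HH H (\<lambda>m0 m1. counit K m1 \<odot>\<^bsub>H\<^esub> m0) (rho m)"
      by (rule tlift_eq_tsum) simp_all
    also have "\<dots> = sw H (\<lambda>u z. sw H (\<lambda>x y. counit H x \<odot>\<^bsub>H\<^esub> (counit H z \<odot>\<^bsub>H\<^esub> twist H y)) u) m"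
      by (simp add: yd_coaction_sw V.smult_assoc1)
    also have "\<dots> = twist H m" by simp
    finally show "tlift k H (\<lambda>m0 m1. counit K m1 \<odot>\<^bsub>H\<^esub> m0) (rho m) = twist H m" .
    have "tmap k H HH (twist H) (twist K) (rho m) = tsum k H HH HK (\<lambda>a b. tpure k H HH (twist H a) (twist K b)) (rho m)"
      by (rule tm) (simp_all add: twist_K)
    also have "\<dots> = sw HK (\<lambda>u z. sw HK (\<lambda>x y.
       tpure k H HH (twist H (twist H y)) (tpure k H H (twist H (antipode_inv H x)) (twist H z))) u) m"
      by (simp add: yd_coaction_sw)
    also have "\<dots> = sw HK (\<lambda>u z. sw HK (\<lambda>x y.
       tpure k H HH (twist H y) (tpure k H H (antipode_inv H x) (twist H z))) (twist H u)) m"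
      by (rule tsum_body_cong, simp, subst (2) tsum_sw, simp_all)
    also have "\<dots> = rho (twist H m)"
      by (subst yd_coaction_sw, simp, simp, subst (2) tsum_sw, simp_all)
    finally show "tmap k H K (twist H) (twist K) (rho m) = rho (twist H m)" by simp
    let ?KK = "tensor_space k HH HH"
    let ?HKK = "tensor_space k H ?KK"
    let ?a = "twist H" and ?S = "antipode_inv H"
    let ?G = "\<lambda>p q r s t. tpure k H ?KK (?a (?a r)) (tpure k HH HH (tpure k H H (?a (?S q)) (?a s)) (tpure k H H (?a (?S p)) (?a t)))"
    have "tmap k HK HH rho (twist K) (rho m) = tsum k H HH (tensor_space k HK HH) (\<lambda>a b. tpure k HK HH (rho a) (twist K b)) (rho m)"
      by (rule tm) (simp_all add: twist_K yd_coaction_linear)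
    also have "\<dots> = sw (tensor_space k HK HH) (\<lambda>u z. sw (tensor_space k HK HH) (\<lambda>x y.
       tpure k HK HH (rho (?a y)) (tpure k H H (?a (?S x)) (?a z))) u) m"
      by (simp add: yd_coaction_sw[of m])
    finally have L1: "tmap k HK HH rho (twist K) (rho m) = \<dots>" .
    have "tassoc k H HH HH (tmap k HK HH rho (twist K) (rho m)) = sw ?HKK (\<lambda>u z. sw ?HKK (\<lambda>x y. sw ?HKK (\<lambda>w z'. sw ?HKK (\<lambda>x' y'.
        tpure k H ?KK (?a y') (tpure k HH HH (tpure k H H (?S x') z') (tpure k H H (?a (?S x)) (?a z)))) w) (?a y)) u) m"
      unfolding L1 by (simp add: yd_coaction_sw[of "?a _"] cong: tsum_cong)
    also have "\<dots> = sw ?HKK (\<lambda>u z. sw ?HKK (\<lambda>x y. sw ?HKK (\<lambda>w z'. sw ?HKK (\<lambda>x' y'.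
        ?G x x' y' z' z) w) y) u) m"
      apply (rule tsum_body_cong, rule tsum_body_cong)
      apply (simp only: twist_inv_twist)
      apply (rule trans[OF tsum_sw], simp, simp, simp)
      apply (rule tsum_body_cong)
      apply (simp only: twist_inv_twist)
      apply (rule trans[OF tsum_sw], simp, simp, simp)
      apply simp
      done
    finally have L: "tassoc k H HH HH (tmap k HK HH rho (twist K) (rho m)) = \<dots>" .
    have "tmap k H ?KK (twist H) (comult K) (rho m) = tsum k H HH ?HKK (\<lambda>a b. tpure k H ?KK (twist H a) (comult K b)) (rho m)"
      by (rule tm) (simp_all add: comult_K)
    also have "\<dots> = sw ?HKK (\<lambda>u z. sw ?HKK (\<lambda>x y. tsum k H H ?HKK (\<lambda>x1 x2. tsum k H H ?HKK (\<lambda>z1 z2.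
       tpure k H ?KK (?a (?a y)) (tpure k HH HH (tpure k H H (?S x2) z1) (tpure k H H (?S x1) z2))) (comult H z)) (comult H x)) u) m"
      by (simp add: yd_coaction_sw[of m] comult_antipode_inv)
    also have "\<dots> = sw ?HKK (\<lambda>u z. sw ?HKK (\<lambda>x y. sw ?HKK (\<lambda>x1 x2. sw ?HKK (\<lambda>z1 z2.
       ?G x1 x2 y z1 z2) z) x) u) m"
      apply (rule tsum_body_cong, rule tsum_body_cong)
      apply (rule trans[OF tsum_sw], simp, simp, simp)
      apply (rule tsum_body_cong)
      apply (rule trans[OF tsum_sw], simp, simp, simp)
      apply simp
      done
    \<comment> \<open>What remains is to turn the bracketing \<open>((m\<^sub>1 m\<^sub>2) m\<^sub>3) (m\<^sub>4 m\<^sub>5)\<close> into \<open>(m\<^sub>1 ((m\<^sub>2 m\<^sub>3) m\<^sub>4)) m\<^sub>5\<close>.\<close>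
    also have "\<dots> = sw ?HKK (\<lambda>u z. sw ?HKK (\<lambda>x y. sw ?HKK (\<lambda>z1 z2. sw ?HKK (\<lambda>x1 x2.
       ?G x1 x2 y z1 z2) x) z) u) m"
      by (rule tsum_body_cong, rule tsum_body_cong, rule tsum_swap) simp_all
    also have "\<dots> = sw ?HKK (\<lambda>u z. sw ?HKK (\<lambda>z1 z2. sw ?HKK (\<lambda>x y. sw ?HKK (\<lambda>x1 x2.
       ?G x1 x2 y z1 z2) x) u) z) m"
      by (rule tsum_body_cong, rule tsum_swap) simp_all
    also have "\<dots> = sw ?HKK (\<lambda>v z2. sw ?HKK (\<lambda>u z1. sw ?HKK (\<lambda>x y. sw ?HKK (\<lambda>x1 x2.
       ?G x1 x2 y z1 z2) x) u) v) m"
      by (rule sw_coassoc[symmetric]) simp_all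
    also have "\<dots> = sw ?HKK (\<lambda>v z2. sw ?HKK (\<lambda>u z1. sw ?HKK (\<lambda>x1 w. sw ?HKK (\<lambda>x2 y.
       ?G x1 x2 y z1 z2) w) u) v) m"
      by (rule tsum_body_cong, rule tsum_body_cong, rule sw_coassoc) simp_all
    also have "\<dots> = sw ?HKK (\<lambda>v z2. sw ?HKK (\<lambda>x1 y'. sw ?HKK (\<lambda>w z1. sw ?HKK (\<lambda>x2 y.
       ?G x1 x2 y z1 z2) w) y') v) m"
      by (rule tsum_body_cong, rule sw_coassoc) simp_all
    finally have R: "tmap k H ?KK (twist H) (comult K) (rho m) = \<dots>" .
    show "tassoc k H K K (tmap k (tensor_space k H K) K rho (twist K) (rho m)) =
         tmap k H (tensor_space k K K) (twist H) (comult K) (rho m)"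
      using L R by (simp only: space_simps)
  qed
qed

text \<open>
  Both sides are sums over \<open>a\<^sub>1, a\<^sub>2, a\<^sub>3\<close> and \<open>b\<^sub>1, b\<^sub>2, b\<^sub>3\<close>. In the first leg of \<open>K\<close> stands
  \<open>S\<^sup>-\<^sup>1(a\<^sub>1 b\<^sub>1) = S\<^sup>-\<^sup>1(b\<^sub>1) S\<^sup>-\<^sup>1(a\<^sub>1)\<close>, which is the product of \<open>S\<^sup>-\<^sup>1(a\<^sub>1)\<close> and
  \<open>S\<^sup>-\<^sup>1(b\<^sub>1)\<close> in \<open>H\<^sup>o\<^sup>p\<close>.
\<close>

lemma hom_comodule_algebra_yd: "hom_comodule_algebra k K H rho"
proof -
  interpret K: hom_hopf_algebra k K by (rule hom_hopf_algebra_K)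
  interpret HK: hom_algebra k "tensor_alg k H K" by (rule hom_algebra_tensor_alg) unfold_locales
  let ?HK = "tensor_alg k H K"
  note [simp] = K.algebra_rules[unfolded space_simps]
    HK.algebra_rules[unfolded space_simps]
    tensor_alg_mult_pure[OF hom_algebra_axioms K.hom_algebra_axioms, unfolded space_simps]
  note dist = HK.mult_tsum_left[unfolded space_simps] HK.mult_tsum_right[unfolded space_simps]
  show ?thesis
  proof (intro hom_comodule_algebra.intro hom_comodule_algebra_axioms.intro K.hom_hopf_algebra_axioms
      hom_algebra_axioms hom_comodule_yd)
    let ?S = "antipode_inv H" and ?a = "twist H"
    let ?G = "\<lambda>x y z x' y' z'. tpure k H HH (?a y \<otimes>\<^bsub>H\<^esub> ?a y') (tpure k H H (?S x' \<otimes>\<^bsub>H\<^esub> ?S x) (z \<otimes>\<^bsub>H\<^esub> z'))"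
    show "rho \<one>\<^bsub>H\<^esub> = tpure k H K \<one>\<^bsub>H\<^esub> \<one>\<^bsub>K\<^esub>"
      by (simp add: yd_coaction_sw)
    fix a b assume [simp]: "a \<in> carrier H" "b \<in> carrier H"
    have "rho (a \<otimes>\<^bsub>H\<^esub> b) = sw HK (\<lambda>u z. sw HK (\<lambda>u' z'. sw HK (\<lambda>x y. sw HK (\<lambda>x' y'. ?G x y z x' y' z') u') u) b) a"
      by (simp add: yd_coaction_sw twist_inv_mult comult_mult twist_mult antipode_inv_mult)
    also have "\<dots> = sw HK (\<lambda>u z. sw HK (\<lambda>x y. sw HK (\<lambda>u' z'. sw HK (\<lambda>x' y'. ?G x y z x' y' z') u') b) u) a"
      by (rule tsum_body_cong, rule tsum_swap) simp_all
    also have "\<dots> = sw HK (\<lambda>u z. sw HK (\<lambda>x y. tpure k H HH (?a y) (tpure k H H (?S x) z) \<otimes>\<^bsub>?HK\<^esub> rho b) u) a"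
      by (simp add: yd_coaction_sw[of b] dist(2))
    also have "\<dots> = rho a \<otimes>\<^bsub>?HK\<^esub> rho b"
      by (simp add: yd_coaction_sw[of a] dist(1))
    finally show "rho (a \<otimes>\<^bsub>H\<^esub> b) = rho a \<otimes>\<^bsub>?HK\<^esub> rho b" .
  qed
qed

section \<open>The action of the opposite tensor algebra\<close>

abbreviation kact where "kact \<equiv> yd_action k H"

lemma yd_action_tsum:
  assumes "t \<in> carrier HH" "l \<in> carrier H"
  shows "kact t l = tsum k H H H (\<lambda>h g. (g \<otimes>\<^bsub>H\<^esub> twist_inv H l) \<otimes>\<^bsub>H\<^esub> twist H h) t"
  unfolding yd_action_def by (rule tlift_eq_tsum) (simp_all add: assms)

lemma yd_action_pure [simp]:
  assumes "h \<in> carrier H" "g \<in> carrier H" "l \<in> carrier H"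
  shows "kact (tpure k H H h g) l = (g \<otimes>\<^bsub>H\<^esub> twist_inv H l) \<otimes>\<^bsub>H\<^esub> twist H h"
  by (simp add: yd_action_tsum assms)

lemma yd_action_bilinear: "bilinear_map k HH H H kact"
proof (rule bilinear_mapI)
  show "linear_map k H H (kact t)" if "t \<in> carrier HH" for t
    by (rule linear_map_cong[OF _ _ yd_action_tsum[symmetric]]) (use that in simp_all)
  show "linear_map k HH H (\<lambda>t. kact t l)" if "l \<in> carrier H" for l
    by (rule linear_map_cong[OF _ _ yd_action_tsum[symmetric]]) (use that in simp_all)
qed

lemma yd_action_closed [simp]: "\<lbrakk>t \<in> carrier HH; l \<in> carrier H\<rbrakk> \<Longrightarrow> kact t l \<in> carrier H"
  by (rule bilinear_map_closed[OF yd_action_bilinear])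

lemma lin_yd_action1 [simp]: "\<lbrakk>l \<in> carrier H; linear_map k X HH f\<rbrakk> \<Longrightarrow> linear_map k X H (\<lambda>x. kact (f x) l)"
  by (rule linear_map_comp[OF bilinear_map_left[OF yd_action_bilinear]])

lemma lin_yd_action2 [simp]: "\<lbrakk>t \<in> carrier HH; linear_map k X H f\<rbrakk> \<Longrightarrow> linear_map k X H (\<lambda>x. kact t (f x))"
  by (rule linear_map_comp[OF bilinear_map_right[OF yd_action_bilinear]])

text \<open>
  In the underlying associative algebra both sides are the product of \<open>g, g', m, h', h\<close> in this order, up to a
  power of \<open>\<alpha>\<close> on each factor; Hom-associativity matches the powers.
\<close>

lemma yd_action_mult_pure:
  assumes [simp]: "h \<in> carrier H" "g \<in> carrier H" "h' \<in> carrier H" "g' \<in> carrier H" "m \<in> carrier H"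
  shows "(twist H g \<otimes>\<^bsub>H\<^esub> twist_inv H ((g' \<otimes>\<^bsub>H\<^esub> twist_inv H m) \<otimes>\<^bsub>H\<^esub> twist H h')) \<otimes>\<^bsub>H\<^esub> twist H (twist H h) =
    ((g \<otimes>\<^bsub>H\<^esub> g') \<otimes>\<^bsub>H\<^esub> m) \<otimes>\<^bsub>H\<^esub> twist H (h' \<otimes>\<^bsub>H\<^esub> h)"
proof -
  let ?i = "twist_inv H" and ?a = "twist H"
  let ?X = "(?i g \<otimes>\<^bsub>H\<^esub> ?i g') \<otimes>\<^bsub>H\<^esub> ?i m"
  have "?a g \<otimes>\<^bsub>H\<^esub> ((?i g' \<otimes>\<^bsub>H\<^esub> ?i (?i m)) \<otimes>\<^bsub>H\<^esub> h') = (g \<otimes>\<^bsub>H\<^esub> (?i g' \<otimes>\<^bsub>H\<^esub> ?i (?i m))) \<otimes>\<^bsub>H\<^esub> ?a h'"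
    by (rule hom_assoc) simp_all
  also have "g \<otimes>\<^bsub>H\<^esub> (?i g' \<otimes>\<^bsub>H\<^esub> ?i (?i m)) = ?X"
    using hom_assoc[of "?i g" "?i g'" "?i (?i m)"] by simp
  finally have "(?a g \<otimes>\<^bsub>H\<^esub> ?i ((g' \<otimes>\<^bsub>H\<^esub> ?i m) \<otimes>\<^bsub>H\<^esub> ?a h')) \<otimes>\<^bsub>H\<^esub> ?a (?a h) = (?X \<otimes>\<^bsub>H\<^esub> ?a h') \<otimes>\<^bsub>H\<^esub> ?a (?a h)"
    by (simp add: twist_inv_mult)
  also have "\<dots> = ?a ?X \<otimes>\<^bsub>H\<^esub> (?a h' \<otimes>\<^bsub>H\<^esub> ?a h)"
    by (rule hom_assoc[symmetric]) simp_all
  finally show ?thesis by (simp add: twist_mult)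
qed

lemma hom_module_yd: "hom_module k K H kact"
proof -
  interpret K: hom_hopf_algebra k K by (rule hom_hopf_algebra_K)
  note [simp] = K.algebra_rules[unfolded space_simps]
    K.twist_closed[unfolded space_simps] K.lin_twist[unfolded space_simps]
  show ?thesis
  proof (intro hom_module.intro hom_module_axioms.intro K.hom_algebra_axioms hom_vector_space_axioms)
    show "bilinear_map k K H H kact"
      using yd_action_bilinear by (simp only: space_simps)
    fix m assume m [simp]: "m \<in> carrier H"
    show "kact \<one>\<^bsub>K\<^esub> m = twist H m"
      by simp
    fix a assume "a \<in> carrier K"
    then have a [simp]: "a \<in> carrier HH" by simp
    show "twist H (kact a m) = kact (twist K a) (twist H m)"
      by (rule tensor_linear_ext[of k H H H "\<lambda>a. twist H (kact a m)" "\<lambda>a. kact (twist K a) (twist H m)" a])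
         (simp_all add: twist_mult)
    fix b assume "b \<in> carrier K"
    then have b [simp]: "b \<in> carrier HH" by simp
    show "kact (twist K a) (kact b m) = kact (a \<otimes>\<^bsub>K\<^esub> b) (twist H m)"
    proof (rule tensor_linear_ext[of k H H H "\<lambda>a. kact (twist K a) (kact b m)" "\<lambda>a. kact (a \<otimes>\<^bsub>K\<^esub> b) (twist H m)" a], goal_cases)
      case (7 h g)
      note [simp] = 7
      show ?case
        by (rule tensor_linear_ext[of k H H H "\<lambda>b. kact (twist K (tpure k H H h g)) (kact b m)"
              "\<lambda>b. kact (tpure k H H h g \<otimes>\<^bsub>K\<^esub> b) (twist H m)" b])
           (simp_all add: yd_action_mult_pure)
    qed simp_all
  qed
qed

text \<open>
  The coproduct of \<open>(g \<alpha>\<^sup>-\<^sup>1(c)) \<alpha>(h)\<close> expands by multiplicativity into the sum over \<open>g\<close>, \<open>c\<close>, \<open>h\<close>, while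
  the axiom sums over \<open>h\<close>, \<open>g\<close>, \<open>c\<close>.
\<close>

lemma hom_module_coalgebra_yd: "hom_module_coalgebra k K H kact"
proof -
  interpret K: hom_hopf_algebra k K by (rule hom_hopf_algebra_K)
  note [simp] = K.coalgebra_rules[unfolded space_simps] lin_ground_mult1 lin_ground_mult2
  show ?thesis
  proof (intro hom_module_coalgebra.intro hom_module_coalgebra_axioms.intro K.hom_hopf_algebra_axioms
      hom_coalgebra_axioms hom_module_yd)
    fix t c assume t: "t \<in> carrier K" and c [simp]: "c \<in> carrier H"
    then have t [simp]: "t \<in> carrier HH" by simp
    let ?L = "\<lambda>t. comult H (kact t c)"
    let ?R = "\<lambda>t. tsum k HH HH HH (\<lambda>h1 h2. tsum k H H HH (\<lambda>c1 c2. tpure k H H (kact h1 c1) (kact h2 c2)) (comult H c)) (comult K t)"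
    have 1: "tlift k HH (\<lambda>c1 c2. tpure k H H (kact h1 c1) (kact h2 c2)) (comult H c) =
        tsum k H H HH (\<lambda>c1 c2. tpure k H H (kact h1 c1) (kact h2 c2)) (comult H c)"
      if "h1 \<in> carrier HH" "h2 \<in> carrier HH" for h1 h2
      by (rule tlift_eq_tsum) (simp_all add: that)
    have "tlift k HH (\<lambda>h1 h2. tlift k HH (\<lambda>c1 c2. tpure k H H (kact h1 c1) (kact h2 c2)) (comult H c)) (comult K t) =
       tsum k HH HH HH (\<lambda>h1 h2. tlift k HH (\<lambda>c1 c2. tpure k H H (kact h1 c1) (kact h2 c2)) (comult H c)) (comult K t)"
      by (rule tlift_eq_tsum) (simp_all add: 1)
    also have "\<dots> = ?R t" by (simp add: 1)
    also have "?R t = ?L t"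
    proof (rule tensor_linear_ext[of k H H HH ?R ?L t], goal_cases)
      case (7 h g)
      note [simp] = 7
      let ?i = "twist_inv H" and ?a = "twist H"
      let ?G = "\<lambda>g1 g2 c1 c2 h1 h2. tpure k H H ((g1 \<otimes>\<^bsub>H\<^esub> ?i c1) \<otimes>\<^bsub>H\<^esub> ?a h1) ((g2 \<otimes>\<^bsub>H\<^esub> ?i c2) \<otimes>\<^bsub>H\<^esub> ?a h2)"
      have "?R (tpure k H H h g) = tsum k H H HH (\<lambda>h1 h2. tsum k H H HH (\<lambda>g1 g2. tsum k H H HH (\<lambda>c1 c2.
          ?G g1 g2 c1 c2 h1 h2) (comult H c)) (comult H g)) (comult H h)"
        by simp
      also have "\<dots> = tsum k H H HH (\<lambda>g1 g2. tsum k H H HH (\<lambda>h1 h2. tsum k H H HH (\<lambda>c1 c2.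
          ?G g1 g2 c1 c2 h1 h2) (comult H c)) (comult H h)) (comult H g)"
        by (rule tsum_swap) simp_all
      also have "\<dots> = tsum k H H HH (\<lambda>g1 g2. tsum k H H HH (\<lambda>c1 c2. tsum k H H HH (\<lambda>h1 h2.
          ?G g1 g2 c1 c2 h1 h2) (comult H h)) (comult H c)) (comult H g)"
        by (rule tsum_body_cong, rule tsum_swap) simp_all
      also have "\<dots> = tsum k H H HH (\<lambda>g1 g2. sw HH (\<lambda>c1 c2. tsum k H H HH (\<lambda>h1 h2.
          ?G g1 g2 (?a c1) (?a c2) h1 h2) (comult H h)) c) (comult H g)"
        by (rule tsum_body_cong, rule tsum_sw) simp_all
      also have "\<dots> = tsum k H H HH (\<lambda>g1 g2. sw HH (\<lambda>c1 c2. tsum k H H HH (\<lambda>h1 h2.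
          tpure k H H ((g1 \<otimes>\<^bsub>H\<^esub> c1) \<otimes>\<^bsub>H\<^esub> h1) ((g2 \<otimes>\<^bsub>H\<^esub> c2) \<otimes>\<^bsub>H\<^esub> h2)) (comult H (?a h))) c) (comult H g)"
        by (simp add: tsum_comult_twist)
      also have "\<dots> = ?L (tpure k H H h g)"
        by (simp add: comult_mult)
      finally show ?case .
    qed simp_all
    finally show "comult H (kact t c) = tlift k (tensor_space k H H) (\<lambda>h1 h2. tlift k (tensor_space k H H)
       (\<lambda>c1 c2. tpure k H H (kact h1 c1) (kact h2 c2)) (comult H c)) (comult K t)" ..
    show "counit H (kact t c) = counit K t \<otimes>\<^bsub>k\<^esub> counit H c"
      by (rule tensor_linear_ext[of k H H "ground_space k" "\<lambda>t. counit H (kact t c)" "\<lambda>t. counit K t \<otimes>\<^bsub>k\<^esub> counit H c" t])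
         (simp_all add: k.m_ac)
  qed
qed

lemma doi_hopf_datum_yd: "doi_hopf_datum k K H rho H kact"
  by (intro doi_hopf_datum.intro hom_comodule_algebra_yd hom_module_coalgebra_yd)

end

section \<open>Doi-Hopf modules and Yetter-Drinfeld modules\<close>

context hom_module
begin

lemma action_closed [simp]: "\<lbrakk>a \<in> carrier A; m \<in> carrier M\<rbrakk> \<Longrightarrow> action a m \<in> carrier M"
  by (rule bilinear_map_closed[OF action_bilinear])

lemma lin_action1 [simp]: "\<lbrakk>m \<in> carrier M; linear_map k X A f\<rbrakk> \<Longrightarrow> linear_map k X M (\<lambda>x. action (f x) m)"
  by (rule linear_map_comp[OF bilinear_map_left[OF action_bilinear]])

end

lemma (in hom_comodule) coaction_closed [simp]:
  "m \<in> carrier M \<Longrightarrow> coaction m \<in> carrier (tensor_space k M C)"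
  by (rule linear_map_closed[OF coaction_linear])

context regular_hom_hopf_algebra
begin

text \<open>
  The two sides split \<open>h\<close> with different brackets, on the left by splitting \<open>h\<^sub>1\<close> and on the right by splitting
  \<open>h\<^sub>2\<close>. In strict numbering the summands agree, and strict coassociativity identifies the sums.
\<close>

lemma doi_hopf_compatibility_eq:
  assumes mod: "hom_module k H M (act M)" and comod: "hom_comodule k H M (coact M)"
    and h [simp]: "h \<in> carrier H" and m [simp]: "m \<in> carrier M"
  shows "tlift k (tensor_space k M H) (\<lambda>a0 a1.
      tlift k (tensor_space k M H) (\<lambda>m0 m1. tpure k M H (act M a0 m0) (kact a1 m1)) (coact M m)) (rho h) =
    tlift k (tensor_space k M H) (\<lambda>h1 h2. tlift k (tensor_space k M H) (\<lambda>h21 h22.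
      tlift k (tensor_space k M H) (\<lambda>m0 m1. tpure k M H (act M (twist_inv H h21) m0)
        ((twist_inv H (twist_inv H h22) \<otimes>\<^bsub>H\<^esub> twist_inv H m1) \<otimes>\<^bsub>H\<^esub> antipode_inv H h1))
        (coact M m)) (comult H h2)) (comult H h)"
proof -
  interpret M: hom_module k H M "act M" by fact
  interpret M: hom_comodule k H M "coact M" by fact
  let ?MH = "tensor_space k M H" and ?i = "twist_inv H" and ?a = "twist H" and ?S = "antipode_inv H"
  have 1: "tlift k ?MH (\<lambda>m0 m1. tpure k M H (act M a0 m0) (kact a1 m1)) (coact M m) =
      tsum k M H ?MH (\<lambda>m0 m1. tpure k M H (act M a0 m0) (kact a1 m1)) (coact M m)"
    if "a0 \<in> carrier H" "a1 \<in> carrier HH" for a0 a1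
    by (rule tlift_eq_tsum) (simp_all add: that)
  let ?F = "\<lambda>h1 h21 h22 m0 m1. tpure k M H (act M (?i h21) m0)
        ((?i (?i h22) \<otimes>\<^bsub>H\<^esub> ?i m1) \<otimes>\<^bsub>H\<^esub> ?S h1)"
  have 2: "tlift k ?MH (\<lambda>m0 m1. ?F h1 h21 h22 m0 m1) (coact M m) = tsum k M H ?MH (\<lambda>m0 m1. ?F h1 h21 h22 m0 m1) (coact M m)"
    if "h1 \<in> carrier H" "h21 \<in> carrier H" "h22 \<in> carrier H" for h1 h21 h22
    by (rule tlift_eq_tsum) (simp_all add: that)
  have 3: "tlift k ?MH (\<lambda>h21 h22. tlift k ?MH (\<lambda>m0 m1. ?F h1 h21 h22 m0 m1) (coact M m)) (comult H h2) =
      tsum k H H ?MH (\<lambda>h21 h22. tlift k ?MH (\<lambda>m0 m1. ?F h1 h21 h22 m0 m1) (coact M m)) (comult H h2)"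
    if "h1 \<in> carrier H" "h2 \<in> carrier H" for h1 h2
    by (rule tlift_eq_tsum) (simp_all add: that 2)
  have "tlift k ?MH (\<lambda>a0 a1. tlift k ?MH (\<lambda>m0 m1. tpure k M H (act M a0 m0) (kact a1 m1)) (coact M m)) (rho h) =
      tsum k H HH ?MH (\<lambda>a0 a1. tlift k ?MH (\<lambda>m0 m1. tpure k M H (act M a0 m0) (kact a1 m1)) (coact M m)) (rho h)"
    by (rule tlift_eq_tsum) (simp_all add: 1)
  also have "\<dots> = tsum k H HH ?MH (\<lambda>a0 a1. tsum k M H ?MH (\<lambda>m0 m1. tpure k M H (act M a0 m0) (kact a1 m1)) (coact M m)) (rho h)"
    by (simp add: 1)
  also have "\<dots> = sw ?MH (\<lambda>u z. sw ?MH (\<lambda>x y. tsum k M H ?MH (\<lambda>m0 m1.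
      tpure k M H (act M (?a y) m0) ((z \<otimes>\<^bsub>H\<^esub> ?i m1) \<otimes>\<^bsub>H\<^esub> ?a (?S x))) (coact M m)) u) h"
    by (simp add: yd_coaction_sw)
  also have "\<dots> = sw ?MH (\<lambda>x u. sw ?MH (\<lambda>y z. tsum k M H ?MH (\<lambda>m0 m1.
      tpure k M H (act M (?a y) m0) ((z \<otimes>\<^bsub>H\<^esub> ?i m1) \<otimes>\<^bsub>H\<^esub> ?a (?S x))) (coact M m)) u) h"
    by (rule sw_coassoc) simp_all
  also have "\<dots> = tsum k H H ?MH (\<lambda>h1 h2. tsum k H H ?MH (\<lambda>h21 h22. tsum k M H ?MH (\<lambda>m0 m1. ?F h1 h21 h22 m0 m1) (coact M m))
      (comult H h2)) (comult H h)"
    by (subst tsum_nested_right_sw) simp_all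
  also have "\<dots> = tsum k H H ?MH (\<lambda>h1 h2. tlift k ?MH (\<lambda>h21 h22. tlift k ?MH (\<lambda>m0 m1. ?F h1 h21 h22 m0 m1) (coact M m))
      (comult H h2)) (comult H h)"
    by (simp add: 2 3)
  also have "\<dots> = tlift k ?MH (\<lambda>h1 h2. tlift k ?MH (\<lambda>h21 h22. tlift k ?MH (\<lambda>m0 m1. ?F h1 h21 h22 m0 m1) (coact M m))
      (comult H h2)) (comult H h)"
    by (rule tlift_eq_tsum[symmetric]) (simp_all add: 2 3)
  finally show ?thesis .
qed

lemma doi_hopf_module_iff_yetter_drinfeld:
  "doi_hopf_module k H rho H kact M \<longleftrightarrow> yetter_drinfeld_module k H M"
  unfolding doi_hopf_module_def yetter_drinfeld_module_def
  by (intro conj_cong ball_cong refl) (simp only: doi_hopf_compatibility_eq)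

end

section \<open>Categories of modules with coaction\<close>

lemma linear_colinear_mapsD:
  assumes "f \<in> linear_colinear_maps k A C M N"
  shows "f \<in> extensional (carrier M)" "linear_map k M N f"
    "m \<in> carrier M \<Longrightarrow> f (twist M m) = twist N (f m)"
    "\<lbrakk>a \<in> carrier A; m \<in> carrier M\<rbrakk> \<Longrightarrow> f (act M a m) = act N a (f m)"
    "m \<in> carrier M \<Longrightarrow> tmap k N C f (\<lambda>c. c) (coact M m) = coact N (f m)"
  using assms by (auto simp: linear_colinear_maps_def)

text \<open>
  Only the closure of arrows requires an argument, and there only colinearity: on a coaction, tensoring
  with the identity of \<open>C\<close> respects identities and composition. The other laws are those of extensional
  functions.
\<close>

lemma is_category_act_coact:
  assumes P: "\<And>M. P M \<Longrightarrow> hom_module k A M (act M) \<and> hom_comodule k C M (coact M)"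
  shows "is_category (act_coact_category k A C P)"
proof (unfold_locales, unfold act_coact_category_def category.simps mem_Collect_eq, goal_cases)
  case (1 M)
  then interpret M: hom_module k A M "act M" using P by blast
  from 1 interpret M: hom_comodule k C M "coact M" using P by blast
  let ?id = "\<lambda>m\<in>carrier M. m"
  have lin: "linear_map k M M ?id"
    by (rule linear_map_cong[OF linear_map_id]) simp_all
  have "tmap k M C ?id (\<lambda>c. c) (coact M m) = coact M m" if m: "m \<in> carrier M" for m
  proof -
    have "tmap k M C ?id (\<lambda>c. c) (coact M m) = tsum k M C (tensor_space k M C) (\<lambda>a b. tpure k M C (?id a) b) (coact M m)"
      by (rule tmap_tsum) (simp_all add: lin m)
    also have "\<dots> = coact M m"
      using tsum_tpure[OF M.M.space M.C.space M.coaction_closed[OF m]] by simp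
    finally show ?thesis .
  qed
  with lin show ?case by (simp add: linear_colinear_maps_def)
next
  case (2 L M N f g)
  then interpret L: hom_comodule k C L "coact L" using P by blast
  from 2 interpret L': hom_module k A L "act L" using P by blast
  from 2 interpret M: hom_comodule k C M "coact M" using P by blast
  from 2 interpret N: hom_comodule k C N "coact N" using P by blast
  note f = linear_colinear_mapsD[OF 2(4)] and g = linear_colinear_mapsD[OF 2(5)]
  have [simp]: "f x \<in> carrier M" if "x \<in> carrier L" for x
    by (rule linear_map_closed[OF f(2) that])
  have [simp]: "g x \<in> carrier N" if "x \<in> carrier M" for x
    by (rule linear_map_closed[OF g(2) that])
  let ?gf = "compose (carrier L) g f"
  have gf: "?gf x = g (f x)" if "x \<in> carrier L" for x
    using that by (simp add: compose_def)
  have lin: "linear_map k L N ?gf"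
    by (rule linear_map_cong[OF linear_map_comp[OF g(2) f(2)]]) (simp_all add: gf)
  have "tmap k N C ?gf (\<lambda>c. c) (coact L m) = coact N (?gf m)" if m: "m \<in> carrier L" for m
  proof -
    have "coact N (?gf m) = tmap k N C g (\<lambda>c. c) (tmap k M C f (\<lambda>c. c) (coact L m))"
      using m by (simp add: gf f(5) g(5))
    also have "tmap k M C f (\<lambda>c. c) (coact L m) = tsum k L C (tensor_space k M C) (\<lambda>a b. tpure k M C (f a) b) (coact L m)"
      by (rule tmap_tsum) (simp_all add: m f(2))
    also have "tmap k N C g (\<lambda>c. c) \<dots> = tsum k L C (tensor_space k N C) (\<lambda>a b. tpure k N C (g (f a)) b) (coact L m)"
      using m g(2) by simp
    also have "\<dots> = tmap k N C ?gf (\<lambda>c. c) (coact L m)"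
      by (subst tmap_tsum[of k L C]) (simp_all add: m lin gf)
    finally show ?thesis ..
  qed
  then show ?case
    using lin f(3,4) g(3,4) by (simp add: linear_colinear_maps_def gf compose_extensional)
next
  case (3 M N f)
  note f = linear_colinear_mapsD[OF 3(3)]
  show ?case
    by (rule compose_Id[of _ _ "carrier N"]) (use f linear_map_closed[OF f(2)] in auto)
next
  case (4 M N f)
  note f = linear_colinear_mapsD[OF 4(3)]
  show ?case
    by (rule Id_compose[of _ _ "carrier N"]) (use f linear_map_closed[OF f(2)] in auto)
next
  case (5 L M N Q f g h)
  note f = linear_colinear_mapsD[OF 5(5)]
  show ?case
    by (rule compose_assoc[symmetric]) (use linear_map_closed[OF f(2)] in auto)
qed

lemma isomorphic_categories_refl:
  assumes "is_category C" shows "isomorphic_categories C C"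
proof -
  interpret is_category C by fact
  have "is_functor C C (\<lambda>X. X) (\<lambda>X Y f. f)"
    by unfold_locales simp_all
  then show ?thesis unfolding isomorphic_categories_def by blast
qed

context regular_hom_hopf_algebra
begin

text \<open>
  The objects are cut out by equivalent predicates, and arrows, identities and composites are
  defined by the same formulas.
\<close>

lemma categories_equal:
  "doi_hopf_category k H rho H kact = yetter_drinfeld_category k H"
  by (simp add: doi_hopf_category_def yetter_drinfeld_category_def doi_hopf_module_iff_yetter_drinfeld[abs_def])

lemma is_category_yetter_drinfeld: "is_category (yetter_drinfeld_category k H)"
  unfolding yetter_drinfeld_category_def
  by (rule is_category_act_coact) (simp add: yetter_drinfeld_module_def)

end

theorem proposition2p5:
  fixes k :: "('k, 'r) ring_scheme" and H :: "('k, 'h) hom_hopf"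
  assumes "hom_hopf_algebra k H"
    and "bij_betw (antipode H) (carrier H) (carrier H)"
  shows "hom_comodule k (op_tensor_hopf k H) H (yd_coaction k H) \<and>
    doi_hopf_datum k (op_tensor_hopf k H) H (yd_coaction k H) H (yd_action k H) \<and>
    isomorphic_categories
      (doi_hopf_category k H (yd_coaction k H) H (yd_action k H)
        :: (('k, 'h, 'h, 'm) act_coact_space, 'm \<Rightarrow> 'm) category)
      (yetter_drinfeld_category k H
        :: (('k, 'h, 'h, 'm) act_coact_space, 'm \<Rightarrow> 'm) category)"
proof -
  interpret regular_hom_hopf_algebra k H
    using assms by (intro regular_hom_hopf_algebra.intro regular_hom_hopf_algebra_axioms.intro)
  show ?thesis
    unfolding op_tensor_hopf_def categories_equal
    using hom_comodule_yd doi_hopf_datum_yd isomorphic_categories_refl[OF is_category_yetter_drinfeld]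
    by blast
qed

end
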